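(* Let $n$ be even and $d$ a positive integer, and let $H \sim \mathcal{G}_{\mathrm{reg}}(n,d)$, with every edge of $H$ given weight $(n-1)/d$. Then with probability $1-o_n(1)$, $H$ is an $\epsilon$ cut sparsifier of the (unweighted) complete graph $K_n$ on the same vertex set, with \[ \epsilon \le \frac{2\sqrt{2/\pi} + o_{n,d}(1)}{\sqrt d}, \qquad 2\sqrt{2/\pi} = 1.595\ldots \]
   Context: $\mathcal{G}_{\mathrm{reg}}(n,d)$ ($n$ even) is the distribution of the $d$-regular multigraph on vertex set $[n]$ obtained as the disjoint union of $d$ independent uniformly random perfect matchings of $[n]$. For a weighted graph $G=(V,E,w)$ and $S\subseteq V$, $\mathrm{cut}_G(S)$ is the total weight of edges with exactly one endpoint in $S$. A weighted graph $H$ on $V$ is an $\epsilon$ cut sparsifier of $G$ if for all $S\subseteq V$: $(1-\epsilon)\mathrm{cut}_G(S)\le \mathrm{cut}_H(S)\le(1+\epsilon)\mathrm{cut}_G(S)$. The notation $o_{n,d}(1)$ denotes an error term such that after taking the limit $n\to\infty$ one obtains an expression depending only on $d$, which tends to $0$ as $d\to\infty$. *)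

theory Defs
  imports "HOL-Probability.Probability"
begin

text \<open>
  Edges are sets of endpoints; \<open>edges\<close> is a multiset, so parallel edges are allowed (all copies
  of an edge carry the same weight).
\<close>

record 'a wgraph =
  verts :: "'a set"
  edges :: "'a set multiset"
  weight :: "'a set \<Rightarrow> real"

definition cut :: "'a wgraph \<Rightarrow> 'a set \<Rightarrow> real" where
  "cut G S = (\<Sum>e\<in>#filter_mset (\<lambda>e. card (e \<inter> S) = 1) (edges G). weight G e)"

definition cut_sparsifier :: "real \<Rightarrow> 'a wgraph \<Rightarrow> 'a wgraph \<Rightarrow> bool" where
  "cut_sparsifier \<epsilon> H G \<longleftrightarrow> verts H = verts G \<and>
     (\<forall>S\<subseteq>verts G. (1 - \<epsilon>) * cut G S \<le> cut H S \<and> cut H S \<le> (1 + \<epsilon>) * cut G S)"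

definition complete_wgraph :: "nat \<Rightarrow> nat wgraph" where
  "complete_wgraph n =
     \<lparr>verts = {1..n}, edges = mset_set {e. e \<subseteq> {1..n} \<and> card e = 2}, weight = (\<lambda>_. 1)\<rparr>"

definition perfect_matchings :: "nat \<Rightarrow> nat set set set" where
  "perfect_matchings n = {M. partition_on {1..n} M \<and> (\<forall>e\<in>M. card e = 2)}"

text \<open>
  The edge multiset of the union, counted with multiplicity, of \<open>d\<close> independent uniformly random
  perfect matchings of \<open>{1..n}\<close>. For odd \<open>n\<close> there are no perfect matchings and the value is
  meaningless.
\<close>

definition G_reg :: "nat \<Rightarrow> nat \<Rightarrow> nat set multiset pmf" where
  "G_reg n d = map_pmf (\<lambda>M. \<Sum>i<d. mset_set (M i))
     (Pi_pmf {..<d} {} (\<lambda>_. pmf_of_set (perfect_matchings n)))"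

definition weighted_multigraph :: "nat \<Rightarrow> real \<Rightarrow> nat set multiset \<Rightarrow> nat wgraph" where
  "weighted_multigraph n c E = \<lparr>verts = {1..n}, edges = E, weight = (\<lambda>_. c)\<rparr>"

text \<open>The error terms denoted \<open>o\<^bsub>n,d\<^esub>(1)\<close>: first \<open>n \<rightarrow> \<infinity>\<close> for each fixed \<open>d\<close>, then \<open>d \<rightarrow> \<infinity>\<close>.\<close>

definition small_o_nd :: "(nat \<Rightarrow> nat \<Rightarrow> real) \<Rightarrow> bool" where
  "small_o_nd r \<longleftrightarrow>
     (\<exists>g. (\<forall>d>0. (\<lambda>n. r n d) \<longlonglongrightarrow> g d) \<and> g \<longlonglongrightarrow> 0)"

abbreviation even_at_top :: "nat filter" where
  "even_at_top \<equiv> inf sequentially (principal {n. even n})"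

lemma finite_perfect_matchings: "finite (perfect_matchings n)"
proof (rule finite_subset)
  show "perfect_matchings n \<subseteq> Pow (Pow {1..n})"
    by (auto simp: perfect_matchings_def partition_on_def)
qed simp

lemma perfect_matchings_nonempty:
  assumes "even n"
  shows "perfect_matchings n \<noteq> {}"
proof -
  have "\<exists>M. M \<in> perfect_matchings (2 * m)" for m
  proof (induction m)
    case 0
    have "{} \<in> perfect_matchings 0"
      by (simp add: perfect_matchings_def partition_on_def)
    then show ?case by auto
  next
    case (Suc m)
    then obtain M where M: "M \<in> perfect_matchings (2 * m)" by blast
    let ?e = "{2 * m + 1, 2 * m + 2}"
    have "partition_on (?e \<union> {1..2 * m}) (insert ?e M)"
      using M by (intro partition_on_insert[THEN iffD2])
        (auto simp: perfect_matchings_def partition_on_def disjnt_def)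
    moreover have "?e \<union> {1..2 * m} = {1..2 * Suc m}" by auto
    ultimately have "insert ?e M \<in> perfect_matchings (2 * Suc m)"
      using M by (auto simp: perfect_matchings_def)
    then show ?case by blast
  qed
  with assms show ?thesis by (auto elim!: evenE)
qed

end

theory Submission
  imports Defs "HOL-Combinatorics.Permutations" "HOL-Real_Asymp.Real_Asymp"
begin

text \<open>
  A union bound over all cuts only gives the constant \<open>2 * sqrt (ln 2) = 1.665...\<close>; the improvement comes
  from counting extremal cuts only. If some cut has relative deviation more than \<open>\<epsilon>\<close>, take a cut \<open>S\<close>
  whose relative deviation \<open>\<rho>\<close> (of the given sign) is largest. Moving a single vertex across \<open>S\<close> does not
  increase the deviation, which means exactly that the number of crossing edges at each vertex, compared
  with the average over its side, is smaller (for the other sign: larger) by at most \<open>\<rho> d / 2\<close>. Given the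
  numbers of crossing edges in the \<open>d\<close> matchings, the sets of crossing vertices are uniform, hence
  independent Bernoulli up to factors polynomial in \<open>n\<close>. So these \<open>n\<close> conditions are essentially
  independent, and by the central limit theorem each of them has probability
  \<open>Phi (x / (2 * sqrt (a * b))) + o(1)\<close> as \<open>d\<close> grows, where \<open>x = \<rho> * sqrt d\<close>, \<open>a = card S / n\<close> and \<open>b = 1 - a\<close>.
  Together with the entropy \<open>h a\<close> of the choice of \<open>S\<close> and a Chernoff bound for the number of crossing
  edges, the expected number of such cuts is at most
  \<open>exp (n * (h a - x\<^sup>2 / 4 + ln (Phi (x / (2 * sqrt (a * b)))) + o(1)))\<close>. The exponent is negative for all
  \<open>a\<close> bounded away from \<open>0\<close> and \<open>1\<close> and all \<open>x \<ge> 1.5957\<close>, a number below \<open>2 * sqrt (2 / pi)\<close>; for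
  unbalanced cuts the Chernoff bound alone suffices. Hence the error term can be taken to be \<open>0\<close> for
  large \<open>d\<close>, and for the remaining \<open>d\<close> it is chosen so that the trivial value \<open>\<epsilon> = 1\<close> is allowed.
\<close>

section \<open>Lindeberg comparison for sums of independent Bernoulli variables\<close>

text \<open>The constant \<open>2 * sqrt (2 / pi)\<close> is not the root of the exponent at
  \<open>a = 1 / 2\<close> but lies just above it, so the first moment has to be computed almost
  without loss. Errors that survive as \<open>n\<close> grows (the factor \<open>exp \<mu>\<close>
  in the Chernoff bound, the normal approximation) are made tiny by taking \<open>d\<close> large.
  Factors polynomial in \<open>n\<close> are free once \<open>d\<close> is fixed: this pays for
  conditioning on the whole vector of crossing counts, which is what makes every crossing set
  uniform, and for the factor \<open>(n + 1) ^ 2\<close> per matching that buys independence. They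
  are not free for vertex sets of nearly bounded size, where the gain is itself only a power of
  \<open>n\<close>; there the price of fixing \<open>card S\<close> is \<open>exp (card S)\<close>
  per matching instead of \<open>n + 1\<close>. The crossing counts may differ between the
  matchings, so the summands at a vertex are not identically distributed and the normal
  approximation has to be uniform in their parameters; hence a quantitative Lindeberg argument in
  place of a limit theorem.\<close>

definition gauss_avg :: "(real \<Rightarrow> real) \<Rightarrow> real \<Rightarrow> real \<Rightarrow> real" where
  "gauss_avg f \<sigma> z = (\<integral>x. std_normal_density x * f (z + \<sigma> * x) \<partial>lborel)"

text \<open>
  Smoothness is encoded by the third-order Taylor bound itself: in this form it passes to averages
  without differentiating under the integral sign.
\<close>

definition smooth3 :: "real \<Rightarrow> (real \<Rightarrow> real) \<Rightarrow> bool" where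
  "smooth3 B f \<longleftrightarrow> f \<in> borel_measurable borel \<and> (\<forall>z. 0 \<le> f z \<and> f z \<le> 1) \<and>
     (\<exists>f1 f2 C. f1 \<in> borel_measurable borel \<and> f2 \<in> borel_measurable borel \<and>
        (\<forall>z. \<bar>f1 z\<bar> \<le> C \<and> \<bar>f2 z\<bar> \<le> C) \<and>
        (\<forall>z h. \<bar>f (z + h) - f z - h * f1 z - h\<^sup>2 / 2 * f2 z\<bar> \<le> B * \<bar>h\<bar> ^ 3))"

lemma smooth3I:
  assumes "f \<in> borel_measurable borel" "\<And>z. 0 \<le> f z" "\<And>z. f z \<le> 1"
    "f1 \<in> borel_measurable borel" "f2 \<in> borel_measurable borel"
    "\<And>z. \<bar>f1 z\<bar> \<le> C" "\<And>z. \<bar>f2 z\<bar> \<le> C"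
    "\<And>z h. \<bar>f (z + h) - f z - h * f1 z - h\<^sup>2 / 2 * f2 z\<bar> \<le> B * \<bar>h\<bar> ^ 3"
  shows "smooth3 B f"
  unfolding smooth3_def using assms by blast

lemma integrable_std_normal_bounded:
  fixes f :: "real \<Rightarrow> real"
  assumes [measurable]: "f \<in> borel_measurable borel" and "\<And>z. \<bar>f z\<bar> \<le> C"
  shows "integrable lborel (\<lambda>x. std_normal_density x * f x)"
proof (rule Bochner_Integration.integrable_bound)
  show "integrable lborel (\<lambda>x. C * std_normal_density x)" by simp
  show "AE x in lborel. norm (std_normal_density x * f x) \<le> norm (C * std_normal_density x)"
  proof (rule AE_I2)
    fix x
    have "norm (std_normal_density x * f x) = std_normal_density x * \<bar>f x\<bar>" by (simp add: abs_mult)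
    also have "\<dots> \<le> std_normal_density x * C" by (intro mult_left_mono assms) simp
    also have "\<dots> \<le> norm (C * std_normal_density x)" by (simp add: mult.commute)
    finally show "norm (std_normal_density x * f x) \<le> norm (C * std_normal_density x)" .
  qed
qed simp

lemma gauss_avg_integrable:
  assumes [measurable]: "f \<in> borel_measurable borel" and "\<And>z. \<bar>f z\<bar> \<le> C"
  shows "integrable lborel (\<lambda>x. std_normal_density x * f (z + \<sigma> * x))"
  by (rule integrable_std_normal_bounded[where C = C]) (use assms in auto)

lemma gauss_avg_measurable[measurable]:
  assumes [measurable]: "f \<in> borel_measurable borel"
  shows "gauss_avg f \<sigma> \<in> borel_measurable borel"
  unfolding gauss_avg_def by measurable

lemma gauss_avg_bound:
  assumes [measurable]: "f \<in> borel_measurable borel" and b: "\<And>z. \<bar>f z\<bar> \<le> C"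
  shows "\<bar>gauss_avg f \<sigma> z\<bar> \<le> C"
proof -
  have "\<bar>gauss_avg f \<sigma> z\<bar> \<le> (\<integral>x. \<bar>std_normal_density x * f (z + \<sigma> * x)\<bar> \<partial>lborel)"
    unfolding gauss_avg_def by (rule integral_abs_bound)
  also have "\<dots> \<le> (\<integral>x. std_normal_density x * C \<partial>lborel)"
  proof (rule integral_mono)
    show "integrable lborel (\<lambda>x. \<bar>std_normal_density x * f (z + \<sigma> * x)\<bar>)"
      using gauss_avg_integrable[OF assms, of z \<sigma>] by (rule integrable_abs)
  qed (use b in \<open>auto simp: abs_mult intro!: mult_left_mono\<close>)
  finally show ?thesis by simp
qed

text \<open>Integrating out one Bernoulli variable replaces the test function by such an average of
  translates; the Taylor bound survives with the same constant.\<close>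

lemma smooth3_convex_comb:
  assumes "smooth3 B f" "0 \<le> q" "q \<le> 1"
  shows "smooth3 B (\<lambda>z. (1 - q) * f (z + a) + q * f (z + b))"
proof -
  obtain f1 f2 C where [measurable]: "f \<in> borel_measurable borel" "f1 \<in> borel_measurable borel" "f2 \<in> borel_measurable borel"
    and r: "\<And>z. 0 \<le> f z \<and> f z \<le> 1"
    and C: "\<And>z. \<bar>f1 z\<bar> \<le> C" "\<And>z. \<bar>f2 z\<bar> \<le> C"
    and T: "\<And>z h. \<bar>f (z + h) - f z - h * f1 z - h\<^sup>2 / 2 * f2 z\<bar> \<le> B * \<bar>h\<bar> ^ 3"
    using assms(1) unfolding smooth3_def by blast
  have comb: "\<bar>(1 - q) * x + q * y\<bar> \<le> D" if "\<bar>x\<bar> \<le> D" "\<bar>y\<bar> \<le> D" for x y D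
  proof -
    have "\<bar>(1 - q) * x + q * y\<bar> \<le> (1 - q) * \<bar>x\<bar> + q * \<bar>y\<bar>"
      using assms(2,3) by (intro order.trans[OF abs_triangle_ineq]) (simp add: abs_mult)
    also have "\<dots> \<le> (1 - q) * D + q * D" using assms(2,3) that by (intro add_mono mult_left_mono) auto
    finally show ?thesis by (simp add: algebra_simps)
  qed
  have 1: "0 \<le> (1 - q) * f (z + a) + q * f (z + b)" for z using assms(2,3) r by simp
  have 2: "(1 - q) * f (z + a) + q * f (z + b) \<le> 1" for z
    using comb[of "f (z+a)" 1 "f (z+b)"] r by (auto simp: abs_le_iff)
  show ?thesis
  proof (rule smooth3I[where C=C])
    fix z h
    let ?R = "\<lambda>z. f (z + h) - f z - h * f1 z - h\<^sup>2 / 2 * f2 z"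
    have "(1 - q) * f (z + h + a) + q * f (z + h + b) - ((1 - q) * f (z + a) + q * f (z + b))
       - h * ((1 - q) * f1 (z + a) + q * f1 (z + b)) - h\<^sup>2 / 2 * ((1 - q) * f2 (z + a) + q * f2 (z + b))
      = (1 - q) * ?R (z + a) + q * ?R (z + b)" by (simp add: algebra_simps add_divide_distrib diff_divide_distrib)
    with comb[OF T T] show "\<bar>(1 - q) * f (z + h + a) + q * f (z + h + b) - ((1 - q) * f (z + a) + q * f (z + b))
       - h * ((1 - q) * f1 (z + a) + q * f1 (z + b)) - h\<^sup>2 / 2 * ((1 - q) * f2 (z + a) + q * f2 (z + b))\<bar> \<le> B * \<bar>h\<bar> ^ 3"
      by simp
  qed (use 1 2 in \<open>auto intro!: comb C\<close>)
qed

text \<open>The averages of \<open>f1\<close> and \<open>f2\<close> serve as derivatives, since the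
  Taylor bound can be integrated against the normal density.\<close>

lemma smooth3_gauss_avg:
  assumes "smooth3 B f"
  shows "smooth3 B (gauss_avg f \<sigma>)"
proof -
  obtain f1 f2 C where m[measurable]: "f \<in> borel_measurable borel" "f1 \<in> borel_measurable borel" "f2 \<in> borel_measurable borel"
    and r: "\<And>z. 0 \<le> f z \<and> f z \<le> 1"
    and C: "\<And>z. \<bar>f1 z\<bar> \<le> C" "\<And>z. \<bar>f2 z\<bar> \<le> C"
    and T: "\<And>z h. \<bar>f (z + h) - f z - h * f1 z - h\<^sup>2 / 2 * f2 z\<bar> \<le> B * \<bar>h\<bar> ^ 3"
    using assms(1) unfolding smooth3_def by blast
  have r': "\<bar>f z\<bar> \<le> 1" for z using r[of z] by auto
  have i: "integrable lborel (\<lambda>x. std_normal_density x * f (z + \<sigma> * x))"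
    "integrable lborel (\<lambda>x. std_normal_density x * f1 (z + \<sigma> * x))"
    "integrable lborel (\<lambda>x. std_normal_density x * f2 (z + \<sigma> * x))" for z
    using gauss_avg_integrable m r' C by blast+
  show ?thesis
  proof (rule smooth3I[where C=C])
    fix z h
    let ?R = "\<lambda>z. f (z + h) - f z - h * f1 z - h\<^sup>2 / 2 * f2 z"
    have "gauss_avg f \<sigma> (z + h) - gauss_avg f \<sigma> z - h * gauss_avg f1 \<sigma> z - h\<^sup>2 / 2 * gauss_avg f2 \<sigma> z
      = gauss_avg ?R \<sigma> z"
    proof -
      have "gauss_avg ?R \<sigma> z = (\<integral>x. std_normal_density x * f (z + h + \<sigma> * x) - std_normal_density x * f (z + \<sigma> * x)
         - h * (std_normal_density x * f1 (z + \<sigma> * x)) - h\<^sup>2 / 2 * (std_normal_density x * f2 (z + \<sigma> * x)) \<partial>lborel)"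
        unfolding gauss_avg_def by (intro Bochner_Integration.integral_cong refl) (simp add: algebra_simps)
      also have "\<dots> = gauss_avg f \<sigma> (z + h) - gauss_avg f \<sigma> z - h * gauss_avg f1 \<sigma> z - h\<^sup>2 / 2 * gauss_avg f2 \<sigma> z"
        unfolding gauss_avg_def
        using i(1)[of "z + h"] i[of z]
        by (subst Bochner_Integration.integral_diff; (subst Bochner_Integration.integral_diff)?; auto intro!: Bochner_Integration.integrable_diff)
      finally show ?thesis by simp
    qed
    moreover have "\<bar>gauss_avg ?R \<sigma> z\<bar> \<le> B * \<bar>h\<bar> ^ 3"
      by (rule gauss_avg_bound) (use T in auto)
    ultimately show "\<bar>gauss_avg f \<sigma> (z + h) - gauss_avg f \<sigma> z - h * gauss_avg f1 \<sigma> z - h\<^sup>2 / 2 * gauss_avg f2 \<sigma> z\<bar> \<le> B * \<bar>h\<bar> ^ 3"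
      by simp
  next
    fix z
    show "0 \<le> gauss_avg f \<sigma> z" unfolding gauss_avg_def using r by (intro integral_nonneg_AE) auto
    show "gauss_avg f \<sigma> z \<le> 1" using gauss_avg_bound[of f 1 \<sigma> z] r' by auto
  qed (auto intro!: gauss_avg_bound C)
qed

text \<open>A centred Bernoulli variable and a normal one of the same variance agree in their first
  two moments, so both averages equal the second-order Taylor value \<open>A\<close> up to third
  absolute moments.\<close>

lemma gauss_avg_step:
  assumes "smooth3 B u" "0 \<le> q" "q \<le> 1" "0 \<le> B"
  shows "\<bar>(1 - q) * u (z - c * q) + q * u (z + c * (1 - q)) - gauss_avg u (\<bar>c\<bar> * sqrt (q * (1 - q))) z\<bar>
    \<le> 2 * B * \<bar>c\<bar> ^ 3"
proof -
  obtain f1 f2 C where m[measurable]: "u \<in> borel_measurable borel" "f1 \<in> borel_measurable borel" "f2 \<in> borel_measurable borel"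
    and r: "\<And>z. 0 \<le> u z \<and> u z \<le> 1"
    and C: "\<And>z. \<bar>f1 z\<bar> \<le> C" "\<And>z. \<bar>f2 z\<bar> \<le> C"
    and T: "\<And>z h. \<bar>u (z + h) - u z - h * f1 z - h\<^sup>2 / 2 * f2 z\<bar> \<le> B * \<bar>h\<bar> ^ 3"
    using assms(1) unfolding smooth3_def by blast
  define w where "w = \<bar>c\<bar> * sqrt (q * (1 - q))"
  have w2: "w\<^sup>2 = c\<^sup>2 * (q * (1 - q))" unfolding w_def using assms by (simp add: power_mult_distrib)
  have w0: "0 \<le> w" unfolding w_def using assms by simp
  define A where "A = u z + c\<^sup>2 * (q * (1 - q)) / 2 * f2 z"
  have cube: "\<bar>c * p\<bar> ^ 3 \<le> \<bar>c\<bar> ^ 3" if "0 \<le> p" "p \<le> 1" for p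
    using that by (intro power_mono) (auto simp: abs_mult mult_left_le)
  have 1: "\<bar>(1 - q) * u (z - c * q) + q * u (z + c * (1 - q)) - A\<bar> \<le> B * \<bar>c\<bar> ^ 3"
  proof -
    let ?R = "\<lambda>h. u (z + h) - u z - h * f1 z - h\<^sup>2 / 2 * f2 z"
    have "(1 - q) * u (z - c * q) + q * u (z + c * (1 - q)) - A = (1 - q) * ?R (- (c * q)) + q * ?R (c * (1 - q))"
      unfolding A_def by (simp add: algebra_simps power2_eq_square add_divide_distrib diff_divide_distrib)
    also have "\<bar>\<dots>\<bar> \<le> (1 - q) * \<bar>?R (- (c * q))\<bar> + q * \<bar>?R (c * (1 - q))\<bar>"
      using assms by (intro order.trans[OF abs_triangle_ineq]) (simp add: abs_mult)
    also have "\<dots> \<le> (1 - q) * (B * \<bar>c\<bar> ^ 3) + q * (B * \<bar>c\<bar> ^ 3)"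
      using assms T[of z "- (c * q)"] T[of z "c * (1 - q)"] cube[of q] cube[of "1 - q"]
      by (intro add_mono mult_left_mono order.trans[OF T] mult_left_mono) auto
    finally show ?thesis by (simp add: algebra_simps)
  qed
  have 2: "\<bar>gauss_avg u w z - A\<bar> \<le> B * \<bar>c\<bar> ^ 3"
  proof -
    let ?n = std_normal_density
    let ?R = "\<lambda>h. u (z + h) - u z - h * f1 z - h\<^sup>2 / 2 * f2 z"
    have iu: "integrable lborel (\<lambda>x. ?n x * u (z + w * x))"
      by (rule gauss_avg_integrable[where C=1]) (use r in \<open>auto simp: abs_of_nonneg\<close>)
    have i1: "integrable lborel (\<lambda>x. ?n x * x)" "(\<integral>x. ?n x * x \<partial>lborel) = 0"
      using integrable_std_normal_moment[of 1] integral_std_normal_moment_odd[of 0] by auto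
    have i2: "integrable lborel (\<lambda>x. ?n x * x\<^sup>2)" "(\<integral>x. ?n x * x\<^sup>2 \<partial>lborel) = 1"
      using integrable_std_normal_moment[of 2] integral_std_normal_moment_even[of 1] by (auto simp: fact_numeral)
    have i3: "integrable lborel (\<lambda>x. ?n x * \<bar>x\<bar>^3)" "(\<integral>x. ?n x * \<bar>x\<bar>^3 \<partial>lborel) = 2 * sqrt (2 / pi)"
      using integrable_std_normal_moment_abs[of 3] integral_std_normal_moment_abs_odd[of 1] by (auto simp: numeral_3_eq_3)
    have e: "(\<lambda>x. ?n x * ?R (w * x)) = (\<lambda>x. ?n x * u (z + w * x) - u z * ?n x - w * f1 z * (?n x * x) - w\<^sup>2 / 2 * f2 z * (?n x * x\<^sup>2))"
      by (auto simp: fun_eq_iff algebra_simps power2_eq_square)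
    have iR: "integrable lborel (\<lambda>x. ?n x * ?R (w * x))"
      unfolding e using iu i1 i2 by (intro Bochner_Integration.integrable_diff) auto
    have "(\<integral>x. ?n x * ?R (w * x) \<partial>lborel) = gauss_avg u w z - A"
      unfolding e using iu i1 i2
      by (simp add: gauss_avg_def A_def w2 Bochner_Integration.integral_diff)
    then have "\<bar>gauss_avg u w z - A\<bar> \<le> (\<integral>x. \<bar>?n x * ?R (w * x)\<bar> \<partial>lborel)"
      using integral_abs_bound[of lborel "\<lambda>x. ?n x * ?R (w * x)"] by simp
    also have "\<dots> \<le> (\<integral>x. B * w ^ 3 * (?n x * \<bar>x\<bar> ^ 3) \<partial>lborel)"
    proof (rule integral_mono)
      show "integrable lborel (\<lambda>x. \<bar>?n x * ?R (w * x)\<bar>)" using iR by (rule integrable_abs)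
      show "integrable lborel (\<lambda>x. B * w ^ 3 * (?n x * \<bar>x\<bar> ^ 3))" using i3 by auto
      fix x
      have "\<bar>?n x * ?R (w * x)\<bar> \<le> ?n x * (B * \<bar>w * x\<bar> ^ 3)"
        unfolding abs_mult[of "?n x"] using T[of z "w * x"] by (simp add: mult_left_mono)
      also have "\<dots> = B * w ^ 3 * (?n x * \<bar>x\<bar> ^ 3)" using w0 by (simp add: abs_mult power_mult_distrib)
      finally show "\<bar>?n x * ?R (w * x)\<bar> \<le> B * w ^ 3 * (?n x * \<bar>x\<bar> ^ 3)" .
    qed
    also have "\<dots> = B * w ^ 3 * (2 * sqrt (2 / pi))" using i3 by simp
    \<comment> \<open>Here \<open>2 * sqrt (2 / pi)\<close> is the third absolute moment of the
      standard normal law; it is at most 2, and the standard deviation \<open>w\<close> is at most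
      \<open>\<bar>c\<bar> / 2\<close>.\<close>
    also have "\<dots> \<le> B * \<bar>c\<bar> ^ 3"
    proof -
      have "q * (1 - q) \<le> (1/2)\<^sup>2" using zero_le_power2[of "q - 1/2"] by (simp add: power2_eq_square algebra_simps)
      then have "sqrt (q * (1 - q)) \<le> 1 / 2" by (intro real_le_lsqrt) auto
      then have "w \<le> \<bar>c\<bar> / 2" unfolding w_def using mult_left_mono[of "sqrt (q * (1 - q))" "1/2" "\<bar>c\<bar>"] by simp
      then have w3: "w ^ 3 \<le> (\<bar>c\<bar> / 2) ^ 3" using w0 by (intro power_mono)
      have "sqrt (2 / pi) \<le> 1" using pi_gt3 by simp
      then have "w ^ 3 * (2 * sqrt (2 / pi)) \<le> (\<bar>c\<bar> / 2) ^ 3 * 2" using w3 w0 by (intro mult_mono) auto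
      also have "\<dots> \<le> \<bar>c\<bar> ^ 3" by (simp add: power_divide)
      finally show ?thesis using assms(4) by (simp add: mult.assoc mult_left_mono)
    qed
    finally show ?thesis .
  qed
  show ?thesis using 1 2 unfolding w_def[symmetric] by linarith
qed

text \<open>Independent normal variables add up to a normal one. The computation runs through
  nonnegative integrals, where Fubini needs no integrability; the zero cases are split off because
  the convolution law for densities requires positive deviations.\<close>

lemma gauss_avg_gauss_avg:
  assumes [measurable]: "f \<in> borel_measurable borel" and r: "\<And>z. 0 \<le> f z" "\<And>z. f z \<le> 1"
    and "0 \<le> \<sigma>" "0 \<le> \<tau>"
  shows "gauss_avg (gauss_avg f \<sigma>) \<tau> z = gauss_avg f (sqrt (\<sigma>\<^sup>2 + \<tau>\<^sup>2)) z"
proof (cases "\<sigma> = 0 \<or> \<tau> = 0")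
  case True
  have "gauss_avg g 0 z = g z" for g z unfolding gauss_avg_def by simp
  moreover from this have "gauss_avg f 0 = f" by auto
  ultimately show ?thesis using True assms(4,5) by auto
next
  case False
  with assms have st: "0 < \<sigma>" "0 < \<tau>" by auto
  have r': "\<bar>f z\<bar> \<le> 1" for z using r[of z] by auto
  have nn: "ennreal (gauss_avg g s z) = (\<integral>\<^sup>+x. ennreal (normal_density 0 s x) * ennreal (g (z + x)) \<partial>lborel)"
    if [measurable]: "g \<in> borel_measurable borel" and g: "\<And>z. 0 \<le> g z" "\<And>z. g z \<le> 1" and "0 < s" for g s z
  proof -
    have "ennreal (gauss_avg g s z) = (\<integral>\<^sup>+x. ennreal (std_normal_density x * g (z + s * x)) \<partial>lborel)"
      unfolding gauss_avg_def
      using g by (intro nn_integral_eq_integral[symmetric] gauss_avg_integrable[where C=1]) (auto simp: abs_of_nonneg)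
    also have "\<dots> = (\<integral>\<^sup>+x. ennreal s * (ennreal (normal_density 0 s (0 + s * x)) * ennreal (g (z + (0 + s * x)))) \<partial>lborel)"
    proof (intro nn_integral_cong)
      fix x
      have "std_normal_density x = s * normal_density 0 s (s * x)"
        using that(4) unfolding normal_density_def by (simp add: power_mult_distrib real_sqrt_mult)
      then show "ennreal (std_normal_density x * g (z + s * x)) = ennreal s * (ennreal (normal_density 0 s (0 + s * x)) * ennreal (g (z + (0 + s * x))))"
        using g that(4) by (simp add: ennreal_mult' mult.assoc)
    qed
    also have "\<dots> = ennreal s * (\<integral>\<^sup>+x. ennreal (normal_density 0 s (0 + s * x)) * ennreal (g (z + (0 + s * x))) \<partial>lborel)"
      by (rule nn_integral_cmult) simp
    also have "\<dots> = (\<integral>\<^sup>+x. ennreal (normal_density 0 s x) * ennreal (g (z + x)) \<partial>lborel)"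
      using that(4) by (subst nn_integral_real_affine[where c=s and t=0]) auto
    finally show ?thesis .
  qed
  have gr: "0 \<le> gauss_avg f \<sigma> z" "gauss_avg f \<sigma> z \<le> 1" for z
    using r gauss_avg_bound[of f 1 \<sigma> z] r' unfolding gauss_avg_def by (auto intro!: integral_nonneg_AE)
  let ?N = "\<lambda>s x. ennreal (normal_density 0 s x)"
  let ?f = "\<lambda>z. ennreal (f z)"
  have "ennreal (gauss_avg f (sqrt (\<sigma>\<^sup>2 + \<tau>\<^sup>2)) z) = (\<integral>\<^sup>+x. ?N (sqrt (\<sigma>\<^sup>2 + \<tau>\<^sup>2)) x * ?f (z + x) \<partial>lborel)"
    using r st by (intro nn) (auto simp: add_pos_pos)
  also have "\<dots> = (\<integral>\<^sup>+x. (\<integral>\<^sup>+y. ennreal (normal_density 0 \<sigma> (x - y) * normal_density 0 \<tau> y) \<partial>lborel) * ?f (z + x) \<partial>lborel)"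
    using conv_normal_density_zero_mean[OF st, THEN fun_cong] by (simp add: fun_eq_iff)
  also have "\<dots> = (\<integral>\<^sup>+x. (\<integral>\<^sup>+y. ?N \<tau> y * (?N \<sigma> (x - y) * ?f (z + x)) \<partial>lborel) \<partial>lborel)"
    by (intro nn_integral_cong, subst nn_integral_multc[symmetric]) (auto simp: ennreal_mult' ac_simps)
  also have "\<dots> = (\<integral>\<^sup>+y. (\<integral>\<^sup>+x. ?N \<tau> y * (?N \<sigma> (x - y) * ?f (z + x)) \<partial>lborel) \<partial>lborel)"
    by (rule lborel_pair.Fubini') simp
  also have "\<dots> = (\<integral>\<^sup>+y. ?N \<tau> y * (\<integral>\<^sup>+x. ?N \<sigma> (x - y) * ?f (z + x) \<partial>lborel) \<partial>lborel)"
    by (intro nn_integral_cong nn_integral_cmult) simp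
  also have "\<dots> = (\<integral>\<^sup>+y. ?N \<tau> y * (\<integral>\<^sup>+x. ?N \<sigma> x * ?f (z + y + x) \<partial>lborel) \<partial>lborel)"
  proof (rule nn_integral_cong, rule arg_cong[where f="(*) (?N \<tau> _)"])
    fix y
    show "(\<integral>\<^sup>+x. ?N \<sigma> (x - y) * ?f (z + x) \<partial>lborel) = (\<integral>\<^sup>+x. ?N \<sigma> x * ?f (z + y + x) \<partial>lborel)"
      by (subst nn_integral_real_affine[where c=1 and t=y]) (auto simp: ac_simps)
  qed
  also have "\<dots> = (\<integral>\<^sup>+y. ?N \<tau> y * ennreal (gauss_avg f \<sigma> (z + y)) \<partial>lborel)"
    by (intro nn_integral_cong arg_cong2[where f="(*)"] refl nn[symmetric]) (use r st in auto)
  also have "\<dots> = ennreal (gauss_avg (gauss_avg f \<sigma>) \<tau> z)"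
    by (intro nn[symmetric]) (use gr st in auto)
  finally have "gauss_avg (gauss_avg f \<sigma>) \<tau> z = gauss_avg f (sqrt (\<sigma>\<^sup>2 + \<tau>\<^sup>2)) z"
    by (subst (asm) ennreal_inj) (use gr r in \<open>auto simp: gauss_avg_def intro!: integral_nonneg_AE\<close>)
  then show ?thesis .
qed

text \<open>The expectation of \<open>f\<close> at the number of successes in \<open>d\<close>
  independent trials with probabilities \<open>q l\<close>. The sum runs over the set of successful
  trials, the form in which \<open>sum_prod_bernoulli_vertices\<close> produces it.\<close>

definition bernoulli_sum_avg :: "nat \<Rightarrow> (nat \<Rightarrow> real) \<Rightarrow> (nat \<Rightarrow> real) \<Rightarrow> real" where
  "bernoulli_sum_avg d q f = (\<Sum>L\<in>Pow {..<d}. (\<Prod>l<d. if l \<in> L then q l else 1 - q l) * f (card L))"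

lemma bernoulli_sum_avg_0 [simp]: "bernoulli_sum_avg 0 q f = f 0"
  by (simp add: bernoulli_sum_avg_def)

lemma bernoulli_sum_avg_Suc:
  "bernoulli_sum_avg (Suc d) q f = bernoulli_sum_avg d q (\<lambda>m. (1 - q d) * f m + q d * f (Suc m))"
proof -
  let ?w = "\<lambda>d L. (\<Prod>l<d. if l \<in> L then q l else 1 - q l)"
  have "bernoulli_sum_avg (Suc d) q f = (\<Sum>L\<in>Pow {..<d} \<union> insert d ` Pow {..<d}. ?w (Suc d) L * f (card L))"
    by (simp add: bernoulli_sum_avg_def lessThan_Suc Pow_insert del: prod.lessThan_Suc)
  also have "\<dots> = (\<Sum>L\<in>Pow {..<d}. ?w (Suc d) L * f (card L)) + (\<Sum>L\<in>insert d ` Pow {..<d}. ?w (Suc d) L * f (card L))"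
    by (intro sum.union_disjoint) auto
  also have "(\<Sum>L\<in>insert d ` Pow {..<d}. ?w (Suc d) L * f (card L)) = (\<Sum>L\<in>Pow {..<d}. ?w (Suc d) (insert d L) * f (card (insert d L)))"
    by (subst sum.reindex) (auto simp: inj_on_def insert_ident)
  also have "\<dots> = (\<Sum>L\<in>Pow {..<d}. ?w d L * (q d * f (Suc (card L))))"
  proof (rule sum.cong)
    fix L assume L: "L \<in> Pow {..<d}"
    then have "finite L" "d \<notin> L" by (auto intro: finite_subset)
    moreover have "?w d (insert d L) = ?w d L" by (intro prod.cong) auto
    ultimately show "?w (Suc d) (insert d L) * f (card (insert d L)) = ?w d L * (q d * f (Suc (card L)))"
      by simp
  qed simp
  also have "(\<Sum>L\<in>Pow {..<d}. ?w (Suc d) L * f (card L)) = (\<Sum>L\<in>Pow {..<d}. ?w d L * ((1 - q d) * f (card L)))"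
    by (intro sum.cong) auto
  finally show ?thesis by (simp add: bernoulli_sum_avg_def sum.distrib[symmetric] ring_distribs)
qed

lemma bernoulli_sum_avg_mono:
  assumes "\<And>l. l < d \<Longrightarrow> 0 \<le> q l \<and> q l \<le> 1" "\<And>m. m \<le> d \<Longrightarrow> f m \<le> g m"
  shows "bernoulli_sum_avg d q f \<le> bernoulli_sum_avg d q g"
  unfolding bernoulli_sum_avg_def
proof (intro sum_mono mult_left_mono prod_nonneg)
  fix L assume "L \<in> Pow {..<d}"
  then have "card L \<le> d" using card_mono[of "{..<d}" L] by auto
  then show "f (card L) \<le> g (card L)" by (rule assms)
qed (use assms in auto)

text \<open>Lindeberg replacement: the last variable is absorbed into the test function
  \<open>f'\<close>, which obeys the same Taylor bound; after the induction hypothesis only this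
  variable is left to be exchanged, and the variances of the normal parts add.\<close>

lemma bernoulli_sum_lindeberg:
  assumes "\<And>l. l < d \<Longrightarrow> 0 \<le> q l \<and> q l \<le> 1" "smooth3 B f" "0 \<le> B"
  shows "\<bar>bernoulli_sum_avg d q (\<lambda>m. f (z + c * (real m - (\<Sum>l<d. q l))))
    - gauss_avg f (\<bar>c\<bar> * sqrt (\<Sum>l<d. q l * (1 - q l))) z\<bar> \<le> 2 * B * \<bar>c\<bar> ^ 3 * real d"
  using assms
proof (induction d arbitrary: f z)
  case 0
  then show ?case by (simp add: gauss_avg_def)
next
  case (Suc d)
  let ?q = "q d"
  have q: "0 \<le> ?q" "?q \<le> 1" using Suc.prems(1)[of d] by auto
  define s where "s = (\<Sum>l<d. q l * (1 - q l))"
  have s0: "0 \<le> s" unfolding s_def using Suc.prems(1) by (intro sum_nonneg mult_nonneg_nonneg) (auto simp: less_Suc_eq)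
  define \<sigma> where "\<sigma> = \<bar>c\<bar> * sqrt s"
  define f' where "f' = (\<lambda>z. (1 - ?q) * f (z + (- c * ?q)) + ?q * f (z + c * (1 - ?q)))"
  have f'3: "smooth3 B f'" unfolding f'_def by (rule smooth3_convex_comb) (use Suc q in auto)
  have m[measurable]: "f \<in> borel_measurable borel" and r: "\<And>z. 0 \<le> f z" "\<And>z. f z \<le> 1"
    using Suc.prems(2) unfolding smooth3_def by auto
  have r': "\<bar>f z\<bar> \<le> 1" for z using r[of z] by auto
  have 1: "bernoulli_sum_avg (Suc d) q (\<lambda>m. f (z + c * (real m - (\<Sum>l<Suc d. q l)))) =
    bernoulli_sum_avg d q (\<lambda>m. f' (z + c * (real m - (\<Sum>l<d. q l))))"
    unfolding bernoulli_sum_avg_Suc f'_def by (simp add: algebra_simps)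
  have 2: "\<bar>bernoulli_sum_avg d q (\<lambda>m. f' (z + c * (real m - (\<Sum>l<d. q l)))) - gauss_avg f' \<sigma> z\<bar> \<le> 2 * B * \<bar>c\<bar> ^ 3 * real d"
    unfolding \<sigma>_def s_def using Suc.prems f'3 by (intro Suc.IH) auto
  have i: "integrable lborel (\<lambda>x. std_normal_density x * f (z + \<sigma> * x))" for z
    using gauss_avg_integrable m r' by blast
  have 3: "gauss_avg f' \<sigma> z = (1 - ?q) * gauss_avg f \<sigma> (z - c * ?q) + ?q * gauss_avg f \<sigma> (z + c * (1 - ?q))"
  proof -
    have "gauss_avg f' \<sigma> z = (\<integral>x. (1 - ?q) * (std_normal_density x * f (z - c * ?q + \<sigma> * x)) + ?q * (std_normal_density x * f (z + c * (1 - ?q) + \<sigma> * x)) \<partial>lborel)"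
      unfolding gauss_avg_def f'_def by (intro Bochner_Integration.integral_cong refl) (simp add: algebra_simps)
    also have "\<dots> = (1 - ?q) * gauss_avg f \<sigma> (z - c * ?q) + ?q * gauss_avg f \<sigma> (z + c * (1 - ?q))"
      unfolding gauss_avg_def using i by (subst Bochner_Integration.integral_add) auto
    finally show ?thesis .
  qed
  have 4: "\<bar>gauss_avg f' \<sigma> z - gauss_avg (gauss_avg f \<sigma>) (\<bar>c\<bar> * sqrt (?q * (1 - ?q))) z\<bar> \<le> 2 * B * \<bar>c\<bar> ^ 3"
    unfolding 3 by (rule gauss_avg_step) (use q Suc.prems smooth3_gauss_avg in auto)
  have 5: "gauss_avg (gauss_avg f \<sigma>) (\<bar>c\<bar> * sqrt (?q * (1 - ?q))) z = gauss_avg f (\<bar>c\<bar> * sqrt (\<Sum>l<Suc d. q l * (1 - q l))) z"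
  proof -
    have "gauss_avg (gauss_avg f \<sigma>) (\<bar>c\<bar> * sqrt (?q * (1 - ?q))) z = gauss_avg f (sqrt (\<sigma>\<^sup>2 + (\<bar>c\<bar> * sqrt (?q * (1 - ?q)))\<^sup>2)) z"
      using r q s0 by (intro gauss_avg_gauss_avg) (auto simp: \<sigma>_def)
    also have "\<sigma>\<^sup>2 + (\<bar>c\<bar> * sqrt (?q * (1 - ?q)))\<^sup>2 = c\<^sup>2 * (\<Sum>l<Suc d. q l * (1 - q l))"
      using q s0 by (simp add: \<sigma>_def power_mult_distrib distrib_left flip: s_def)
    also have "sqrt \<dots> = \<bar>c\<bar> * sqrt (\<Sum>l<Suc d. q l * (1 - q l))" by (simp add: real_sqrt_mult)
    finally show ?thesis .
  qed
  show ?case using 1 2 4 5 by (simp add: algebra_simps abs_le_iff)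
qed

section \<open>Edges of a random perfect matching across a vertex set\<close>

definition cross_edges :: "nat set set \<Rightarrow> nat set \<Rightarrow> nat set set" where
  "cross_edges M S = {e \<in> M. card (e \<inter> S) = 1}"

definition cross_verts :: "nat set set \<Rightarrow> nat set \<Rightarrow> nat set" where
  "cross_verts M S = \<Union>(cross_edges M S)"

lemma perfect_matchingsD:
  assumes "M \<in> perfect_matchings n"
  shows "finite M" "\<Union>M = {1..n}" "disjoint M" "\<And>e. e \<in> M \<Longrightarrow> card e = 2"
    "\<And>e. e \<in> M \<Longrightarrow> finite e" "\<And>e. e \<in> M \<Longrightarrow> e \<subseteq> {1..n}"
proof -
  have p: "partition_on {1..n} M" using assms by (simp add: perfect_matchings_def)
  then show 1: "\<Union>M = {1..n}" "disjoint M" by (auto simp: partition_on_def)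
  show 2: "\<And>e. e \<in> M \<Longrightarrow> card e = 2" using assms by (simp add: perfect_matchings_def)
  show "\<And>e. e \<in> M \<Longrightarrow> finite e" using 2 by (metis card.infinite zero_neq_numeral)
  show 3: "\<And>e. e \<in> M \<Longrightarrow> e \<subseteq> {1..n}" using 1 by auto
  have "M \<subseteq> Pow {1..n}" using 3 by auto
  then show "finite M" by (rule finite_subset) simp
qed

lemma sum_card_Int_matching:
  assumes "M \<in> perfect_matchings n" "C \<subseteq> M"
  shows "card (\<Union>C \<inter> S) = (\<Sum>e\<in>C. card (e \<inter> S))"
proof -
  note M = perfect_matchingsD[OF assms(1)]
  have "\<Union>C \<inter> S = (\<Union>e\<in>C. e \<inter> S)" by auto
  moreover have "card (\<Union>e\<in>C. e \<inter> S) = (\<Sum>e\<in>C. card (e \<inter> S))"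
  proof (rule card_UN_disjoint)
    show "finite C" using assms(2) M(1) by (rule finite_subset)
    show "\<forall>e\<in>C. finite (e \<inter> S)" using M(5) assms(2) by auto
    show "\<forall>e\<in>C. \<forall>e'\<in>C. e \<noteq> e' \<longrightarrow> e \<inter> S \<inter> (e' \<inter> S) = {}"
      using M(3) assms(2) unfolding disjoint_def by blast
  qed
  ultimately show ?thesis by simp
qed

lemma card_matching:
  assumes "M \<in> perfect_matchings n"
  shows "2 * card M = n"
  using sum_card_Int_matching[OF assms order.refl, of UNIV] perfect_matchingsD[OF assms] by simp

lemma cross_edges_sub: "cross_edges M S \<subseteq> M" by (auto simp: cross_edges_def)

lemma cross_verts_sub:
  assumes "M \<in> perfect_matchings n" shows "cross_verts M S \<subseteq> {1..n}"
  using perfect_matchingsD(6)[OF assms] by (auto simp: cross_verts_def cross_edges_def)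

lemma card_cross_verts:
  assumes "M \<in> perfect_matchings n"
  shows "card (cross_verts M S \<inter> S) = card (cross_edges M S)"
    "card (cross_verts M S - S) = card (cross_edges M S)"
proof -
  note M = perfect_matchingsD[OF assms]
  show "card (cross_verts M S \<inter> S) = card (cross_edges M S)"
    unfolding cross_verts_def sum_card_Int_matching[OF assms cross_edges_sub]
    by (simp add: cross_edges_def)
  have c: "card (e \<inter> - S) = 1" if "e \<in> cross_edges M S" for e
  proof -
    from that have e: "e \<in> M" "card (e \<inter> S) = 1" by (auto simp: cross_edges_def)
    have "card e = card (e \<inter> S) + card (e \<inter> - S)"
      using M(5)[OF e(1)] by (subst card_Un_disjoint[symmetric]) (auto intro!: arg_cong[where f=card])
    with e M(4)[OF e(1)] show ?thesis by simp
  qed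
  have "cross_verts M S - S = \<Union>(cross_edges M S) \<inter> - S" by (auto simp: cross_verts_def)
  then show "card (cross_verts M S - S) = card (cross_edges M S)"
    using sum_card_Int_matching[OF assms cross_edges_sub, of S "- S"] c by simp
qed

text \<open>Only the edge at \<open>v\<close> is affected, and moving \<open>v\<close> toggles
  whether it crosses.\<close>

lemma card_cross_edges_flip:
  assumes "M \<in> perfect_matchings n" "v \<in> {1..n}"
    and S': "S' = (if v \<in> S then S - {v} else insert v S)"
  shows "real (card (cross_edges M S')) = real (card (cross_edges M S)) + (if v \<in> cross_verts M S then - 1 else 1)"
proof -
  note M = perfect_matchingsD[OF assms(1)]
  obtain e where e: "e \<in> M" "v \<in> e" using M(2) assms(2) by blast
  have uniq: "e' = e" if "e' \<in> M" "v \<in> e'" for e' using M(3) e that unfolding disjoint_def by blast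
  have vX: "v \<in> cross_verts M S \<longleftrightarrow> card (e \<inter> S) = 1"
  proof
    assume "v \<in> cross_verts M S"
    then obtain e' where "e' \<in> M" "v \<in> e'" "card (e' \<inter> S) = 1" by (auto simp: cross_verts_def cross_edges_def)
    with uniq[of e'] show "card (e \<inter> S) = 1" by simp
  next
    assume "card (e \<inter> S) = 1"
    with e show "v \<in> cross_verts M S" by (auto simp: cross_verts_def cross_edges_def)
  qed
  have oth: "e' \<inter> S' = e' \<inter> S" if "e' \<in> M" "e' \<noteq> e" for e'
    using uniq that S' by (auto split: if_splits)
  obtain w where w: "e = {v, w}" "w \<noteq> v"
    using M(4)[OF e(1)] e(2) by (metis card_2_iff insert_iff insert_commute singletonD)
  have flip: "card (e \<inter> S') = 1 \<longleftrightarrow> card (e \<inter> S) \<noteq> 1"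
    using w S' by (cases "v \<in> S"; cases "w \<in> S") (auto simp: Int_insert_left)
  have fin: "finite (cross_edges M U)" for U using M(1) by (simp add: cross_edges_def)
  have rest: "cross_edges M S' - {e} = cross_edges M S - {e}"
    unfolding cross_edges_def using oth by (intro set_eqI iffI; clarsimp; metis)
  show ?thesis
  proof (cases "card (e \<inter> S) = 1")
    case True
    then have "e \<in> cross_edges M S" "e \<notin> cross_edges M S'" using e flip by (auto simp: cross_edges_def)
    then have "cross_edges M S = insert e (cross_edges M S')" "e \<notin> cross_edges M S'" using rest by auto
    then show ?thesis using True vX fin by simp
  next
    case False
    then have "e \<in> cross_edges M S'" "e \<notin> cross_edges M S" using e flip by (auto simp: cross_edges_def)
    then have "cross_edges M S' = insert e (cross_edges M S)" "e \<notin> cross_edges M S" using rest by auto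
    then show ?thesis using False vX fin by simp
  qed
qed

section \<open>Generating functions over vertex sets for a fixed matching\<close>

lemma sum_Pow_Union_prod:
  fixes g :: "'a set \<Rightarrow> 'a set \<Rightarrow> real"
  assumes "finite M" "disjoint M" "\<And>e. e \<in> M \<Longrightarrow> finite e"
  shows "(\<Sum>S\<in>Pow (\<Union>M). \<Prod>e\<in>M. g e (e \<inter> S)) = (\<Prod>e\<in>M. \<Sum>U\<in>Pow e. g e U)"
  using assms
proof (induction M rule: finite_induct)
  case empty
  then show ?case by simp
next
  case (insert e M)
  have dis: "e \<inter> \<Union>M = {}" using insert.prems(1) insert.hyps by (auto simp: disjoint_def)
  have dM: "disjoint M" using insert.prems(1) by (auto simp: disjoint_def)
  have bij: "bij_betw (\<lambda>(U, R). U \<union> R) (Pow e \<times> Pow (\<Union>M)) (Pow (\<Union>(insert e M)))"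
    by (rule bij_betwI[where g="\<lambda>S. (e \<inter> S, \<Union>M \<inter> S)"]) (use dis in auto)
  have "(\<Sum>S\<in>Pow (\<Union>(insert e M)). \<Prod>e'\<in>insert e M. g e' (e' \<inter> S))
      = (\<Sum>(U, R)\<in>Pow e \<times> Pow (\<Union>M). \<Prod>e'\<in>insert e M. g e' (e' \<inter> (U \<union> R)))"
    by (subst sum.reindex_bij_betw[OF bij, symmetric]) (simp add: case_prod_unfold)
  also have "\<dots> = (\<Sum>(U, R)\<in>Pow e \<times> Pow (\<Union>M). g e U * (\<Prod>e'\<in>M. g e' (e' \<inter> R)))"
  proof (rule sum.cong[OF refl], clarify)
    fix U R assume UR: "U \<subseteq> e" "R \<subseteq> \<Union>M"
    have "e \<inter> (U \<union> R) = U" using UR dis by auto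
    moreover have "e' \<inter> (U \<union> R) = e' \<inter> R" if "e' \<in> M" for e' using UR dis that by auto
    ultimately show "(\<Prod>e'\<in>insert e M. g e' (e' \<inter> (U \<union> R))) = g e U * (\<Prod>e'\<in>M. g e' (e' \<inter> R))"
      using insert.hyps by simp
  qed
  also have "\<dots> = (\<Sum>U\<in>Pow e. g e U) * (\<Sum>R\<in>Pow (\<Union>M). \<Prod>e'\<in>M. g e' (e' \<inter> R))"
    by (simp add: sum_product sum.cartesian_product)
  also have "\<dots> = (\<Prod>e\<in>insert e M. \<Sum>U\<in>Pow e. g e U)"
    using insert.hyps insert.IH[OF dM] insert.prems(2) by simp
  finally show ?case .
qed

text \<open>
  The value at \<open>\<mu>\<close> of the moment generating function of the product of two independent centred
  Bernoulli variables with parameter \<open>a\<close>. Centring removes the part of the number of crossing edges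
  that is determined by \<open>card S\<close>.
\<close>

definition pair_mgf :: "real \<Rightarrow> real \<Rightarrow> real" where
  "pair_mgf a \<mu> = (1 - a)\<^sup>2 * exp (\<mu> * a\<^sup>2) + 2 * a * (1 - a) * exp (- \<mu> * a * (1 - a)) + a\<^sup>2 * exp (\<mu> * (1 - a)\<^sup>2)"

text \<open>For an edge with \<open>c\<close> endpoints in \<open>S\<close>, the product of the two
  centred indicators is \<open>a ^ 2\<close>, \<open>- a * (1 - a)\<close> or
  \<open>(1 - a) ^ 2\<close>. All three have the form \<open>a ^ 2 + c * (1 - 2 * a) / 2\<close>,
  less \<open>1 / 2\<close> if \<open>c = 1\<close>; summed over the \<open>n / 2\<close> edges this
  is the exponent, so the sum over \<open>S\<close> factorizes.\<close>

lemma sum_Pow_matching: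
  fixes a :: real
  assumes "M \<in> perfect_matchings n"
  shows "(\<Sum>S\<in>Pow {1..n}. a ^ card S * (1 - a) ^ (n - card S) *
     exp (\<mu> * (real n / 2 * a\<^sup>2 + real (card S) * (1 - 2 * a) / 2 - real (card (cross_edges M S)) / 2)))
    = pair_mgf a \<mu> ^ card M"
proof -
  note M = perfect_matchingsD[OF assms]
  define g where "g = (\<lambda>(e::nat set) (U::nat set). a ^ card U * (1 - a) ^ (2 - card U) *
     exp (\<mu> * (a\<^sup>2 + real (card U) * (1 - 2 * a) / 2 - (if card U = 1 then 1 else 0) / 2)))"
  have "(\<Prod>e\<in>M. \<Sum>U\<in>Pow e. g e U) = (\<Prod>e\<in>M. pair_mgf a \<mu>)"
  proof (rule prod.cong[OF refl])
    fix e assume "e \<in> M"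
    then obtain v w where e: "e = {v, w}" "v \<noteq> w" using M(4) by (meson card_2_iff)
    have P: "Pow e = {{}, {v}, {w}, {v, w}}" using e by (auto simp: Pow_insert)
    show "(\<Sum>U\<in>Pow e. g e U) = pair_mgf a \<mu>"
      unfolding P using e by (simp add: g_def pair_mgf_def doubleton_eq_iff power2_eq_square algebra_simps diff_divide_distrib)
  qed
  moreover have "(\<Prod>e\<in>M. g e (e \<inter> S)) = a ^ card S * (1 - a) ^ (n - card S) *
     exp (\<mu> * (real n / 2 * a\<^sup>2 + real (card S) * (1 - 2 * a) / 2 - real (card (cross_edges M S)) / 2))"
    if S: "S \<in> Pow {1..n}" for S
  proof -
    have s: "(\<Sum>e\<in>M. card (e \<inter> S)) = card S"
      using sum_card_Int_matching[OF assms order.refl, of S] M(2) S by (simp add: Int_absorb1)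
    have s': "(\<Sum>e\<in>M. 2 - card (e \<inter> S)) = n - card S"
    proof -
      have "card (e \<inter> S) \<le> 2" if "e \<in> M" for e using M(4,5)[OF that] by (metis card_mono inf_le1)
      then have "(\<Sum>e\<in>M. 2 - card (e \<inter> S)) = (\<Sum>e\<in>M. 2) - (\<Sum>e\<in>M. card (e \<inter> S))"
        by (intro sum_subtractf_nat) auto
      then show ?thesis using s card_matching[OF assms] by simp
    qed
    have c: "(\<Sum>e\<in>M. (if card (e \<inter> S) = 1 then 1 else 0::real)) = card (cross_edges M S)"
      using M(1) by (simp add: cross_edges_def sum.If_cases Int_def)
    have "(\<Prod>e\<in>M. g e (e \<inter> S)) = a ^ (\<Sum>e\<in>M. card (e \<inter> S)) * (1 - a) ^ (\<Sum>e\<in>M. 2 - card (e \<inter> S)) *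
      exp (\<Sum>e\<in>M. \<mu> * (a\<^sup>2 + real (card (e \<inter> S)) * (1 - 2 * a) / 2 - (if card (e \<inter> S) = 1 then 1 else 0) / 2))"
      unfolding g_def by (simp add: prod.distrib power_sum exp_sum M(1))
    also have "(\<Sum>e\<in>M. \<mu> * (a\<^sup>2 + real (card (e \<inter> S)) * (1 - 2 * a) / 2 - (if card (e \<inter> S) = 1 then 1 else 0) / 2))
       = \<mu> * (real (card M) * a\<^sup>2 + real (\<Sum>e\<in>M. card (e \<inter> S)) * (1 - 2 * a) / 2 - (\<Sum>e\<in>M. (if card (e \<inter> S) = 1 then 1 else 0::real)) / 2)"
      by (simp add: sum_distrib_left[symmetric] sum.distrib sum_subtractf sum_divide_distrib[symmetric] sum_distrib_right[symmetric])
    also have "real (card M) = real n / 2" using card_matching[OF assms] by linarith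
    finally show ?thesis unfolding s s' c .
  qed
  ultimately show ?thesis
    using sum_Pow_Union_prod[OF M(1,3,5), of g] M(2) by simp
qed

section \<open>Symmetry under permutations of the vertices\<close>

definition cross_prob :: "nat \<Rightarrow> nat set \<Rightarrow> nat \<Rightarrow> real" where
  "cross_prob n S k = real (card {M \<in> perfect_matchings n. card (cross_edges M S) = k}) / real (card (perfect_matchings n))"

definition cross_verts_prob :: "nat \<Rightarrow> nat set \<Rightarrow> nat set \<Rightarrow> real" where
  "cross_verts_prob n S X = real (card {M \<in> perfect_matchings n. cross_verts M S = X}) / real (card (perfect_matchings n))"

lemma image_matching:
  assumes "p permutes {1..n}" "M \<in> perfect_matchings n"
  shows "(`) p ` M \<in> perfect_matchings n"
proof -
  note M = perfect_matchingsD[OF assms(2)]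
  have inj: "inj p" using assms(1) by (rule permutes_inj)
  have "\<Union>((`) p ` M) = p ` \<Union>M" by auto
  then have 1: "\<Union>((`) p ` M) = {1..n}" using M(2) permutes_image[OF assms(1)] by simp
  have 2: "card e = 2" if "e \<in> (`) p ` M" for e
    using that M(4) inj by (auto simp: card_image inj_on_def)
  have 3: "disjoint ((`) p ` M)"
    unfolding disjoint_def
  proof (intro ballI impI)
    fix e e' assume "e \<in> (`) p ` M" "e' \<in> (`) p ` M" "e \<noteq> e'"
    then obtain f f' where f: "f \<in> M" "f' \<in> M" "e = p ` f" "e' = p ` f'" "f \<noteq> f'" by blast
    then have "f \<inter> f' = {}" using M(3) unfolding disjoint_def by blast
    then show "e \<inter> e' = {}" using f inj by (simp add: image_Int[symmetric])
  qed
  have "{} \<notin> (`) p ` M" using M(4)[of "{}"] by auto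
  with 1 2 3 show ?thesis unfolding perfect_matchings_def partition_on_def by auto
qed

lemma cross_edges_image:
  assumes "inj p"
  shows "cross_edges ((`) p ` M) (p ` S) = (`) p ` cross_edges M S"
proof -
  have "card (p ` e \<inter> p ` S) = card (e \<inter> S)" for e
    using assms by (metis card_image image_Int inj_on_subset subset_UNIV)
  then show ?thesis unfolding cross_edges_def by auto
qed

lemma card_matchings_permute:
  assumes p: "p permutes {1..n}"
    and PQ: "\<And>M. M \<in> perfect_matchings n \<Longrightarrow> Q ((`) p ` M) \<longleftrightarrow> P M"
  shows "card {M \<in> perfect_matchings n. P M} = card {M \<in> perfect_matchings n. Q M}"
proof (rule bij_betw_same_card, rule bij_betwI[where f="\<lambda>M. (`) p ` M" and g="\<lambda>M. (`) (inv p) ` M"])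
  have inv1: "(`) (inv p) ` (`) p ` M = M" for M
    using permutes_inverses(2)[OF p] by (auto simp: image_image image_iff)
  have inv2: "(`) p ` (`) (inv p) ` M = M" for M
    using permutes_inverses(1)[OF p] by (auto simp: image_image image_iff)
  note pi = permutes_inv[OF p]
  show "(\<lambda>M. (`) p ` M) \<in> {M \<in> perfect_matchings n. P M} \<rightarrow> {M \<in> perfect_matchings n. Q M}"
    using PQ image_matching[OF p] by auto
  show "(\<lambda>M. (`) (inv p) ` M) \<in> {M \<in> perfect_matchings n. Q M} \<rightarrow> {M \<in> perfect_matchings n. P M}"
    using PQ image_matching[OF pi] inv2 by fastforce
qed (use permutes_inverses[OF p] in \<open>auto simp: image_image\<close>)

lemma cross_prob_permute:
  assumes "p permutes {1..n}"
  shows "cross_prob n (p ` S) k = cross_prob n S k"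
proof -
  have inj: "inj p" using assms by (rule permutes_inj)
  have "card ((`) p ` cross_edges M S) = card (cross_edges M S)" for M
    using inj by (intro card_image) (auto simp: inj_on_def inj_image_eq_iff)
  then show ?thesis
    unfolding cross_prob_def
    using card_matchings_permute[OF assms, of "\<lambda>M. card (cross_edges M (p ` S)) = k" "\<lambda>M. card (cross_edges M S) = k"]
    by (simp add: cross_edges_image[OF inj])
qed

lemma cross_verts_prob_permute:
  assumes "p permutes {1..n}"
  shows "cross_verts_prob n (p ` S) (p ` X) = cross_verts_prob n S X"
proof -
  have inj: "inj p" using assms by (rule permutes_inj)
  have "cross_verts ((`) p ` M) (p ` S) = p ` cross_verts M S" for M
    unfolding cross_verts_def cross_edges_image[OF inj] by auto
  then show ?thesis
    unfolding cross_verts_prob_def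
    using card_matchings_permute[OF assms, of "\<lambda>M. cross_verts M (p ` S) = p ` X" "\<lambda>M. cross_verts M S = X"]
    by (simp add: inj_image_eq_iff[OF inj])
qed

text \<open>Label each point by its membership in the two sets. The hypotheses determine all four
  class sizes, so the two labellings have the same multiset of labels and differ by a
  permutation.\<close>

lemma exists_permutes_two_sets:
  assumes "finite V" "S \<subseteq> V" "S' \<subseteq> V" "X \<subseteq> V" "X' \<subseteq> V"
    and "card (X \<inter> S) = card (X' \<inter> S')" "card (X - S) = card (X' - S')" "card S = card S'"
  shows "\<exists>p. p permutes V \<and> p ` S = S' \<and> p ` X = X'"
proof -
  let ?f = "\<lambda>v. (v \<in> S, v \<in> X)" and ?g = "\<lambda>v. (v \<in> S', v \<in> X')"
  have cnt: "count (image_mset f (mset_set V)) c = card {v \<in> V. f v = c}" for f :: "'a \<Rightarrow> bool \<times> bool" and c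
    using assms(1) by (auto simp: count_image_mset_eq_card_vimage)
  have fin: "finite S" "finite S'" "finite X" "finite X'" using assms(1-5) finite_subset by blast+
  have c1: "card (S - X) = card (S' - X')"
    using fin assms(6,8) by (simp add: card_Diff_subset_Int Int_commute)
  have c2: "card (V - S - X) = card (V - S' - X')"
  proof -
    have "card (V - S - X) = card V - card S - card (X - S)"
    proof -
      have "V - S - X = V - (S \<union> (X - S))" by auto
      then have "card (V - S - X) = card V - card (S \<union> (X - S))"
        using assms(1-5) fin by (simp add: card_Diff_subset)
      moreover have "card (S \<union> (X - S)) = card S + card (X - S)"
        using fin by (intro card_Un_disjoint) auto
      ultimately show ?thesis by simp
    qed
    moreover have "card (V - S' - X') = card V - card S' - card (X' - S')"
    proof -
      have "V - S' - X' = V - (S' \<union> (X' - S'))" by auto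
      then have "card (V - S' - X') = card V - card (S' \<union> (X' - S'))"
        using assms(1-5) fin by (simp add: card_Diff_subset)
      moreover have "card (S' \<union> (X' - S')) = card S' + card (X' - S')"
        using fin by (intro card_Un_disjoint) auto
      ultimately show ?thesis by simp
    qed
    ultimately show ?thesis using assms(7,8) by simp
  qed
  have "image_mset ?f (mset_set V) = image_mset ?g (mset_set V)"
  proof (rule multiset_eqI)
    fix c :: "bool \<times> bool"
    obtain a b where c: "c = (a, b)" by (cases c)
    have sets: "{v \<in> V. ?f v = c} = (if a then (if b then X \<inter> S else S - X) else (if b then X - S else V - S - X))"
      "{v \<in> V. ?g v = c} = (if a then (if b then X' \<inter> S' else S' - X') else (if b then X' - S' else V - S' - X'))"
      using assms(2-5) c by auto
    show "count (image_mset ?f (mset_set V)) c = count (image_mset ?g (mset_set V)) c"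
      unfolding cnt sets using c1 c2 assms(6,7) by simp
  qed
  then obtain p where p: "p permutes V" "\<forall>x\<in>V. ?f x = ?g (p x)"
    using image_mset_eq_implies_permutes[OF assms(1)] by blast
  have "p ` A = A'" if A: "A \<subseteq> V" "A' \<subseteq> V" "\<forall>x\<in>V. x \<in> A \<longleftrightarrow> p x \<in> A'" for A A'
  proof
    show "p ` A \<subseteq> A'" using A by auto
    show "A' \<subseteq> p ` A"
    proof
      fix y assume y: "y \<in> A'"
      then obtain x where "x \<in> V" "y = p x" using permutes_image[OF p(1)] A(2) by blast
      with y A show "y \<in> p ` A" by auto
    qed
  qed
  with p assms(2-5) show ?thesis by (metis Pair_inject)
qed

lemma cross_prob_eq_card:
  assumes "S \<subseteq> {1..n}" "S' \<subseteq> {1..n}" "card S = card S'"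
  shows "cross_prob n S k = cross_prob n S' k"
  using exists_permutes_two_sets[of "{1..n}" S S' "{}" "{}"] assms cross_prob_permute by fastforce

lemma card_two_part_subsets:
  assumes "finite V" "S \<subseteq> V"
  shows "card {X. X \<subseteq> V \<and> card (X \<inter> S) = k \<and> card (X - S) = l} = (card S choose k) * (card (V - S) choose l)"
proof -
  have bij: "bij_betw (\<lambda>(A, B). A \<union> B) ({A. A \<subseteq> S \<and> card A = k} \<times> {B. B \<subseteq> V - S \<and> card B = l})
     {X. X \<subseteq> V \<and> card (X \<inter> S) = k \<and> card (X - S) = l}"
  proof (rule bij_betwI[where g="\<lambda>X. (X \<inter> S, X - S)"])
    have "(A \<union> B) \<inter> S = A" "(A \<union> B) - S = B" if "A \<subseteq> S" "B \<subseteq> V - S" for A B using that by auto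
    then show "(\<lambda>(A, B). A \<union> B) \<in> {A. A \<subseteq> S \<and> card A = k} \<times> {B. B \<subseteq> V - S \<and> card B = l}
      \<rightarrow> {X. X \<subseteq> V \<and> card (X \<inter> S) = k \<and> card (X - S) = l}"
      using assms by auto
  qed (use assms in auto)
  have "finite S" using assms finite_subset by auto
  then show ?thesis
    using bij_betw_same_card[OF bij] assms n_subsets[of S k] n_subsets[of "V - S" l]
    by (simp add: card_cartesian_product)
qed

text \<open>Permutations preserving \<open>S\<close> act transitively on the sets with
  \<open>k\<close> points on either side, and every crossing set with \<open>k\<close> crossing
  edges is of this kind; hence all these sets are equally likely.\<close>

lemma cross_prob_eq_cross_verts_prob:
  assumes S: "S \<subseteq> {1..n}" and X: "X \<subseteq> {1..n}" "card (X \<inter> S) = k" "card (X - S) = k"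
  shows "cross_prob n S k = real (card S choose k) * real ((n - card S) choose k) * cross_verts_prob n S X"
proof -
  let ?F = "{X. X \<subseteq> {1..n} \<and> card (X \<inter> S) = k \<and> card (X - S) = k}"
  let ?PM = "perfect_matchings n"
  have fS: "finite S" using S finite_subset by auto
  have fF: "finite ?F" by simp
  have "{M \<in> ?PM. card (cross_edges M S) = k} = (\<Union>Y\<in>?F. {M \<in> ?PM. cross_verts M S = Y})"
    using card_cross_verts cross_verts_sub by fastforce
  then have "card {M \<in> ?PM. card (cross_edges M S) = k} = (\<Sum>Y\<in>?F. card {M \<in> ?PM. cross_verts M S = Y})"
    using fF finite_perfect_matchings by (simp only:) (rule card_UN_disjoint, auto)
  then have "cross_prob n S k = (\<Sum>Y\<in>?F. cross_verts_prob n S Y)"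
    by (simp add: cross_prob_def cross_verts_prob_def sum_divide_distrib)
  also have "\<dots> = (\<Sum>Y\<in>?F. cross_verts_prob n S X)"
  proof (rule sum.cong[OF refl])
    fix Y assume "Y \<in> ?F"
    then obtain p where "p permutes {1..n}" "p ` S = S" "p ` X = Y"
      using exists_permutes_two_sets[of "{1..n}" S S X Y] S X by auto
    then show "cross_verts_prob n S Y = cross_verts_prob n S X" using cross_verts_prob_permute by metis
  qed
  also have "\<dots> = real (card ?F) * cross_verts_prob n S X" by simp
  also have "card ?F = (card S choose k) * ((n - card S) choose k)"
    using card_two_part_subsets[of "{1..n}" S k k] S fS by (simp add: card_Diff_subset)
  finally show ?thesis by simp
qed

text \<open>
  By symmetry one may average over all sets of size \<open>card S\<close>, and then over a set containing each vertex
  independently with probability \<open>a\<close>; for a fixed matching its edges then contribute independently.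
\<close>

lemma cross_prob_le_mgf:
  assumes "even n" "S \<subseteq> {1..n}" "0 < n" and a: "a = real (card S) / real n"
  shows "real (n choose card S) * a ^ card S * (1 - a) ^ (n - card S) * cross_prob n S k
      * exp (\<mu> * (a * (1 - a) * real n - real k) / 2) \<le> pair_mgf a \<mu> ^ (n div 2)"
proof -
  let ?PM = "perfect_matchings n"
  let ?s = "card S"
  have a01: "0 \<le> a" "a \<le> 1" using assms(2,3) a card_mono[of "{1..n}" S] by auto
  let ?w = "\<lambda>M U. a ^ card U * (1 - a) ^ (n - card U) *
     exp (\<mu> * (real n / 2 * a\<^sup>2 + real (card U) * (1 - 2 * a) / 2 - real (card (cross_edges M U)) / 2))"
  let ?E = "exp (\<mu> * (a * (1 - a) * real n - real k) / 2)"
  let ?c = "a ^ ?s * (1 - a) ^ (n - ?s) * ?E"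
  have N: "0 < card ?PM" using finite_perfect_matchings perfect_matchings_nonempty[OF assms(1)] by (simp add: card_gt_0_iff)
  let ?F = "{U. U \<subseteq> {1..n} \<and> card U = ?s}"
  have nF: "card ?F = n choose ?s" using n_subsets[of "{1..n}" ?s] by simp
  have "real (n choose ?s) * (real (card ?PM) * cross_prob n S k) * ?c
     = (\<Sum>U\<in>?F. real (card {M \<in> ?PM. card (cross_edges M U) = k}) * ?c)"
  proof -
    have "real (card {M \<in> ?PM. card (cross_edges M U) = k}) = real (card ?PM) * cross_prob n S k" if "U \<in> ?F" for U
      using cross_prob_eq_card[of U n S k] that assms(2) N by (simp add: cross_prob_def)
    then show ?thesis using nF by simp
  qed
  also have "\<dots> = (\<Sum>U\<in>?F. \<Sum>M\<in>{M \<in> ?PM. card (cross_edges M U) = k}. ?c)" by simp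
  also have "\<dots> = (\<Sum>U\<in>?F. \<Sum>M\<in>{M \<in> ?PM. card (cross_edges M U) = k}. ?w M U)"
  proof (intro sum.cong refl)
    fix U M assume "U \<in> ?F" "M \<in> {M \<in> ?PM. card (cross_edges M U) = k}"
    then have U: "card U = ?s" "card (cross_edges M U) = k" by auto
    \<comment> \<open>As \<open>card S = a * n\<close>, the centring terms add up to half of
      \<open>a * (1 - a) * n\<close>, the typical number of crossing edges.\<close>
    have "real n / 2 * a\<^sup>2 + real ?s * (1 - 2 * a) / 2 - real k / 2 = (a * (1 - a) * real n - real k) / 2"
      using assms(3) a by (simp add: field_simps power2_eq_square)
    then show "?c = ?w M U" unfolding U by (simp add: mult.assoc)
  qed
  also have "\<dots> \<le> (\<Sum>U\<in>?F. \<Sum>M\<in>?PM. ?w M U)"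
    using a01 finite_perfect_matchings by (intro sum_mono sum_mono2) auto
  also have "\<dots> \<le> (\<Sum>U\<in>Pow {1..n}. \<Sum>M\<in>?PM. ?w M U)"
    using a01 by (intro sum_mono2) (auto intro!: sum_nonneg)
  also have "\<dots> = (\<Sum>M\<in>?PM. \<Sum>U\<in>Pow {1..n}. ?w M U)" by (rule sum.swap)
  also have "\<dots> = (\<Sum>M\<in>?PM. pair_mgf a \<mu> ^ (n div 2))"
  proof (rule sum.cong[OF refl])
    fix M assume M: "M \<in> ?PM"
    have "card M = n div 2" using card_matching[OF M] by simp
    then show "(\<Sum>U\<in>Pow {1..n}. ?w M U) = pair_mgf a \<mu> ^ (n div 2)" using sum_Pow_matching[OF M, of a \<mu>] by simp
  qed
  also have "\<dots> = real (card ?PM) * pair_mgf a \<mu> ^ (n div 2)" by simp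
  finally have "real (card ?PM) * (real (n choose ?s) * a ^ ?s * (1 - a) ^ (n - ?s) * cross_prob n S k * ?E)
     \<le> real (card ?PM) * pair_mgf a \<mu> ^ (n div 2)"
    by (simp add: mult_ac)
  then show ?thesis using N by simp
qed

section \<open>Independent Bernoulli approximation of the crossing vertices\<close>

text \<open>The Poisson weights \<open>k ^ j / fact j\<close> with integral mean \<open>k\<close>
  are largest at \<open>j = k\<close>.\<close>

lemma fact_mult_power_le: "fact k * real k ^ j \<le> fact j * real k ^ k"
proof (cases "j \<le> k")
  case True
  have "fact (j + i) * real k ^ j \<le> fact j * real k ^ (j + i)" if "j + i \<le> k" for i
    using that
  proof (induction i)
    case (Suc i)
    have "fact (j + Suc i) * real k ^ j = real (Suc (j + i)) * (fact (j + i) * real k ^ j)" by simp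
    also have "\<dots> \<le> real k * (fact j * real k ^ (j + i))" using Suc by (intro mult_mono[of "real (Suc (j + i))"]) auto
    finally show ?case by (simp add: mult_ac)
  qed simp
  from this[of "k - j"] True show ?thesis by simp
next
  case False
  have "fact k * real k ^ (k + i) \<le> fact (k + i) * real k ^ k" for i
  proof (induction i)
    case (Suc i)
    have "fact k * real k ^ (k + Suc i) = real k * (fact k * real k ^ (k + i))" by simp
    also have "\<dots> \<le> real (Suc (k + i)) * (fact (k + i) * real k ^ k)" using Suc by (intro mult_mono[of "real k"]) auto
    finally show ?case by (simp add: mult_ac)
  qed simp
  from this[of "j - k"] False show ?thesis by simp
qed

text \<open>A binomial law with integral mean \<open>k\<close> has its mode there: each of the two
  factorials in the coefficient is handled by a Poisson comparison. The largest of the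
  \<open>s + 1\<close> terms is at least their average.\<close>

lemma binomial_mode_ge:
  assumes "k \<le> s"
  shows "real s ^ s \<le> real (s + 1) * (real (s choose k) * real k ^ k * real (s - k) ^ (s - k))"
proof -
  have le: "real (s choose j) * real k ^ j * real (s - k) ^ (s - j) \<le> real (s choose k) * real k ^ k * real (s - k) ^ (s - k)"
    if j: "j \<le> s" for j
  proof -
    have c: "real (s choose i) * (fact i * fact (s - i)) = fact s" if "i \<le> s" for i
      using binomial_fact_lemma[OF that] by (metis (no_types, lifting) mult.commute of_nat_fact of_nat_mult)
    have m: "(fact k * real k ^ j) * (fact (s - k) * real (s - k) ^ (s - j)) \<le> (fact j * real k ^ k) * (fact (s - j) * real (s - k) ^ (s - k))"
      by (intro mult_mono fact_mult_power_le) auto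
    have "real (s choose j) * real k ^ j * real (s - k) ^ (s - j) * (fact j * fact (s - j) * (fact k * fact (s - k)))
      = fact s * ((fact k * real k ^ j) * (fact (s - k) * real (s - k) ^ (s - j)))"
      using c[OF j] by (simp add: mult_ac)
    also have "\<dots> \<le> fact s * ((fact j * real k ^ k) * (fact (s - j) * real (s - k) ^ (s - k)))"
      by (intro mult_left_mono m) auto
    also have "\<dots> = real (s choose k) * real k ^ k * real (s - k) ^ (s - k) * (fact j * fact (s - j) * (fact k * fact (s - k)))"
      using c[OF assms] by (simp add: mult_ac)
    finally show ?thesis by (rule mult_right_le_imp_le) auto
  qed
  have "real s ^ s = (real k + real (s - k)) ^ s" using assms by simp
  also have "\<dots> = (\<Sum>j\<le>s. real (s choose j) * real k ^ j * real (s - k) ^ (s - j))" by (rule binomial_ring)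
  also have "\<dots> \<le> (\<Sum>j\<le>s. real (s choose k) * real k ^ k * real (s - k) ^ (s - k))"
    by (intro sum_mono le) auto
  finally show ?thesis by simp
qed

lemma binomial_prob_mode_ge:
  assumes "k \<le> s" "0 < s" "q = real k / real s"
  shows "1 \<le> real (s + 1) * (real (s choose k) * q ^ k * (1 - q) ^ (s - k))"
proof -
  have e: "q ^ k * (1 - q) ^ (s - k) = real k ^ k * real (s - k) ^ (s - k) / real s ^ s"
  proof -
    have "1 - q = real (s - k) / real s" using assms by (simp add: field_simps)
    then have "q ^ k * (1 - q) ^ (s - k) = real k ^ k * real (s - k) ^ (s - k) / (real s ^ k * real s ^ (s - k))"
      unfolding assms(3) by (simp add: power_divide)
    also have "real s ^ k * real s ^ (s - k) = real s ^ s" using assms(1) by (simp flip: power_add)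
    finally show ?thesis .
  qed
  have "1 = real s ^ s / real s ^ s" using assms(2) by simp
  also have "\<dots> \<le> real (s + 1) * (real (s choose k) * real k ^ k * real (s - k) ^ (s - k)) / real s ^ s"
    by (intro divide_right_mono binomial_mode_ge assms) auto
  also have "\<dots> = real (s + 1) * (real (s choose k) * (q ^ k * (1 - q) ^ (s - k)))" unfolding e by simp
  finally show ?thesis by (simp add: mult.assoc)
qed

text \<open>Unlike the price \<open>n + 1\<close> of the mode bound, \<open>exp s\<close> does not
  grow with \<open>n\<close>, which matters for small vertex sets. It comes from
  \<open>(n choose s) * q ^ s \<ge> 1\<close> and
  \<open>(1 - q) ^ (n - s) \<ge> exp (- s)\<close>.\<close>

lemma binomial_prob_mode_ge_exp:
  assumes "0 < s" "s < n" "q = real s / real n"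
  shows "1 \<le> exp (real s) * (real (n choose s) * q ^ s * (1 - q) ^ (n - s))"
proof -
  have q: "0 < q" "q < 1" using assms by auto
  have "(real n / real s) ^ s * q ^ s = 1" using assms by (simp add: power_divide)
  moreover have "(real n / real s) ^ s \<le> real (n choose s)"
    using binomial_ge_n_over_k_pow_k[of s n, where 'a=real] assms by simp
  ultimately have 1: "1 \<le> real (n choose s) * q ^ s"
    using q by (metis mult_right_mono zero_le_power less_imp_le)
  have "1 - q = real (n - s) / real n" using assms by (simp add: field_simps)
  then have "1 / (1 - q) = real n / real (n - s)" by simp
  also have "\<dots> = 1 + real s / real (n - s)" using assms(1,2) by (simp add: field_simps)
  also have "\<dots> \<le> exp (real s / real (n - s))" by (rule exp_ge_add_one_self)
  finally have "(1 / (1 - q)) ^ (n - s) \<le> exp (real s / real (n - s)) ^ (n - s)" using q by (intro power_mono) auto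
  also have "\<dots> = exp (real s)" using assms by (simp flip: exp_of_nat_mult)
  finally have "1 / (1 - q) ^ (n - s) \<le> exp (real s)" by (simp add: power_divide)
  then have 2: "1 \<le> exp (real s) * (1 - q) ^ (n - s)" using q by (simp add: divide_le_eq)
  have "1 * 1 \<le> (real (n choose s) * q ^ s) * (exp (real s) * (1 - q) ^ (n - s))"
    using 1 2 by (intro mult_mono) auto
  then show ?thesis by (simp add: mult_ac)
qed

lemma binomial_prob_le_1:
  assumes "s \<le> n" "0 \<le> q" "q \<le> (1::real)"
  shows "real (n choose s) * q ^ s * (1 - q) ^ (n - s) \<le> 1"
proof -
  have "real (n choose s) * q ^ s * (1 - q) ^ (n - s) \<le> (\<Sum>j\<le>n. real (n choose j) * q ^ j * (1 - q) ^ (n - j))"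
    using assms by (intro member_le_sum) auto
  also have "\<dots> = 1" using binomial_ring[of q "1 - q" n] by simp
  finally show ?thesis .
qed

text \<open>The conditional probability that \<open>v\<close> is an endpoint of a crossing edge,
  given that there are \<open>k\<close> of them.\<close>

definition vertex_rate :: "nat \<Rightarrow> nat set \<Rightarrow> nat \<Rightarrow> nat \<Rightarrow> real" where
  "vertex_rate n S k v = (if v \<in> S then real k / real (card S) else real k / real (n - card S))"

lemma prod_bernoulli_set:
  assumes "finite A"
  shows "(\<Prod>v\<in>A. if v \<in> X then q else 1 - q :: real) = q ^ card (X \<inter> A) * (1 - q) ^ (card A - card (X \<inter> A))"
proof -
  have "(\<Prod>v\<in>A. if v \<in> X then q else 1 - q) = q ^ card (A \<inter> X) * (1 - q) ^ card (A \<inter> - X)"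
    using assms by (simp add: prod.If_cases Collect_neg_eq)
  moreover have "A \<inter> - X = A - X \<inter> A" by auto
  ultimately show ?thesis using assms by (simp add: card_Diff_subset Int_commute)
qed

text \<open>Given \<open>k\<close> crossing edges, the crossing set is a Bernoulli set conditioned
  on its count on each side. Each count is at the mode of its binomial law, so undoing the
  conditioning costs at most \<open>n + 1\<close> per side.\<close>

lemma cross_verts_prob_le:
  assumes S: "S \<subseteq> {1..n}" "0 < card S" "card S < n"
    and X: "X \<subseteq> {1..n}" "card (X \<inter> S) = k" "card (X - S) = k"
  shows "cross_verts_prob n S X \<le> cross_prob n S k * (real (n + 1))\<^sup>2 *
     (\<Prod>v\<in>{1..n}. if v \<in> X then vertex_rate n S k v else 1 - vertex_rate n S k v)"
proof -
  define s t where "s = card S" and "t = n - card S"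
  have fS: "finite S" using S finite_subset by auto
  have cT: "card ({1..n} - S) = t" using S fS by (simp add: t_def card_Diff_subset)
  have XT: "X \<inter> ({1..n} - S) = X - S" using X(1) by auto
  have ks: "k \<le> s" using X(2) fS card_mono[of S "X \<inter> S"] by (auto simp: s_def)
  have kt: "k \<le> t" using X(1,3) cT card_mono[of "{1..n} - S" "X - S"] by auto
  define q r where "q = real k / real s" and "r = real k / real t"
  have st0: "0 < s" "0 < t" "s \<le> n" "t \<le> n" using S by (auto simp: s_def t_def)
  have "(\<Prod>v\<in>{1..n}. if v \<in> X then vertex_rate n S k v else 1 - vertex_rate n S k v)
    = (\<Prod>v\<in>{1..n} - S. if v \<in> X then vertex_rate n S k v else 1 - vertex_rate n S k v) * (\<Prod>v\<in>S. if v \<in> X then vertex_rate n S k v else 1 - vertex_rate n S k v)"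
    by (rule prod.subset_diff) (use S in auto)
  also have "(\<Prod>v\<in>S. if v \<in> X then vertex_rate n S k v else 1 - vertex_rate n S k v) = (\<Prod>v\<in>S. if v \<in> X then q else 1 - q)"
    by (intro prod.cong) (auto simp: vertex_rate_def q_def s_def)
  also have "(\<Prod>v\<in>{1..n} - S. if v \<in> X then vertex_rate n S k v else 1 - vertex_rate n S k v) = (\<Prod>v\<in>{1..n} - S. if v \<in> X then r else 1 - r)"
    by (intro prod.cong) (auto simp: vertex_rate_def r_def t_def)
  finally have P: "(\<Prod>v\<in>{1..n}. if v \<in> X then vertex_rate n S k v else 1 - vertex_rate n S k v)
     = (r ^ k * (1 - r) ^ (t - k)) * (q ^ k * (1 - q) ^ (s - k))"
    using prod_bernoulli_set[OF fS, of X q] prod_bernoulli_set[of "{1..n} - S" X r] cT X XT by (simp add: s_def)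
  have b1: "1 \<le> real (s + 1) * (real (s choose k) * q ^ k * (1 - q) ^ (s - k))"
    using ks st0(1) q_def by (rule binomial_prob_mode_ge)
  have b2: "1 \<le> real (t + 1) * (real (t choose k) * r ^ k * (1 - r) ^ (t - k))"
    using kt st0(2) r_def by (rule binomial_prob_mode_ge)
  have q01: "0 \<le> q" "q \<le> 1" "0 \<le> r" "r \<le> 1" using ks kt st0 by (auto simp: q_def r_def)
  have b1': "1 \<le> real (n + 1) * (real (s choose k) * q ^ k * (1 - q) ^ (s - k))"
    by (rule order.trans[OF b1]) (use st0 q01 in \<open>intro mult_right_mono, auto\<close>)
  have b2': "1 \<le> real (n + 1) * (real (t choose k) * r ^ k * (1 - r) ^ (t - k))"
    by (rule order.trans[OF b2]) (use st0 q01 in \<open>intro mult_right_mono, auto\<close>)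
  have p0: "0 \<le> cross_verts_prob n S X" by (simp add: cross_verts_prob_def)
  have "cross_verts_prob n S X * (1 * 1) \<le> cross_verts_prob n S X * ((real (n + 1) * (real (s choose k) * q ^ k * (1 - q) ^ (s - k)))
     * (real (n + 1) * (real (t choose k) * r ^ k * (1 - r) ^ (t - k))))"
    using b1' b2' p0 by (intro mult_left_mono mult_mono) auto
  also have "\<dots> = (real (s choose k) * real (t choose k) * cross_verts_prob n S X) * (real (n + 1))\<^sup>2 * ((r ^ k * (1 - r) ^ (t - k)) * (q ^ k * (1 - q) ^ (s - k)))"
    by (simp add: power2_eq_square mult_ac del: of_nat_add of_nat_Suc)
  also have "real (s choose k) * real (t choose k) * cross_verts_prob n S X = cross_prob n S k"
    using cross_prob_eq_cross_verts_prob[OF S(1) X] by (simp add: s_def t_def)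
  finally show ?thesis unfolding P by simp
qed

text \<open>Transposing the incidence relation turns one vertex set per matching into one set of
  matchings per vertex. The condition \<open>ok\<close> concerns single vertices, so the sum then
  factorizes.\<close>

lemma sum_prod_bernoulli_vertices:
  assumes "finite V"
  shows "(\<Sum>X\<in>{X \<in> {..<d} \<rightarrow>\<^sub>E Pow V. \<forall>v\<in>V. ok v (card {l \<in> {..<d}. v \<in> X l})}.
       \<Prod>l<d. \<Prod>v\<in>V. if v \<in> X l then q l v else 1 - q l v)
    = (\<Prod>v\<in>V. bernoulli_sum_avg d (\<lambda>l. q l v) (\<lambda>m. if ok v m then 1 else 0))"
proof -
  let ?A = "{X \<in> {..<d} \<rightarrow>\<^sub>E Pow V. \<forall>v\<in>V. ok v (card {l \<in> {..<d}. v \<in> X l})}"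
  let ?B = "{Y \<in> V \<rightarrow>\<^sub>E Pow {..<d}. \<forall>v\<in>V. ok v (card (Y v))}"
  let ?h = "\<lambda>X. \<lambda>v\<in>V. {l \<in> {..<d}. v \<in> X l}"
  let ?g = "\<lambda>Y. \<lambda>l\<in>{..<d}. {v \<in> V. l \<in> Y v}"
  have bij: "bij_betw ?h ?A ?B"
  proof (rule bij_betwI[where g="?g"])
    show "?h \<in> ?A \<rightarrow> ?B" by auto
    show "?g \<in> ?B \<rightarrow> ?A"
    proof
      fix Y assume Y: "Y \<in> ?B"
      have "{l \<in> {..<d}. v \<in> ?g Y l} = Y v" if "v \<in> V" for v using Y that by (auto simp: PiE_def Pi_def)
      with Y show "?g Y \<in> ?A" by auto
    qed
    show "?g (?h X) = X" if "X \<in> ?A" for X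
    proof
      fix l show "?g (?h X) l = X l" using that by (cases "l < d") (auto simp: PiE_def Pi_def extensional_def)
    qed
    show "?h (?g Y) = Y" if "Y \<in> ?B" for Y
    proof
      fix v show "?h (?g Y) v = Y v" using that by (cases "v \<in> V") (auto simp: PiE_def Pi_def extensional_def)
    qed
  qed
  let ?t = "\<lambda>v L. (\<Prod>l<d. if l \<in> L then q l v else 1 - q l v) * (if ok v (card L) then 1 else 0)"
  have "(\<Sum>X\<in>?A. \<Prod>l<d. \<Prod>v\<in>V. if v \<in> X l then q l v else 1 - q l v)
    = (\<Sum>X\<in>?A. \<Prod>v\<in>V. ?t v (?h X v))"
  proof (rule sum.cong[OF refl])
    fix X assume X: "X \<in> ?A"
    have "(\<Prod>l<d. \<Prod>v\<in>V. if v \<in> X l then q l v else 1 - q l v) = (\<Prod>v\<in>V. \<Prod>l<d. if v \<in> X l then q l v else 1 - q l v)"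
      by (rule prod.swap)
    also have "\<dots> = (\<Prod>v\<in>V. ?t v (?h X v))"
    proof (rule prod.cong[OF refl])
      fix v assume v: "v \<in> V"
      have "(\<Prod>l<d. if v \<in> X l then q l v else 1 - q l v) = (\<Prod>l<d. if l \<in> ?h X v then q l v else 1 - q l v)"
        using v by (intro prod.cong) auto
      moreover have "ok v (card (?h X v))" using X v by simp
      ultimately show "(\<Prod>l<d. if v \<in> X l then q l v else 1 - q l v) = ?t v (?h X v)" by simp
    qed
    finally show "(\<Prod>l<d. \<Prod>v\<in>V. if v \<in> X l then q l v else 1 - q l v) = (\<Prod>v\<in>V. ?t v (?h X v))" .
  qed
  also have "\<dots> = (\<Sum>Y\<in>?B. \<Prod>v\<in>V. ?t v (Y v))" by (rule sum.reindex_bij_betw[OF bij])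
  also have "\<dots> = (\<Sum>Y\<in>V \<rightarrow>\<^sub>E Pow {..<d}. \<Prod>v\<in>V. ?t v (Y v))"
  proof (rule sum.mono_neutral_left)
    show "finite (V \<rightarrow>\<^sub>E Pow {..<d})" using assms by (intro finite_PiE) auto
    show "\<forall>Y\<in>(V \<rightarrow>\<^sub>E Pow {..<d}) - ?B. (\<Prod>v\<in>V. ?t v (Y v)) = 0"
    proof
      fix Y assume "Y \<in> (V \<rightarrow>\<^sub>E Pow {..<d}) - ?B"
      then obtain v where "v \<in> V" "\<not> ok v (card (Y v))" by auto
      then show "(\<Prod>v\<in>V. ?t v (Y v)) = 0" using assms by (intro prod_zero) auto
    qed
  qed auto
  also have "\<dots> = (\<Prod>v\<in>V. \<Sum>L\<in>Pow {..<d}. ?t v L)"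
    using assms by (intro prod_sum_PiE[symmetric]) auto
  finally show ?thesis unfolding bernoulli_sum_avg_def by simp
qed

text \<open>The matchings are kept apart, since the argument conditions on the crossing count of
  each one; \<open>G_reg\<close> is the image of this law under union.\<close>

definition matchings_pmf :: "nat \<Rightarrow> nat \<Rightarrow> (nat \<Rightarrow> nat set set) pmf" where
  "matchings_pmf n d = Pi_pmf {..<d} {} (\<lambda>_. pmf_of_set (perfect_matchings n))"

lemma set_matchings_pmf:
  assumes "even n" "M \<in> set_pmf (matchings_pmf n d)" "l < d"
  shows "M l \<in> perfect_matchings n"
  using assms set_Pi_pmf_subset'[of "{..<d}" "{}" "\<lambda>_. pmf_of_set (perfect_matchings n)"]
    finite_perfect_matchings[of n] perfect_matchings_nonempty[of n]
  by (auto simp: matchings_pmf_def PiE_dflt_def set_pmf_of_set)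

lemma prob_matchings_Pi:
  assumes "even n"
  shows "measure_pmf.prob (matchings_pmf n d) {M. \<forall>l<d. P l (M l)}
    = (\<Prod>l<d. real (card {M \<in> perfect_matchings n. P l M}) / real (card (perfect_matchings n)))"
proof -
  have "{M. \<forall>l<d. P l (M l)} = Pi {..<d} (\<lambda>l. {M. P l M})" by (auto simp: Pi_def)
  moreover have "measure_pmf.prob (pmf_of_set (perfect_matchings n)) {M. Q M}
     = real (card {M \<in> perfect_matchings n. Q M}) / real (card (perfect_matchings n))" for Q
    using finite_perfect_matchings[of n] perfect_matchings_nonempty[OF assms]
    by (simp add: measure_pmf_of_set Int_def)
  ultimately show ?thesis unfolding matchings_pmf_def by (simp add: measure_Pi_pmf_Pi)
qed

lemma prob_cross_vector:
  assumes "even n"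
  shows "measure_pmf.prob (matchings_pmf n d) {M. \<forall>l<d. card (cross_edges (M l) S) = k l} = (\<Prod>l<d. cross_prob n S (k l))"
  unfolding cross_prob_def by (rule prob_matchings_Pi[OF assms, of d "\<lambda>l M. card (cross_edges M S) = k l"])

lemma prob_cross_vector_local:
  assumes n: "even n" and S: "S \<subseteq> {1..n}" "0 < card S" "card S < n"
    and k: "\<And>l. l < d \<Longrightarrow> k l \<le> card S \<and> k l \<le> n - card S"
  shows "measure_pmf.prob (matchings_pmf n d) {M. (\<forall>l<d. card (cross_edges (M l) S) = k l) \<and>
       (\<forall>v\<in>{1..n}. ok v (card {l \<in> {..<d}. v \<in> cross_verts (M l) S}))}
    \<le> (\<Prod>l<d. cross_prob n S (k l)) * (real (n + 1)) ^ (2 * d) *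
       (\<Prod>v\<in>{1..n}. bernoulli_sum_avg d (\<lambda>l. vertex_rate n S (k l) v) (\<lambda>m. if ok v m then 1 else 0))"
proof -
  let ?V = "{1..n}"
  let ?P = "matchings_pmf n d"
  let ?E = "{M. (\<forall>l<d. card (cross_edges (M l) S) = k l) \<and> (\<forall>v\<in>?V. ok v (card {l \<in> {..<d}. v \<in> cross_verts (M l) S}))}"
  let ?A = "{X \<in> {..<d} \<rightarrow>\<^sub>E Pow ?V. \<forall>v\<in>?V. ok v (card {l \<in> {..<d}. v \<in> X l})}"
  let ?C = "{X \<in> ?A. \<forall>l<d. card (X l \<inter> S) = k l \<and> card (X l - S) = k l}"
  let ?p = "\<lambda>X. \<Prod>l<d. \<Prod>v\<in>?V. if v \<in> X l then vertex_rate n S (k l) v else 1 - vertex_rate n S (k l) v"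
  have finA: "finite ?A" by (rule finite_subset[of _ "{..<d} \<rightarrow>\<^sub>E Pow ?V"]) (auto intro!: finite_PiE)
  have finC: "finite ?C" by (rule finite_subset[OF _ finA]) auto
  have rate: "0 \<le> vertex_rate n S (k l) v" "vertex_rate n S (k l) v \<le> 1" if "l < d" for l v
    using k[OF that] S by (auto simp: vertex_rate_def divide_le_eq of_nat_diff)
  have "measure_pmf.prob ?P ?E = measure_pmf.prob ?P (?E \<inter> set_pmf ?P)" by (simp add: measure_Int_set_pmf)
  also have "\<dots> \<le> measure_pmf.prob ?P (\<Union>X\<in>?C. {M. \<forall>l<d. cross_verts (M l) S = X l})"
  proof (rule measure_pmf.finite_measure_mono)
    show "?E \<inter> set_pmf ?P \<subseteq> (\<Union>X\<in>?C. {M. \<forall>l<d. cross_verts (M l) S = X l})"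
    proof
      fix M assume M: "M \<in> ?E \<inter> set_pmf ?P"
      let ?X = "\<lambda>l\<in>{..<d}. cross_verts (M l) S"
      have "{l \<in> {..<d}. v \<in> ?X l} = {l \<in> {..<d}. v \<in> cross_verts (M l) S}" for v by auto
      moreover have "M l \<in> perfect_matchings n" if "l < d" for l using M that n set_matchings_pmf by auto
      moreover from this have "card (cross_verts (M l) S \<inter> S) = k l" "card (cross_verts (M l) S - S) = k l"
        "cross_verts (M l) S \<subseteq> {1..n}" if "l < d" for l
        using M that card_cross_verts[of "M l" n S] cross_verts_sub[of "M l" n S] by auto
      ultimately have "?X \<in> ?C" using M by auto
      then show "M \<in> (\<Union>X\<in>?C. {M. \<forall>l<d. cross_verts (M l) S = X l})"
        by (rule UN_I) auto
    qed
  qed auto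
  also have "\<dots> \<le> (\<Sum>X\<in>?C. measure_pmf.prob ?P {M. \<forall>l<d. cross_verts (M l) S = X l})"
    by (rule measure_pmf.finite_measure_subadditive_finite) (use finC in auto)
  also have "\<dots> = (\<Sum>X\<in>?C. \<Prod>l<d. cross_verts_prob n S (X l))"
  proof (rule sum.cong[OF refl])
    fix X
    show "measure_pmf.prob ?P {M. \<forall>l<d. cross_verts (M l) S = X l} = (\<Prod>l<d. cross_verts_prob n S (X l))"
      unfolding cross_verts_prob_def by (rule prob_matchings_Pi[OF n, of d "\<lambda>l M. cross_verts M S = X l"])
  qed
  also have "\<dots> \<le> (\<Sum>X\<in>?C. \<Prod>l<d. cross_prob n S (k l) * (real (n + 1))\<^sup>2 *
     (\<Prod>v\<in>?V. if v \<in> X l then vertex_rate n S (k l) v else 1 - vertex_rate n S (k l) v))"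
  proof (intro sum_mono prod_mono conjI)
    fix X l assume X: "X \<in> ?C" "l \<in> {..<d}"
    show "0 \<le> cross_verts_prob n S (X l)" by (simp add: cross_verts_prob_def)
    show "cross_verts_prob n S (X l) \<le> cross_prob n S (k l) * (real (n + 1))\<^sup>2 *
     (\<Prod>v\<in>?V. if v \<in> X l then vertex_rate n S (k l) v else 1 - vertex_rate n S (k l) v)"
      by (rule cross_verts_prob_le[OF S]) (use X in auto)
  qed
  also have "\<dots> = (\<Prod>l<d. cross_prob n S (k l)) * (real (n + 1)) ^ (2 * d) * (\<Sum>X\<in>?C. ?p X)"
    by (simp add: prod.distrib power_mult sum_distrib_left mult.assoc del: of_nat_add of_nat_Suc)
  \<comment> \<open>Forgetting that the sets have exactly \<open>k l\<close> points on each side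
    leaves only conditions at single vertices.\<close>
  also have "\<dots> \<le> (\<Prod>l<d. cross_prob n S (k l)) * (real (n + 1)) ^ (2 * d) * (\<Sum>X\<in>?A. ?p X)"
  proof (intro mult_left_mono sum_mono2 finA)
    show "0 \<le> ?p X" for X using rate by (intro prod_nonneg ballI) auto
    show "0 \<le> (\<Prod>l<d. cross_prob n S (k l)) * (real (n + 1)) ^ (2 * d)"
      by (intro mult_nonneg_nonneg prod_nonneg) (auto simp: cross_prob_def)
  qed auto
  also have "(\<Sum>X\<in>?A. ?p X) = (\<Prod>v\<in>?V. bernoulli_sum_avg d (\<lambda>l. vertex_rate n S (k l) v) (\<lambda>m. if ok v m then 1 else 0))"
    by (rule sum_prod_bernoulli_vertices) simp
  finally show ?thesis .
qed

section \<open>Cuts of extremal deviation\<close>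

lemma cut_union_matchings:
  fixes d :: nat
  assumes "\<And>l. l < d \<Longrightarrow> M l \<in> perfect_matchings n"
  shows "cut (weighted_multigraph n c (\<Sum>i<d. mset_set (M i))) S = c * (\<Sum>l<d. real (card (cross_edges (M l) S)))"
  using assms
proof (induction d)
  case 0
  then show ?case by (simp add: cut_def weighted_multigraph_def)
next
  case (Suc d)
  have fin: "finite (M d)" using perfect_matchingsD(1)[of "M d" n] Suc.prems[of d] by simp
  have "cut (weighted_multigraph n c (\<Sum>i<Suc d. mset_set (M i))) S
     = cut (weighted_multigraph n c (\<Sum>i<d. mset_set (M i))) S + c * real (card (cross_edges (M d) S))"
    using fin by (simp add: cut_def weighted_multigraph_def cross_edges_def mult.commute)
  then show ?case using Suc by (simp add: algebra_simps)
qed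

lemma cut_complete_wgraph:
  assumes "S \<subseteq> {1..n}"
  shows "cut (complete_wgraph n) S = real (card S) * (real n - real (card S))"
proof -
  let ?E = "{e. e \<subseteq> {1..n} \<and> card e = 2}"
  have fS: "finite S" using assms finite_subset by auto
  have fE: "finite ?E" by (rule finite_subset[of _ "Pow {1..n}"]) auto
  have "{e \<in> ?E. card (e \<inter> S) = 1} = {e. e \<subseteq> {1..n} \<and> card (e \<inter> S) = 1 \<and> card (e - S) = 1}"
  proof -
    have "card e = card (e \<inter> S) + card (e - S)" if "e \<subseteq> {1..n}" for e
    proof -
      have "finite e" using that finite_subset by auto
      then show ?thesis by (subst card_Un_disjoint[symmetric]) (auto intro!: arg_cong[where f=card])
    qed
    then show ?thesis by auto
  qed
  then have "card {e \<in> ?E. card (e \<inter> S) = 1} = card S * (n - card S)"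
    using card_two_part_subsets[of "{1..n}" S 1 1] assms fS by (simp add: card_Diff_subset)
  moreover have "card S \<le> n" using assms card_mono[of "{1..n}" S] by auto
  ultimately show ?thesis using fE by (simp add: cut_def complete_wgraph_def of_nat_diff)
qed

text \<open>
  The relative deviation, with sign \<open>\<tau> = \<plusminus>1\<close>, of a cut with \<open>s\<close> vertices on one side and \<open>k l\<close> crossing
  edges in the \<open>l\<close>-th matching.
\<close>

definition cut_deviation :: "nat \<Rightarrow> nat \<Rightarrow> real \<Rightarrow> nat \<Rightarrow> (nat \<Rightarrow> nat) \<Rightarrow> real" where
  "cut_deviation n d \<tau> s k = \<tau> * ((\<Sum>l<d. real (k l)) * (real n - 1) / (real d * (real s * (real n - real s))) - 1)"

lemma cross_edges_trivial:
  assumes "M \<in> perfect_matchings n"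
  shows "cross_edges M {} = {}" "cross_edges M {1..n} = {}"
  using perfect_matchingsD(4,6)[OF assms] by (auto simp: cross_edges_def Int_absorb2)

lemma cross_edges_Compl:
  assumes "M \<in> perfect_matchings n"
  shows "cross_edges M ({1..n} - S) = cross_edges M S"
proof -
  have "card (e \<inter> ({1..n} - S)) = 1 \<longleftrightarrow> card (e \<inter> S) = 1" if "e \<in> M" for e
  proof -
    have e: "finite e" "card e = 2" "e \<subseteq> {1..n}" using perfect_matchingsD[OF assms] that by auto
    have "e = (e \<inter> S) \<union> (e \<inter> ({1..n} - S))" using e(3) by auto
    then have "card e = card ((e \<inter> S) \<union> (e \<inter> ({1..n} - S)))" by simp
    also have "\<dots> = card (e \<inter> S) + card (e \<inter> ({1..n} - S))" using e(1) by (intro card_Un_disjoint) auto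
    finally have "card e = card (e \<inter> S) + card (e \<inter> ({1..n} - S))" .
    with e show ?thesis by auto
  qed
  then show ?thesis by (auto simp: cross_edges_def)
qed

text \<open>The flip inequality at a cut of maximal deviation is linear in the number of crossing
  edges at \<open>v\<close>. With the weight \<open>(n - 1) / d\<close> and the exact change of both
  cuts it becomes a one-sided bound relative to the mean over the side of \<open>v\<close>, without
  error terms in \<open>n\<close>.\<close>

lemma extremal_cut:
  assumes n: "0 < n" and d: "0 < d" and M: "\<And>l. l < d \<Longrightarrow> M l \<in> perfect_matchings n"
    and neg: "\<not> cut_sparsifier \<epsilon> (weighted_multigraph n ((real n - 1) / real d) (\<Sum>i<d. mset_set (M i))) (complete_wgraph n)"
  obtains \<tau> :: real and S \<rho> where "\<tau> = 1 \<or> \<tau> = -1" "S \<subseteq> {1..n}" "0 < card S" "2 * card S \<le> n"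
    "\<rho> = cut_deviation n d \<tau> (card S) (\<lambda>l. card (cross_edges (M l) S))" "\<epsilon> < \<rho>"
    "\<And>v. v \<in> {1..n} \<Longrightarrow> - (\<rho> * real d / 2) \<le> \<tau> * (real (card {l \<in> {..<d}. v \<in> cross_verts (M l) S})
       - (\<Sum>l<d. vertex_rate n S (card (cross_edges (M l) S)) v))"
proof -
  let ?V = "{1..n}"
  define x where "x S = (\<Sum>l<d. real (card (cross_edges (M l) S)))" for S
  define st where "st S = real (card S) * (real n - real (card S))" for S :: "nat set"
  define cH where "cH S = (real n - 1) / real d * x S" for S
  have cutH: "cut (weighted_multigraph n ((real n - 1) / real d) (\<Sum>i<d. mset_set (M i))) S = cH S" for S
    unfolding cH_def x_def by (rule cut_union_matchings[OF M])
  have triv: "cH S = 0 \<and> st S = 0" if "S = {} \<or> S = ?V" for S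
  proof -
    have "cross_edges (M l) S = {}" if "l < d" for l
      using \<open>S = {} \<or> S = ?V\<close> cross_edges_trivial[OF M[OF that]] by auto
    then have "x S = 0" by (simp add: x_def)
    then show ?thesis using that by (auto simp: cH_def st_def)
  qed
  define F where "F = {S. S \<subseteq> ?V \<and> S \<noteq> {} \<and> S \<noteq> ?V}"
  have F: "0 < card S \<and> card S < n" if "S \<in> F" for S
  proof -
    have "finite S" "S \<subset> ?V" "S \<noteq> {}" using that finite_subset[of S ?V] by (auto simp: F_def)
    then show ?thesis using psubset_card_mono[of ?V S] by (auto simp: card_gt_0_iff)
  qed
  have st_pos: "0 < st S" if "S \<in> F" for S using F[OF that] by (simp add: st_def)
  obtain \<tau> :: real and S0 where \<tau>: "\<tau> = 1 \<or> \<tau> = -1" and S0: "S0 \<subseteq> ?V" "\<epsilon> * st S0 < \<tau> * (cH S0 - st S0)"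
  proof -
    obtain S where S: "S \<subseteq> ?V" "\<not> ((1 - \<epsilon>) * st S \<le> cH S \<and> cH S \<le> (1 + \<epsilon>) * st S)"
      using neg cutH cut_complete_wgraph unfolding cut_sparsifier_def st_def
      by (auto simp: weighted_multigraph_def complete_wgraph_def)
    then consider "cH S < (1 - \<epsilon>) * st S" | "(1 + \<epsilon>) * st S < cH S" by linarith
    then show ?thesis
    proof cases
      case 1 then show ?thesis using S by (intro that[of "-1" S]) (auto simp: algebra_simps)
    next
      case 2 then show ?thesis using S by (intro that[of 1 S]) (auto simp: algebra_simps)
    qed
  qed
  have S0F: "S0 \<in> F" using S0 triv[of S0] by (auto simp: F_def)
  define \<rho> where "\<rho> S = \<tau> * (cH S / st S - 1)" for S
  have "finite F" by (rule finite_subset[of _ "Pow ?V"]) (auto simp: F_def)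
  then have fin: "finite (\<rho> ` F)" by simp
  then have "Max (\<rho> ` F) \<in> \<rho> ` F" using S0F by (intro Max_in) auto
  then obtain S1 where S1: "S1 \<in> F" "\<And>S. S \<in> F \<Longrightarrow> \<rho> S \<le> \<rho> S1"
    using Max_ge[OF fin] by force
  \<comment> \<open>Complementation preserves all cut values, so the smaller side may be
    chosen.\<close>
  define S where "S = (if 2 * card S1 \<le> n then S1 else ?V - S1)"
  have comp: "\<rho> (?V - S1) = \<rho> S1" "?V - S1 \<in> F" "card (?V - S1) = n - card S1"
  proof -
    have "finite S1" using S1 finite_subset[of S1 ?V] by (auto simp: F_def)
    then show c: "card (?V - S1) = n - card S1" using S1(1) by (simp add: F_def card_Diff_subset)
    have "x (?V - S1) = x S1" unfolding x_def using M cross_edges_Compl by (intro sum.cong) auto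
    moreover have "st (?V - S1) = st S1" using c F[OF S1(1)] by (simp add: st_def of_nat_diff)
    ultimately show "\<rho> (?V - S1) = \<rho> S1" by (simp add: \<rho>_def cH_def)
    show "?V - S1 \<in> F" using S1(1) by (auto simp: F_def)
  qed
  have S: "S \<in> F" "\<And>S'. S' \<in> F \<Longrightarrow> \<rho> S' \<le> \<rho> S" "2 * card S \<le> n"
    using S1 comp by (auto simp: S_def)
  define s t where "s = real (card S)" and "t = real n - real (card S)"
  have st0: "0 < s" "0 < t" using F[OF S(1)] by (auto simp: s_def t_def)
  have st_eq: "st S = s * t" by (simp add: st_def s_def t_def)
  have nst: "real n = s + t" by (simp add: s_def t_def)
  have n1: "0 < real n - 1" using F[OF S(1)] by auto
  have \<tau>2: "\<tau> * \<tau> = 1" using \<tau> by auto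
  let ?r = "\<rho> S"
  have cHS: "cH S = (1 + \<tau> * ?r) * (s * t)"
  proof -
    have "\<tau> * ?r = \<tau> * \<tau> * (cH S / st S - 1)" by (simp add: \<rho>_def)
    then have "1 + \<tau> * ?r = cH S / (s * t)" using \<tau>2 st_eq by simp
    then show ?thesis using st0 by simp
  qed
  have xS: "x S = (1 + \<tau> * ?r) * (s * t) * real d / (real n - 1)"
    using cHS n1 d unfolding cH_def by (simp add: field_simps)
  show ?thesis
  proof (rule that[of \<tau> S ?r])
    show "\<tau> = 1 \<or> \<tau> = -1" by fact
    show "S \<subseteq> ?V" using S(1) by (simp add: F_def)
    show "0 < card S" using F[OF S(1)] by simp
    show "2 * card S \<le> n" by (rule S(3))
    show "?r = cut_deviation n d \<tau> (card S) (\<lambda>l. card (cross_edges (M l) S))"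
      by (simp add: \<rho>_def cut_deviation_def cH_def x_def st_def mult_ac)
    have "\<epsilon> < \<rho> S0" using S0(2) st_pos[OF S0F] by (simp add: \<rho>_def field_simps)
    also have "\<dots> \<le> ?r" using S(2) S0F by blast
    finally show "\<epsilon> < ?r" .
    fix v assume v: "v \<in> ?V"
    define S' where "S' = (if v \<in> S then S - {v} else insert v S)"
    define c where "c = real (card {l \<in> {..<d}. v \<in> cross_verts (M l) S})"
    have fS: "finite S" using S(1) finite_subset[of S ?V] by (auto simp: F_def)
    have S'V: "S' \<subseteq> ?V" using v S(1) by (auto simp: S'_def F_def)
    \<comment> \<open>If the flip leads to the empty or the full set, which have no relative
      deviation, both sides of the inequality are 0.\<close>
    have opt: "\<tau> * cH S' \<le> (\<tau> + ?r) * st S'"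
    proof (cases "S' \<in> F")
      case True
      have "\<rho> S' \<le> ?r" by (rule S(2)[OF True])
      then have "\<tau> * (cH S' / st S') \<le> \<tau> + ?r" unfolding \<rho>_def[of S'] by (simp add: algebra_simps)
      then have "\<tau> * (cH S' / st S') * st S' \<le> (\<tau> + ?r) * st S'" using st_pos[OF True] by (intro mult_right_mono) auto
      then show ?thesis using st_pos[OF True] by simp
    next
      case False
      then show ?thesis using S'V triv[of S'] by (auto simp: F_def)
    qed
    have xS': "x S' = x S + real d - 2 * c"
    proof -
      have "x S' = (\<Sum>l<d. real (card (cross_edges (M l) S)) + (if v \<in> cross_verts (M l) S then - 1 else 1))"
        unfolding x_def by (intro sum.cong refl card_cross_edges_flip[OF M v]) (auto simp: S'_def)
      also have "\<dots> = x S + (\<Sum>l<d. 1 - 2 * (if v \<in> cross_verts (M l) S then 1 else 0))"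
        unfolding x_def sum.distrib by (intro arg_cong2[where f="(+)"] sum.cong) auto
      also have "(\<Sum>l<d. 1 - 2 * (if v \<in> cross_verts (M l) S then 1 else 0)) = real d - 2 * c"
        unfolding c_def by (simp add: sum_subtractf sum_distrib_left[symmetric] sum.If_cases Int_def)
      finally show ?thesis by simp
    qed
    \<comment> \<open>The size of the side opposite to \<open>v\<close>: moving \<open>v\<close>
      replaces its \<open>m\<close> crossing pairs in the complete graph by the
      \<open>n - 1 - m\<close> others.\<close>
    define m where "m = (if v \<in> S then t else s)"
    have st': "st S' = s * t + (real n - 2 * m - 1)"
    proof (cases "v \<in> S")
      case True
      then have c: "real (card S') = s - 1" using fS F[OF S(1)] by (simp add: S'_def s_def of_nat_diff)
      show ?thesis unfolding st_def c m_def nst using True by (simp add: algebra_simps)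
    next
      case False
      then have c: "real (card S') = s + 1" using fS by (simp add: S'_def s_def)
      show ?thesis unfolding st_def c m_def nst using False by (simp add: algebra_simps)
    qed
    \<comment> \<open>The total number of crossing edges divided by the size of a side is the mean
      number at a vertex of that side.\<close>
    have rate: "(\<Sum>l<d. vertex_rate n S (card (cross_edges (M l) S)) v) = (1 + \<tau> * ?r) * m * real d / (real n - 1)"
    proof -
      have "(\<Sum>l<d. vertex_rate n S (card (cross_edges (M l) S)) v) = x S / (if v \<in> S then s else t)"
        using F[OF S(1)] by (simp add: vertex_rate_def x_def s_def t_def sum_divide_distrib[symmetric] of_nat_diff)
      also have "\<dots> = (1 + \<tau> * ?r) * m * real d / (real n - 1)" unfolding xS m_def using st0 by simp
      finally show ?thesis .
    qed
    have cc: "cH S' = cH S + (real n - 1) * (1 - 2 * c / real d)"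
      unfolding cH_def xS' using d by (simp add: field_simps)
    have "\<tau> * ((1 + \<tau> * ?r) * (s * t)) = (\<tau> + \<tau> * \<tau> * ?r) * (s * t)" by (simp add: algebra_simps)
    then have B: "\<tau> * ((1 + \<tau> * ?r) * (s * t)) = (\<tau> + ?r) * (s * t)" using \<tau>2 by simp
    have A: "\<tau> * ((real n - 1) * (1 - 2 * c / real d)) \<le> (\<tau> + ?r) * (real n - 2 * m - 1)"
      using opt unfolding cc st' cHS distrib_left B by simp
    have "\<tau> * (c - (1 + \<tau> * ?r) * m * real d / (real n - 1)) = \<tau> * c - (\<tau> + ?r) * m * real d / (real n - 1)"
      using \<tau>2 by (simp add: algebra_simps add_divide_distrib)
    also have "\<dots> = (real d / (2 * (real n - 1))) * (2 * \<tau> * c * (real n - 1) / real d - 2 * m * (\<tau> + ?r))"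
      using d n1 by (simp add: field_simps)
    also have "\<dots> \<ge> (real d / (2 * (real n - 1))) * (- ?r * (real n - 1))"
    proof (rule mult_left_mono)
      show "- ?r * (real n - 1) \<le> 2 * \<tau> * c * (real n - 1) / real d - 2 * m * (\<tau> + ?r)"
        using A by (simp add: algebra_simps)
      show "0 \<le> real d / (2 * (real n - 1))" using n1 by simp
    qed
    finally have "(real d / (2 * (real n - 1))) * (- ?r * (real n - 1)) \<le> \<tau> * (c - (1 + \<tau> * ?r) * m * real d / (real n - 1))" .
    moreover have "(real d / (2 * (real n - 1))) * (- ?r * (real n - 1)) = - (?r * real d / 2)"
      using n1 by (simp add: field_simps)
    ultimately show "- (?r * real d / 2) \<le> \<tau> * (real (card {l \<in> {..<d}. v \<in> cross_verts (M l) S})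
       - (\<Sum>l<d. vertex_rate n S (card (cross_edges (M l) S)) v))"
      unfolding rate c_def[symmetric] by simp
  qed
qed

text \<open>A matching has at most \<open>card S\<close> crossing edges, and the larger side has at
  least \<open>(n - 1) / 2\<close> vertices, so no cut exceeds twice its value in the complete
  graph.\<close>

lemma cut_sparsifier_trivial:
  assumes n: "0 < n" and d: "0 < d" and M: "\<And>l. l < d \<Longrightarrow> M l \<in> perfect_matchings n"
  shows "cut_sparsifier 1 (weighted_multigraph n ((real n - 1) / real d) (\<Sum>i<d. mset_set (M i))) (complete_wgraph n)"
proof (rule ccontr)
  assume "\<not> ?thesis"
  from extremal_cut[OF n d M this] obtain \<tau> :: real and S \<rho> where *: "\<tau> = 1 \<or> \<tau> = -1" "S \<subseteq> {1..n}" "0 < card S" "2 * card S \<le> n"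
    "\<rho> = cut_deviation n d \<tau> (card S) (\<lambda>l. card (cross_edges (M l) S))" "1 < \<rho>" by metis
  have n2: "2 \<le> n" using *(3,4) by simp
  define s t where "s = real (card S)" and "t = real n - real (card S)"
  have st: "0 < s" "0 < t" "real n - 1 \<le> 2 * t" "0 \<le> real n - 1" using *(3,4) n2 by (auto simp: s_def t_def)
  let ?K = "\<Sum>l<d. real (card (cross_edges (M l) S))"
  have fS: "finite S" using *(2) finite_subset by auto
  have "card (cross_edges (M l) S) \<le> card S" if "l < d" for l
    using card_cross_verts(1)[OF M[OF that], of S] card_mono[of S "cross_verts (M l) S \<inter> S"] fS by auto
  then have "?K \<le> (\<Sum>l<d. s)" unfolding s_def by (intro sum_mono) auto
  then have K: "0 \<le> ?K" "?K \<le> real d * s" by (auto intro: sum_nonneg)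
  have "?K * (real n - 1) \<le> real d * s * (2 * t)" using K st by (intro mult_mono) auto
  then have "?K * (real n - 1) / (real d * (s * t)) \<le> 2" using st d by (simp add: divide_le_eq mult_ac)
  moreover have "0 \<le> ?K * (real n - 1) / (real d * (s * t))" using K st by simp
  ultimately show False using *(1,5,6) by (auto simp: cut_deviation_def s_def t_def)
qed

section \<open>The standard normal distribution function\<close>

text \<open>The standard normal distribution function, written as an upper tail at \<open>-g\<close>.\<close>

definition Phi :: "real \<Rightarrow> real" where
  "Phi g = (\<integral>x. std_normal_density x * indicator {-g..} x \<partial>lborel)"

lemma std_normal_indicator_integrable [simp]:
  "A \<in> sets borel \<Longrightarrow> integrable lborel (\<lambda>x. std_normal_density x * indicator A x)"
  by (rule integrable_std_normal_bounded[where C=1]) (auto split: split_indicator)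

lemma Phi_nonneg: "0 \<le> Phi g"
  unfolding Phi_def by (intro integral_nonneg_AE) auto

lemma Phi_mono: "a \<le> b \<Longrightarrow> Phi a \<le> Phi b"
  unfolding Phi_def by (intro integral_mono mult_left_mono) (auto split: split_indicator)

lemma Phi_le_1: "Phi g \<le> 1"
proof -
  have "Phi g \<le> (\<integral>x. std_normal_density x \<partial>lborel)"
    unfolding Phi_def by (intro integral_mono) (auto split: split_indicator)
  then show ?thesis by simp
qed

lemma Phi_diff:
  assumes "a \<le> b"
  shows "Phi b = Phi a + (\<integral>x. std_normal_density x * indicator {-b..<-a} x \<partial>lborel)"
proof -
  have "indicator {-b..} x = indicator {-a..} x + (indicator {-b..<-a} x :: real)" for x
    using assms by (auto split: split_indicator)
  then show ?thesis unfolding Phi_def by (simp add: distrib_left)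
qed

lemma Phi_le_add:
  assumes "a \<le> b" "\<And>x. -b \<le> x \<Longrightarrow> x \<le> -a \<Longrightarrow> std_normal_density x \<le> c"
  shows "Phi b \<le> Phi a + c * (b - a)"
proof -
  have "(\<integral>x. std_normal_density x * indicator {-b..<-a} x \<partial>lborel) \<le> (\<integral>x. c * indicator {-b..<-a} x \<partial>lborel)"
    using assms by (intro integral_mono) (auto split: split_indicator)
  also have "\<dots> = c * (b - a)" using assms(1) by simp
  finally show ?thesis using Phi_diff[OF assms(1)] by simp
qed

lemma inverse_sqrt_2pi_bounds: "0 < 1 / sqrt (2 * pi)" "1 / sqrt (2 * pi) \<le> 0.39895"
proof -
  have "(1 / 0.39895)\<^sup>2 \<le> 2 * pi" using pi_approx(1) by (simp add: power2_eq_square)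
  then have "1 / 0.39895 \<le> sqrt (2 * pi)" by (rule real_le_rsqrt)
  then show "1 / sqrt (2 * pi) \<le> 0.39895" by (simp add: field_simps)
qed simp

lemma std_normal_density_le_1: "std_normal_density x \<le> 1"
proof -
  have "std_normal_density x = 1 / sqrt (2 * pi) * exp (- x\<^sup>2 / 2)" by (simp add: std_normal_density_def)
  also have "\<dots> \<le> 0.39895 * 1" by (intro mult_mono inverse_sqrt_2pi_bounds) auto
  finally show ?thesis by simp
qed

lemma Phi_0: "Phi 0 = 1 / 2"
proof -
  have "Phi 0 = (\<integral>x. std_normal_density x * indicator {..0} x \<partial>lborel)"
  proof -
    have "(\<integral>x. std_normal_density x * indicator {..0} x \<partial>lborel)
      = \<bar>-1\<bar> *\<^sub>R (\<integral>x. std_normal_density (0 + (-1) * x) * indicator {..0} (0 + (-1) * x) \<partial>lborel)"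
      by (rule lborel_integral_real_affine) simp
    also have "\<dots> = Phi 0" unfolding Phi_def
      by (simp add: std_normal_density_def) (intro Bochner_Integration.integral_cong, auto split: split_indicator)
    finally show ?thesis by simp
  qed
  moreover have "(\<integral>x. std_normal_density x * indicator {..0} x \<partial>lborel) + Phi 0 = 1"
  proof -
    have "(\<integral>x. std_normal_density x * indicator {..0} x \<partial>lborel) + Phi 0 =
      (\<integral>x. std_normal_density x * indicator {..0} x + std_normal_density x * indicator {0..} x \<partial>lborel)"
      unfolding Phi_def by (subst Bochner_Integration.integral_add) auto
    also have "\<dots> = (\<integral>x. std_normal_density x \<partial>lborel)"
    proof (rule integral_cong_AE)
      have "AE x in lborel. x \<noteq> (0::real)" by (rule AE_lborel_singleton)
      then show "AE x in lborel. std_normal_density x * indicator {..0} x + std_normal_density x * indicator {0..} x = std_normal_density x"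
        by eventually_elim (auto split: split_indicator)
    qed auto
    finally show ?thesis by simp
  qed
  ultimately show ?thesis by simp
qed

text \<open>Truncation after an even power gives an upper bound, as the remainder has the sign of
  \<open>(- y) ^ 9\<close>.\<close>

lemma exp_minus_le_taylor8:
  fixes y :: real
  assumes "0 \<le> y"
  shows "exp (- y) \<le> (\<Sum>m<9. (- y) ^ m / fact m)"
proof -
  obtain t where "exp (- y) = (\<Sum>m<9. (- y) ^ m / fact m) + exp t / fact 9 * (- y) ^ 9"
    using Maclaurin_exp_le[of "- y" 9] by blast
  moreover have "exp t / fact 9 * (- y) ^ 9 \<le> 0" using assms by (intro mult_nonneg_nonpos) auto
  ultimately show ?thesis by simp
qed

text \<open>The Taylor polynomial of \<open>exp (- x ^ 2 / 2)\<close> is integrated over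
  \<open>[-g, 0]\<close> and added to \<open>Phi 0 = 1 / 2\<close>; 0.39895 rounds
  \<open>1 / sqrt (2 * pi) = 0.398942...\<close> up.\<close>

lemma Phi_le_taylor:
  assumes "0 \<le> g"
  shows "Phi g \<le> 1 / 2 + 0.39895 * (\<Sum>m<9. (- 1 / 2) ^ m * g ^ (2 * m + 1) / (fact m * real (2 * m + 1)))"
proof -
  let ?p = "\<lambda>x::real. \<Sum>m<9. (- (x\<^sup>2 / 2)) ^ m / fact m"
  let ?F = "\<lambda>x::real. \<Sum>m<9. (- 1 / 2) ^ m * x ^ (2 * m + 1) / (fact m * real (2 * m + 1))"
  have der: "(?F has_real_derivative ?p x) (at x)" for x
  proof -
    have "(?F has_real_derivative (\<Sum>m<9. (- 1 / 2) ^ m * (real (2 * m + 1) * x ^ (2 * m)) / (fact m * real (2 * m + 1)))) (at x)"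
    proof (rule DERIV_sum)
      fix m :: nat
      show "((\<lambda>x::real. (- 1 / 2) ^ m * x ^ (2 * m + 1) / (fact m * real (2 * m + 1))) has_real_derivative
          (- 1 / 2) ^ m * (real (2 * m + 1) * x ^ (2 * m)) / (fact m * real (2 * m + 1))) (at x)"
        using DERIV_cdivide[OF DERIV_cmult[OF DERIV_pow[of "2 * m + 1" x]], of "(- 1 / 2) ^ m" "fact m * real (2 * m + 1)"]
        by simp
    qed
    also have "(\<Sum>m<9. (- 1 / 2) ^ m * (real (2 * m + 1) * x ^ (2 * m)) / (fact m * real (2 * m + 1))) = ?p x"
    proof (rule sum.cong[OF refl])
      fix m :: nat
      have "(- 1 / 2) ^ m * (real (2 * m + 1) * x ^ (2 * m)) / (fact m * real (2 * m + 1)) = (- 1 / 2) ^ m * (x\<^sup>2) ^ m / fact m"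
        by (simp add: power_mult del: of_nat_add of_nat_mult of_nat_Suc)
      also have "(- 1 / 2) ^ m * (x\<^sup>2) ^ m = (- (x\<^sup>2 / 2)) ^ m" by (simp flip: power_mult_distrib)
      finally show "(- 1 / 2) ^ m * (real (2 * m + 1) * x ^ (2 * m)) / (fact m * real (2 * m + 1)) = (- (x\<^sup>2 / 2)) ^ m / fact m" .
    qed
    finally show ?thesis .
  qed
  have FTC: "has_bochner_integral lborel (\<lambda>x. ?p x * indicator {-g .. 0} x) (?F 0 - ?F (-g))"
    by (rule has_bochner_integral_FTC_Icc_real) (use assms der in \<open>auto intro!: continuous_intros\<close>)
  have "(\<integral>x. std_normal_density x * indicator {-g..<-0} x \<partial>lborel) \<le> (\<integral>x. 0.39895 * (?p x * indicator {-g .. 0} x) \<partial>lborel)"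
  proof (rule integral_mono)
    show "integrable lborel (\<lambda>x. 0.39895 * (?p x * indicator {-g .. 0} x))"
      by (intro integrable_mult_right) (use FTC has_bochner_integral_iff in blast)
    fix x :: real
    have e: "exp (- (x\<^sup>2 / 2)) \<le> ?p x" by (rule exp_minus_le_taylor8) simp
    have "std_normal_density x = 1 / sqrt (2 * pi) * exp (- (x\<^sup>2 / 2))" by (simp add: std_normal_density_def)
    also have "\<dots> \<le> 0.39895 * ?p x" using inverse_sqrt_2pi_bounds e by (intro mult_mono) auto
    finally have n: "std_normal_density x \<le> 0.39895 * ?p x" .
    have "0 \<le> ?p x" by (rule order.trans[OF _ e]) simp
    with n show "std_normal_density x * indicator {-g..<-0} x \<le> 0.39895 * (?p x * indicator {-g .. 0} x)"
      by (auto split: split_indicator)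
  qed simp
  also have "\<dots> = 0.39895 * (?F 0 - ?F (-g))"
    using has_bochner_integral_integral_eq[OF FTC] by simp
  also have "?F 0 - ?F (-g) = ?F g"
    by (simp add: sum_negf[symmetric])
  finally show ?thesis using Phi_diff[of 0 g] assms Phi_0 by simp
qed

text \<open>The true value is 0.94472...; the truncation error of the polynomial of degree 17 is
  only about 1e-6.\<close>

lemma Phi_numeric: "Phi 1.5957 \<le> 0.94475"
proof -
  have "(\<Sum>m<9. (- 1 / 2) ^ m * (1.5957::real) ^ (2 * m + 1) / (fact m * real (2 * m + 1))) \<le> (0.94475 - 1/2) / 0.39895"
    by (simp add: eval_nat_numeral lessThan_Suc fact_numeral)
  then show ?thesis using Phi_le_taylor[of "1.5957"] by simp
qed

text \<open>
  This is the numerical fact behind the theorem: the exponent of balanced cuts is already negative at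
  \<open>1.5957\<close>, slightly below \<open>2 * sqrt (2 / pi) = 1.59576...\<close>; the slack is less than \<open>0.0003\<close>.
\<close>

lemma ln_Phi_numeric: "ln 2 - 1.5957\<^sup>2 / 4 + ln (Phi 1.5957) \<le> - 0.0002"
proof -
  let ?u = "1.5957\<^sup>2 / 4 - 0.0002 :: real"
  have "Phi 1.5957 > 0" using Phi_mono[of 0 "1.5957"] Phi_0 by simp
  have "2 * Phi 1.5957 \<le> 2 * 0.94475" using Phi_numeric by simp
  also have "\<dots> \<le> (\<Sum>m<8. ?u ^ m / fact m)"
    by (simp add: eval_nat_numeral lessThan_Suc fact_numeral)
  also have "\<dots> \<le> exp ?u"
  proof -
    obtain t where "exp ?u = (\<Sum>m<8. ?u ^ m / fact m) + exp t / fact 8 * ?u ^ 8"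
      using Maclaurin_exp_le[of ?u 8] by blast
    moreover have "0 \<le> exp t / fact 8 * ?u ^ 8" by (intro mult_nonneg_nonneg) (auto simp: power2_eq_square)
    ultimately show ?thesis by linarith
  qed
  finally have "ln (2 * Phi 1.5957) \<le> ?u" using \<open>Phi 1.5957 > 0\<close> by (metis ln_exp ln_mono mult_pos_pos zero_less_numeral)
  then show ?thesis using \<open>Phi 1.5957 > 0\<close> by (simp add: ln_mult)
qed

section \<open>A uniform central limit theorem\<close>

text \<open>A smooth substitute for the indicator of a half-line. Its derivatives are polynomials in
  its own value, which makes the third-order remainder elementary to bound.\<close>

definition logistic :: "real \<Rightarrow> real" where "logistic z = 1 / (1 + exp (- z))"

lemma logistic_bounds: "0 < logistic z" "logistic z < 1"
  by (simp_all add: logistic_def add_pos_pos)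

lemma logistic_mono: "a \<le> b \<Longrightarrow> logistic a \<le> logistic b"
  unfolding logistic_def by (intro divide_left_mono) (auto simp: add_pos_pos)

lemma DERIV_logistic: "(logistic has_real_derivative logistic z - (logistic z)\<^sup>2) (at z)"
proof -
  have "0 < 1 + exp (- z)" by (simp add: add_pos_pos)
  then have "((\<lambda>z. 1 / (1 + exp (- z))) has_real_derivative exp (- z) / (1 + exp (- z))\<^sup>2) (at z)"
    by (auto intro!: derivative_eq_intros simp: power2_eq_square)
  moreover have "exp (- z) / (1 + exp (- z))\<^sup>2 = logistic z - (logistic z)\<^sup>2"
  proof -
    have "(u - 1) / u\<^sup>2 = 1 / u - (1 / u)\<^sup>2" if "u \<noteq> 0" for u :: real
      using that by (simp add: field_simps power2_eq_square)
    from this[of "1 + exp (- z)"] \<open>0 < 1 + exp (- z)\<close> show ?thesis unfolding logistic_def by simp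
  qed
  ultimately show ?thesis by (simp add: logistic_def[abs_def])
qed

text \<open>The polynomials express the first three derivatives of \<open>logistic\<close> through
  its value \<open>L\<close>; each has the factor \<open>L * (1 - L)\<close>, which lies between 0
  and \<open>1 / 4\<close>.\<close>

lemma unit_poly_bounds:
  assumes "0 \<le> (L::real)" "L \<le> 1"
  shows "\<bar>L - L\<^sup>2\<bar> \<le> 1" "\<bar>L - 3 * L\<^sup>2 + 2 * L ^ 3\<bar> \<le> 1" "\<bar>L - 7 * L\<^sup>2 + 12 * L ^ 3 - 6 * L ^ 4\<bar> \<le> 1"
proof -
  have a: "L - L\<^sup>2 = L * (1 - L)" by (simp add: power2_eq_square algebra_simps)
  have a0: "0 \<le> L * (1 - L)" "L * (1 - L) \<le> 1" using assms by (auto intro: mult_le_one)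
  then show "\<bar>L - L\<^sup>2\<bar> \<le> 1" unfolding a by simp
  have b: "L - 3 * L\<^sup>2 + 2 * L ^ 3 = (L * (1 - L)) * (1 - 2 * L)" by (simp add: power2_eq_square power3_eq_cube algebra_simps)
  show "\<bar>L - 3 * L\<^sup>2 + 2 * L ^ 3\<bar> \<le> 1" unfolding b abs_mult using a0 assms by (intro mult_le_one) auto
  have c: "L - 7 * L\<^sup>2 + 12 * L ^ 3 - 6 * L ^ 4 = (L * (1 - L)) * (1 - 6 * (L * (1 - L)))"
    by (simp add: power2_eq_square power3_eq_cube power4_eq_xxxx algebra_simps)
  have "L * (1 - L) \<le> 1 / 4" using zero_le_power2[of "L - 1/2"] by (simp add: power2_eq_square algebra_simps)
  then have "\<bar>1 - 6 * (L * (1 - L))\<bar> \<le> 1" using a0 by linarith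
  then show "\<bar>L - 7 * L\<^sup>2 + 12 * L ^ 3 - 6 * L ^ 4\<bar> \<le> 1" unfolding c abs_mult[of "L * (1 - L)"]
    using a0 by (intro mult_le_one) auto
qed

lemma logistic_taylor:
  "\<bar>logistic (z + h) - logistic z - h * (logistic z - (logistic z)\<^sup>2)
     - h\<^sup>2 / 2 * (logistic z - 3 * (logistic z)\<^sup>2 + 2 * logistic z ^ 3)\<bar> \<le> \<bar>h\<bar> ^ 3"
proof (cases "h = 0")
  case False
  define D where "D = (\<lambda>m z. if m = (0::nat) then logistic z else if m = 1 then logistic z - (logistic z)\<^sup>2
    else if m = 2 then logistic z - 3 * (logistic z)\<^sup>2 + 2 * logistic z ^ 3
    else logistic z - 7 * (logistic z)\<^sup>2 + 12 * logistic z ^ 3 - 6 * logistic z ^ 4)"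
  have der: "\<forall>m t. m < 3 \<and> min z (z + h) \<le> t \<and> t \<le> max z (z + h) \<longrightarrow> DERIV (D m) t :> D (Suc m) t"
  proof (intro allI impI)
    fix m :: nat and t assume "m < 3 \<and> min z (z + h) \<le> t \<and> t \<le> max z (z + h)"
    then consider "m = 0" | "m = 1" | "m = 2" by linarith
    then show "DERIV (D m) t :> D (Suc m) t"
    proof cases
      case 1 then show ?thesis using DERIV_logistic[of t] by (simp add: D_def)
    next
      case 2
      show ?thesis unfolding 2 D_def
        by (auto intro!: derivative_eq_intros DERIV_logistic simp: power2_eq_square power3_eq_cube algebra_simps)
    next
      case 3
      show ?thesis unfolding 3 D_def
        by (auto intro!: derivative_eq_intros DERIV_logistic simp: power2_eq_square power3_eq_cube power4_eq_xxxx algebra_simps)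
    qed
  qed
  have "\<exists>t. (if z + h < z then z + h < t \<and> t < z else z < t \<and> t < z + h) \<and>
     logistic (z + h) = (\<Sum>m<3. D m z / fact m * (z + h - z) ^ m) + D 3 t / fact 3 * (z + h - z) ^ 3"
    by (rule Taylor[OF _ _ der]) (use False in \<open>auto simp: D_def\<close>)
  then obtain t where t: "logistic (z + h) = (\<Sum>m<3. D m z / fact m * h ^ m) + D 3 t / fact 3 * h ^ 3" by auto
  have "logistic (z + h) - logistic z - h * (logistic z - (logistic z)\<^sup>2)
     - h\<^sup>2 / 2 * (logistic z - 3 * (logistic z)\<^sup>2 + 2 * logistic z ^ 3) = D 3 t / 6 * h ^ 3"
  proof -
    have "logistic (z + h) = D 0 z + D 1 z * h + D 2 z / 2 * h\<^sup>2 + D 3 t / 6 * h ^ 3"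
      unfolding t by (simp add: eval_nat_numeral lessThan_Suc fact_numeral)
    moreover have "D 0 z = logistic z" "D 1 z = logistic z - (logistic z)\<^sup>2"
      "D 2 z = logistic z - 3 * (logistic z)\<^sup>2 + 2 * logistic z ^ 3" by (simp_all add: D_def)
    ultimately show ?thesis by (metis (no_types, lifting) add_diff_cancel_left' diff_diff_eq mult.commute times_divide_eq_left)
  qed
  moreover have "\<bar>D 3 t / 6 * h ^ 3\<bar> \<le> 1 * \<bar>h\<bar> ^ 3"
    unfolding abs_mult power_abs using unit_poly_bounds(3)[of "logistic t"] logistic_bounds[of t]
    by (intro mult_right_mono) (auto simp: D_def)
  ultimately show ?thesis by simp
qed simp

text \<open>\<open>r\<close> is the width over which the smoothed indicator rises; the Taylor
  constant deteriorates like its inverse cube.\<close>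

lemma smooth3_logistic:
  assumes "0 < r"
  shows "smooth3 (1 / r ^ 3) (\<lambda>z. logistic (z / r + a))"
proof (rule smooth3I)
  have [measurable]: "logistic \<in> borel_measurable borel" unfolding logistic_def[abs_def] by measurable
  let ?L = "\<lambda>z. logistic (z / r + a)"
  show "?L \<in> borel_measurable borel" by measurable
  show "(\<lambda>z. (?L z - (?L z)\<^sup>2) / r) \<in> borel_measurable borel" by measurable
  show "(\<lambda>z. (?L z - 3 * (?L z)\<^sup>2 + 2 * ?L z ^ 3) / r\<^sup>2) \<in> borel_measurable borel" by measurable
  fix z
  show "0 \<le> ?L z" "?L z \<le> 1" using logistic_bounds[of "z / r + a"] by auto
  have b: "0 \<le> ?L z" "?L z \<le> 1" using logistic_bounds[of "z / r + a"] by auto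
  show "\<bar>(?L z - (?L z)\<^sup>2) / r\<bar> \<le> 1 / r + 1 / r\<^sup>2"
    using unit_poly_bounds(1)[OF b] assms by (auto simp: abs_divide intro!: add_increasing2 divide_right_mono)
  show "\<bar>(?L z - 3 * (?L z)\<^sup>2 + 2 * ?L z ^ 3) / r\<^sup>2\<bar> \<le> 1 / r + 1 / r\<^sup>2"
    using unit_poly_bounds(2)[OF b] assms by (auto simp: abs_divide intro!: add_increasing divide_right_mono)
  fix h
  have "?L (z + h) - ?L z - h * ((?L z - (?L z)\<^sup>2) / r) - h\<^sup>2 / 2 * ((?L z - 3 * (?L z)\<^sup>2 + 2 * ?L z ^ 3) / r\<^sup>2)
    = logistic (z / r + a + h / r) - ?L z - (h / r) * (?L z - (?L z)\<^sup>2) - (h / r)\<^sup>2 / 2 * (?L z - 3 * (?L z)\<^sup>2 + 2 * ?L z ^ 3)"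
  proof -
    have "h * (P / r) = (h / r) * P" "h\<^sup>2 / 2 * (P / r\<^sup>2) = (h / r)\<^sup>2 / 2 * P" for P
      by (simp_all add: power_divide)
    moreover have "(z + h) / r + a = z / r + a + h / r" by (simp add: add_divide_distrib)
    ultimately show ?thesis by presburger
  qed
  also have "\<bar>\<dots>\<bar> \<le> \<bar>h / r\<bar> ^ 3" by (rule logistic_taylor)
  also have "\<dots> = 1 / r ^ 3 * \<bar>h\<bar> ^ 3" using assms by (simp add: abs_divide power_divide)
  finally show "\<bar>?L (z + h) - ?L z - h * ((?L z - (?L z)\<^sup>2) / r) - h\<^sup>2 / 2 * ((?L z - 3 * (?L z)\<^sup>2 + 2 * ?L z ^ 3) / r\<^sup>2)\<bar> \<le> 1 / r ^ 3 * \<bar>h\<bar> ^ 3" .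
qed

text \<open>Left of \<open>- 2 * a * r\<close> the smoothed indicator is at most
  \<open>exp (- a)\<close>, and elsewhere it is at most 1; so it costs a shift of the threshold and
  an additive error.\<close>

lemma gauss_avg_logistic_le:
  assumes "0 < r" "0 \<le> a" "0 < \<sigma>"
  shows "gauss_avg (\<lambda>z. logistic (z / r + a)) \<sigma> g \<le> Phi ((g + 2 * a * r) / \<sigma>) + exp (- a)"
proof -
  let ?b = "(g + 2 * a * r) / \<sigma>"
  have [measurable]: "logistic \<in> borel_measurable borel" unfolding logistic_def[abs_def] by measurable
  have "gauss_avg (\<lambda>z. logistic (z / r + a)) \<sigma> g \<le> (\<integral>x. std_normal_density x * indicator {- ?b..} x + exp (- a) * std_normal_density x \<partial>lborel)"
    unfolding gauss_avg_def
  proof (rule integral_mono)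
    show "integrable lborel (\<lambda>x. std_normal_density x * logistic ((g + \<sigma> * x) / r + a))"
      by (rule integrable_std_normal_bounded[where C=1]) (auto simp: abs_of_pos logistic_bounds less_imp_le)
    fix x
    have "logistic ((g + \<sigma> * x) / r + a) \<le> indicator {- ?b..} x + exp (- a)"
    proof (cases "- ?b \<le> x")
      case True
      have "logistic ((g + \<sigma> * x) / r + a) \<le> 1" using logistic_bounds less_imp_le by blast
      also have "\<dots> \<le> indicator {- ?b..} x + exp (- a)" using True by simp
      finally show ?thesis .
    next
      case False
      then have "\<sigma> * x < - (g + 2 * a * r)" using assms(3) by (simp add: field_simps)
      then have "(g + \<sigma> * x) / r + a \<le> - a" using assms(1) by (simp add: field_simps)
      then have "logistic ((g + \<sigma> * x) / r + a) \<le> logistic (- a)" by (rule logistic_mono)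
      also have "\<dots> \<le> exp (- a)"
      proof -
        have "logistic (- a) = 1 / (1 + exp a)" by (simp add: logistic_def)
        also have "\<dots> \<le> 1 / exp a" by (intro divide_left_mono) (auto simp: add_pos_pos)
        finally show ?thesis by (simp add: exp_minus field_simps)
      qed
      finally show ?thesis using False by simp
    qed
    then show "std_normal_density x * logistic ((g + \<sigma> * x) / r + a) \<le> std_normal_density x * indicator {- ?b..} x + exp (- a) * std_normal_density x"
      using mult_left_mono[of _ _ "std_normal_density x"] by (fastforce simp: algebra_simps)
  qed simp
  also have "\<dots> = Phi ?b + exp (- a)" unfolding Phi_def by simp
  finally show ?thesis .
qed

section \<open>Tails of Bernoulli sums\<close>

text \<open>The indicator is at most \<open>1 + exp (- a)\<close> times the smoothed one, since
  \<open>logistic a = 1 / (1 + exp (- a))\<close>. Lindeberg passes to the normal law, where the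
  smoothing is undone. Both tails are covered by the scale \<open>c * \<tau>\<close>, of which the
  normal side sees only the modulus.\<close>

lemma bernoulli_sum_tail_le:
  assumes q: "\<And>l. l < d \<Longrightarrow> 0 \<le> q l \<and> q l \<le> 1" and \<tau>: "\<bar>\<tau>\<bar> = 1"
    and r: "0 < r" "0 \<le> a" and c: "0 < c" and \<sigma>: "\<sigma> = c * sqrt (\<Sum>l<d. q l * (1 - q l))" "0 < \<sigma>"
  shows "bernoulli_sum_avg d q (\<lambda>m. if - g \<le> c * (\<tau> * (real m - (\<Sum>l<d. q l))) then 1 else 0)
     \<le> (1 + exp (- a)) * (Phi ((g + 2 * a * r) / \<sigma>) + exp (- a) + 2 * (1 / r ^ 3) * c ^ 3 * real d)"
proof -
  let ?f = "\<lambda>z. logistic (z / r + a)"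
  let ?Q = "\<Sum>l<d. q l"
  have "bernoulli_sum_avg d q (\<lambda>m. if - g \<le> c * (\<tau> * (real m - ?Q)) then 1 else 0)
     \<le> bernoulli_sum_avg d q (\<lambda>m. (1 + exp (- a)) * ?f (g + (c * \<tau>) * (real m - ?Q)))"
  proof (rule bernoulli_sum_avg_mono[OF q])
    fix m :: nat
    have "1 \<le> (1 + exp (- a)) * ?f (g + (c * \<tau>) * (real m - ?Q))" if "- g \<le> c * (\<tau> * (real m - ?Q))"
    proof -
      have "a \<le> (g + (c * \<tau>) * (real m - ?Q)) / r + a" using that r by (simp add: mult.assoc)
      then have "logistic a \<le> ?f (g + (c * \<tau>) * (real m - ?Q))" by (rule logistic_mono)
      then have "(1 + exp (- a)) * logistic a \<le> (1 + exp (- a)) * ?f (g + (c * \<tau>) * (real m - ?Q))"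
        by (intro mult_left_mono) (auto simp: add_nonneg_nonneg)
      moreover have "1 + exp (- a) \<noteq> 0" using exp_gt_zero[of "- a"] by linarith
      then have "(1 + exp (- a)) * logistic a = 1" by (simp add: logistic_def)
      ultimately show ?thesis by simp
    qed
    moreover have "0 \<le> (1 + exp (- a)) * ?f (g + (c * \<tau>) * (real m - ?Q))"
      using logistic_bounds by (intro mult_nonneg_nonneg) (auto simp: less_imp_le add_nonneg_nonneg)
    ultimately show "(if - g \<le> c * (\<tau> * (real m - ?Q)) then 1 else 0) \<le> (1 + exp (- a)) * ?f (g + (c * \<tau>) * (real m - ?Q))"
      by auto
  qed auto
  also have "\<dots> = (1 + exp (- a)) * bernoulli_sum_avg d q (\<lambda>m. ?f (g + (c * \<tau>) * (real m - ?Q)))"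
    unfolding bernoulli_sum_avg_def by (simp add: sum_distrib_left mult_ac)
  also have "\<dots> \<le> (1 + exp (- a)) * (Phi ((g + 2 * a * r) / \<sigma>) + exp (- a) + 2 * (1 / r ^ 3) * c ^ 3 * real d)"
  proof (rule mult_left_mono)
    have "\<bar>c * \<tau>\<bar> = c" using \<tau> c by (simp add: abs_mult)
    then have "\<bar>bernoulli_sum_avg d q (\<lambda>m. ?f (g + (c * \<tau>) * (real m - ?Q))) - gauss_avg ?f \<sigma> g\<bar> \<le> 2 * (1 / r ^ 3) * c ^ 3 * real d"
      using bernoulli_sum_lindeberg[OF q smooth3_logistic[OF r(1)], where z=g and c="c * \<tau>"] r \<sigma> by simp
    then show "bernoulli_sum_avg d q (\<lambda>m. ?f (g + (c * \<tau>) * (real m - ?Q))) \<le> Phi ((g + 2 * a * r) / \<sigma>) + exp (- a) + 2 * (1 / r ^ 3) * c ^ 3 * real d"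
      using gauss_avg_logistic_le[OF r \<sigma>(2), of g] by linarith
  qed (auto simp: add_nonneg_nonneg)
  finally show ?thesis .
qed

text \<open>\<open>v\<close> is a nominal variance per trial; the true total may fall short of
  \<open>d * v\<close> by \<open>4 * sqrt d\<close>, a lower-order loss that uneven crossing counts
  can cause. The smoothing parameters \<open>a\<close> and \<open>r\<close> depend on
  \<open>\<omega>\<close> alone; with the scale \<open>1 / sqrt (d * v)\<close> the Lindeberg error
  is then of order \<open>1 / sqrt d\<close>, whatever the probabilities \<open>q\<close>.\<close>

lemma bernoulli_sum_tail_uniform:
  assumes "0 < \<omega>"
  shows "\<exists>D>0. \<forall>d\<ge>D. \<forall>q v g \<tau>. (\<forall>l<d. 0 \<le> q l \<and> q l \<le> 1) \<and> 1 / 5 \<le> v \<and> 0 \<le> g \<and> g \<le> 3 \<and> \<bar>\<tau>\<bar> = 1 \<and>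
      real d * v - 4 * sqrt (real d) \<le> (\<Sum>l<d. q l * (1 - q l)) \<longrightarrow>
     bernoulli_sum_avg d q (\<lambda>m. if - g * sqrt (real d * v) \<le> \<tau> * (real m - (\<Sum>l<d. q l)) then 1 else 0) \<le> Phi g + \<omega>"
proof -
  define \<delta> where "\<delta> = min 1 (\<omega> / 12)"
  have \<delta>: "0 < \<delta>" "\<delta> \<le> 1" "\<delta> \<le> \<omega> / 12" using assms by (auto simp: \<delta>_def)
  define a where "a = - ln \<delta>"
  have a: "0 \<le> a" "exp (- a) = \<delta>" using \<delta> by (auto simp: a_def)
  define r where "r = \<omega> / (64 * (a + 1))"
  have r: "0 < r" "2 * a * r \<le> \<omega> / 32"
  proof -
    show "0 < r" using a assms by (simp add: r_def)
    have "2 * a * r \<le> 2 * (a + 1) * r" using \<open>0 < r\<close> by (simp add: algebra_simps)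
    also have "\<dots> = \<omega> / 32" using a(1) by (simp add: r_def field_simps)
    finally show "2 * a * r \<le> \<omega> / 32" .
  qed
  \<comment> \<open>\<open>\<sigma>0 d\<close> bounds the normalized deviation from below, because
    \<open>4 * sqrt d / (d * v) \<le> 20 / sqrt d\<close> for \<open>v \<ge> 1 / 5\<close>;
    \<open>E d\<close> bounds the resulting increase of the argument of \<open>Phi\<close>, using
    \<open>g \<le> 3\<close>.\<close>
  define \<sigma>0 where "\<sigma>0 d = sqrt (1 - 20 / sqrt (real d))" for d :: nat
  define E where "E d = 3 * (1 / \<sigma>0 d - 1) + (\<omega> / 32) / \<sigma>0 d" for d :: nat
  have "E \<longlonglongrightarrow> \<omega> / 32" unfolding E_def \<sigma>0_def by real_asymp
  then have ev1: "eventually (\<lambda>d. E d < \<omega> / 8) sequentially" using assms by (intro order_tendstoD) auto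
  have "(\<lambda>d. 2 * (1 / r ^ 3) * (25 / sqrt (real d))) \<longlonglongrightarrow> 0" by real_asymp
  then have ev2: "eventually (\<lambda>d. 2 * (1 / r ^ 3) * (25 / sqrt (real d)) < \<omega> / 8) sequentially"
    using assms by (intro order_tendstoD) auto
  have ev3: "eventually (\<lambda>d::nat. 400 < real d) sequentially" by real_asymp
  obtain D where D: "\<And>d. d \<ge> D \<Longrightarrow> E d < \<omega> / 8 \<and> 2 * (1 / r ^ 3) * (25 / sqrt (real d)) < \<omega> / 8 \<and> 400 < real d"
    using eventually_conj[OF ev1 eventually_conj[OF ev2 ev3]] by (auto simp: eventually_sequentially)
  show ?thesis
  proof (intro exI[of _ "Suc D"] conjI allI impI)
    fix d and q :: "nat \<Rightarrow> real" and v g \<tau> :: real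
    assume dD: "Suc D \<le> d"
    assume H: "(\<forall>l<d. 0 \<le> q l \<and> q l \<le> 1) \<and> 1 / 5 \<le> v \<and> 0 \<le> g \<and> g \<le> 3 \<and> \<bar>\<tau>\<bar> = 1 \<and>
      real d * v - 4 * sqrt (real d) \<le> (\<Sum>l<d. q l * (1 - q l))"
    note Dd = D[of d] 
    have d400: "400 < real d" using Dd dD by simp
    then have d0: "0 < real d" by simp
    have sq20: "20 < sqrt (real d)" using real_sqrt_less_mono[OF d400] by simp
    define c where "c = 1 / sqrt (real d * v)"
    have dv: "0 < real d * v" using d0 H by (intro mult_pos_pos) auto
    have c0: "0 < c" using dv by (simp add: c_def)
    let ?W = "\<Sum>l<d. q l * (1 - q l)"
    define \<sigma> where "\<sigma> = c * sqrt ?W"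
    have "20 / sqrt (real d) < 1" using sq20 by (subst divide_less_eq_1_pos) linarith+
    then have s00: "0 < \<sigma>0 d" "\<sigma>0 d \<le> 1" by (auto simp: \<sigma>0_def)
    have "\<sigma>0 d \<le> \<sigma>"
    proof -
      have "1 - 20 / sqrt (real d) \<le> (real d * v - 4 * sqrt (real d)) / (real d * v)"
      proof -
        have "4 * sqrt (real d) / (real d * v) = 4 / (v * sqrt (real d))"
          using d0 H real_sqrt_mult_self[of "real d"] by (simp add: field_simps)
        also have "\<dots> \<le> 4 / ((1/5) * sqrt (real d))" using sq20 d0 H by (intro divide_left_mono mult_right_mono mult_pos_pos) auto
        also have "\<dots> = 20 / sqrt (real d)" by simp
        finally have "4 * sqrt (real d) / (real d * v) \<le> 20 / sqrt (real d)" .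
        moreover have "real d * v / (real d * v) = 1" by (rule divide_self) (use dv in linarith)
        ultimately show ?thesis unfolding diff_divide_distrib by linarith
      qed
      also have "\<dots> \<le> ?W / (real d * v)" using H dv by (intro divide_right_mono) auto
      finally have "\<sigma>0 d \<le> sqrt (?W / (real d * v))" unfolding \<sigma>0_def by (rule real_sqrt_le_mono)
      then show ?thesis by (simp add: \<sigma>_def c_def real_sqrt_divide)
    qed
    then have s0: "0 < \<sigma>" using s00 by simp
    have c3: "c ^ 3 * real d \<le> 25 / sqrt (real d)"
    proof -
      have "c ^ 3 * real d = real d / (real d * v * sqrt (real d * v))"
        using dv by (simp add: c_def power3_eq_cube)
      also have "\<dots> = 1 / (v * sqrt (real d * v))" using d0 by simp
      also have "\<dots> \<le> 1 / ((1/5) * sqrt (real d * (1/25)))"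
        using H d0 by (intro divide_left_mono mult_mono real_sqrt_le_mono mult_left_mono mult_pos_pos) auto
      also have "\<dots> = 25 / sqrt (real d)" by (simp add: real_sqrt_mult real_sqrt_divide)
      finally show ?thesis .
    qed
    have arg: "(g + 2 * a * r) / \<sigma> \<le> g + E d"
    proof -
      have "(g + 2 * a * r) / \<sigma> \<le> (g + \<omega> / 32) / \<sigma>0 d"
        using r s00 \<open>\<sigma>0 d \<le> \<sigma>\<close> H a assms by (intro frac_le) auto
      also have "\<dots> = g + g * (1 / \<sigma>0 d - 1) + (\<omega> / 32) / \<sigma>0 d" by (simp add: add_divide_distrib algebra_simps)
      also have "g * (1 / \<sigma>0 d - 1) \<le> 3 * (1 / \<sigma>0 d - 1)" using s00 H by (intro mult_right_mono) auto
      finally show ?thesis by (simp add: E_def)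
    qed
    have E0: "0 \<le> E d" unfolding E_def using s00 assms by (intro add_nonneg_nonneg mult_nonneg_nonneg) auto
    have P: "Phi ((g + 2 * a * r) / \<sigma>) \<le> Phi g + E d"
    proof -
      have "Phi ((g + 2 * a * r) / \<sigma>) \<le> Phi (g + E d)" by (rule Phi_mono[OF arg])
      also have "\<dots> \<le> Phi g + 1 * (g + E d - g)" using E0 by (intro Phi_le_add std_normal_density_le_1) auto
      finally show ?thesis by simp
    qed
    have "(\<lambda>m. if - g * sqrt (real d * v) \<le> \<tau> * (real m - (\<Sum>l<d. q l)) then 1 else 0 :: real)
       = (\<lambda>m. if - g \<le> c * (\<tau> * (real m - (\<Sum>l<d. q l))) then 1 else 0)"
      using dv by (simp add: c_def fun_eq_iff field_simps)
    then have "bernoulli_sum_avg d q (\<lambda>m. if - g * sqrt (real d * v) \<le> \<tau> * (real m - (\<Sum>l<d. q l)) then 1 else 0)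
      \<le> (1 + exp (- a)) * (Phi ((g + 2 * a * r) / \<sigma>) + exp (- a) + 2 * (1 / r ^ 3) * c ^ 3 * real d)"
      using bernoulli_sum_tail_le[OF _ _ r(1) a(1) c0 \<sigma>_def s0, of \<tau> g] H by simp
    also have "\<dots> \<le> (1 + \<delta>) * (Phi g + \<omega> / 8 + \<omega> / 12 + \<omega> / 8)"
    proof (intro mult_mono add_mono)
      show "Phi ((g + 2 * a * r) / \<sigma>) \<le> Phi g + \<omega> / 8" using P Dd dD by simp
      have "2 * (1 / r ^ 3) * c ^ 3 * real d \<le> 2 * (1 / r ^ 3) * (25 / sqrt (real d))"
        unfolding mult.assoc[of "2 * (1 / r ^ 3)"] using c3 r by (intro mult_left_mono) auto
      then show "2 * (1 / r ^ 3) * c ^ 3 * real d \<le> \<omega> / 8" using Dd dD by simp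
    qed (use a \<delta> r c0 Phi_nonneg in auto)
    also have "\<dots> = Phi g + \<delta> * Phi g + (1 + \<delta>) * (\<omega> / 3)" by (simp add: algebra_simps)
    also have "\<dots> \<le> Phi g + \<omega> / 12 * 1 + 2 * (\<omega> / 3)"
      using \<delta> Phi_le_1[of g] Phi_nonneg[of g] assms by (intro add_mono mult_mono) auto
    also have "\<dots> \<le> Phi g + \<omega>" using assms by simp
    finally show "bernoulli_sum_avg d q (\<lambda>m. if - g * sqrt (real d * v) \<le> \<tau> * (real m - (\<Sum>l<d. q l)) then 1 else 0) \<le> Phi g + \<omega>" .
  qed simp
qed

section \<open>Chernoff bounds for the number of crossing edges\<close>

lemma exp_le_quadratic: "exp z \<le> 1 + z + z\<^sup>2 / 2 * exp \<bar>z\<bar>" for z :: real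
proof -
  obtain t where t: "\<bar>t\<bar> \<le> \<bar>z\<bar>" "exp z = (\<Sum>m<2. z ^ m / fact m) + exp t / fact 2 * z ^ 2"
    using Maclaurin_exp_le[of z 2] by blast
  have "exp t \<le> exp \<bar>z\<bar>" using t(1) by simp
  then have "exp t / 2 * z\<^sup>2 \<le> exp \<bar>z\<bar> / 2 * z\<^sup>2" by (intro mult_right_mono) auto
  then show ?thesis using t(2) by (simp add: eval_nat_numeral lessThan_Suc mult_ac)
qed

text \<open>The product of two centred indicators has mean 0 and variance
  \<open>(a * (1 - a)) ^ 2\<close>, so the linear terms cancel. The factor
  \<open>exp \<bar>\<mu>\<bar>\<close> pays for the higher orders and is close to 1 for small
  \<open>\<mu>\<close>.\<close>

lemma pair_mgf_le:
  assumes "0 \<le> a" "a \<le> 1"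
  shows "pair_mgf a \<mu> \<le> exp ((\<mu> * (a * (1 - a)))\<^sup>2 / 2 * exp \<bar>\<mu>\<bar>)"
proof -
  define b where "b = 1 - a"
  have b: "0 \<le> b" "b \<le> 1" "a + b = 1" using assms by (auto simp: b_def)
  have e: "exp (\<mu> * y) \<le> 1 + \<mu> * y + (\<mu> * y)\<^sup>2 / 2 * exp \<bar>\<mu>\<bar>" if "\<bar>y\<bar> \<le> 1" for y
  proof -
    have "\<bar>\<mu> * y\<bar> \<le> \<bar>\<mu>\<bar>" using that by (simp add: abs_mult mult_left_le)
    then have "(\<mu> * y)\<^sup>2 / 2 * exp \<bar>\<mu> * y\<bar> \<le> (\<mu> * y)\<^sup>2 / 2 * exp \<bar>\<mu>\<bar>" by (intro mult_left_mono) auto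
    then show ?thesis using exp_le_quadratic[of "\<mu> * y"] by linarith
  qed
  have "pair_mgf a \<mu> = b\<^sup>2 * exp (\<mu> * a\<^sup>2) + 2 * a * b * exp (\<mu> * (- (a * b))) + a\<^sup>2 * exp (\<mu> * b\<^sup>2)"
    unfolding pair_mgf_def b_def[symmetric] by simp
  also have "\<dots> \<le> b\<^sup>2 * (1 + \<mu> * a\<^sup>2 + (\<mu> * a\<^sup>2)\<^sup>2 / 2 * exp \<bar>\<mu>\<bar>)
      + 2 * a * b * (1 + \<mu> * (- (a * b)) + (\<mu> * (- (a * b)))\<^sup>2 / 2 * exp \<bar>\<mu>\<bar>)
      + a\<^sup>2 * (1 + \<mu> * b\<^sup>2 + (\<mu> * b\<^sup>2)\<^sup>2 / 2 * exp \<bar>\<mu>\<bar>)"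
    using assms b by (intro add_mono mult_left_mono e) (auto simp: abs_mult power_le_one mult_le_one)
  also have "\<dots> = (a + b)\<^sup>2 + (\<mu> * (a * b))\<^sup>2 * (a + b)\<^sup>2 / 2 * exp \<bar>\<mu>\<bar>"
    by (simp add: power2_eq_square algebra_simps add_divide_distrib)
  also have "\<dots> = 1 + (\<mu> * (a * b))\<^sup>2 / 2 * exp \<bar>\<mu>\<bar>" using b by simp
  also have "\<dots> \<le> exp ((\<mu> * (a * b))\<^sup>2 / 2 * exp \<bar>\<mu>\<bar>)" by (rule exp_ge_add_one_self)
  finally show ?thesis unfolding b_def .
qed

section \<open>Entropy bounds\<close>

definition bin_entropy :: "real \<Rightarrow> real" where
  "bin_entropy a = - a * ln a - (1 - a) * ln (1 - a)"

text \<open>The second derivative \<open>- 1 / (y * (1 - y))\<close> of the entropy is at most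
  \<open>- 4\<close>, and value and slope of both sides agree at \<open>1 / 2\<close>. The fact
  \<open>key\<close> is the first integration.\<close>

lemma bin_entropy_le_quadratic:
  assumes "0 < a" "a \<le> 1 / 2"
  shows "bin_entropy a \<le> ln 2 - 2 * (1 / 2 - a)\<^sup>2"
proof -
  have key: "2 * (1 - 2 * x) \<le> ln (1 - x) - ln x" if "0 < x" "x \<le> 1 / 2" for x :: real
  proof -
    let ?g = "\<lambda>x::real. ln (1 - x) - ln x - 2 * (1 - 2 * x)"
    have "?g (1/2) \<le> ?g x"
    proof (rule DERIV_nonpos_imp_nonincreasing[OF that(2)])
      fix y :: real assume y: "x \<le> y" "y \<le> 1 / 2"
      have yp: "0 < y" "y < 1" using y that by auto
      have "(?g has_real_derivative (- (1 / (1 - y)) - 1 / y + 4)) (at y)"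
        using yp by (auto intro!: derivative_eq_intros)
      moreover have "- (1 / (1 - y)) - 1 / y + 4 \<le> 0"
      proof -
        have "y * (1 - y) \<le> 1 / 4" using zero_le_power2[of "y - 1/2"] by (simp add: power2_eq_square algebra_simps)
        then have "4 \<le> 1 / (y * (1 - y))" using yp by (simp add: le_divide_eq)
        also have "\<dots> = 1 / (1 - y) + 1 / y" using yp by (simp add: field_simps)
        finally show ?thesis by simp
      qed
      ultimately show "\<exists>D. (?g has_real_derivative D) (at y) \<and> D \<le> 0" by blast
    qed
    then show ?thesis by simp
  qed
  let ?f = "\<lambda>a. bin_entropy a + 2 * (1 / 2 - a)\<^sup>2"
  have "?f a \<le> ?f (1/2)"
  proof (rule DERIV_nonneg_imp_nondecreasing[OF assms(2)])
    fix y :: real assume y: "a \<le> y" "y \<le> 1 / 2"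
    have yp: "0 < y" "y < 1" using y assms by auto
    have "(?f has_real_derivative (ln (1 - y) - ln y - 2 * (1 - 2 * y))) (at y)"
    proof -
      have 1: "((\<lambda>a. a * ln a) has_real_derivative ln y + 1) (at y)"
        using yp by (auto intro!: derivative_eq_intros)
      have 2: "((\<lambda>a. (1 - a) * ln (1 - a)) has_real_derivative - ln (1 - y) - 1) (at y)"
        using yp by (auto intro!: derivative_eq_intros)
      have 3: "((\<lambda>a. 2 * (1 / 2 - a)\<^sup>2) has_real_derivative - (2 * (1 - 2 * y))) (at y)"
        by (auto intro!: derivative_eq_intros simp: algebra_simps)
      have "((\<lambda>a. - (a * ln a) - (1 - a) * ln (1 - a) + 2 * (1 / 2 - a)\<^sup>2) has_real_derivative
          (- (ln y + 1) - (- ln (1 - y) - 1) + - (2 * (1 - 2 * y)))) (at y)"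
        by (intro DERIV_add DERIV_diff DERIV_minus 1 2 3)
      then show ?thesis by (simp add: bin_entropy_def[abs_def] algebra_simps)
    qed
    moreover have "0 \<le> ln (1 - y) - ln y - 2 * (1 - 2 * y)" using key[of y] yp y by simp
    ultimately show "\<exists>D. (?f has_real_derivative D) (at y) \<and> 0 \<le> D" by blast
  qed
  also have "?f (1/2) = ln 2" by (simp add: bin_entropy_def ln_div)
  finally show ?thesis by simp
qed

lemma bin_entropy_le_log:
  assumes "0 < a" "a < 1"
  shows "bin_entropy a \<le> a * (1 - ln a)"
proof -
  have "- ln (1 - a) = ln (1 / (1 - a))" using assms by (simp add: ln_div)
  also have "\<dots> \<le> 1 / (1 - a) - 1" using assms by (intro ln_le_minus_one) auto
  also have "\<dots> = a / (1 - a)" using assms by (simp add: field_simps)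
  finally have "(1 - a) * (- ln (1 - a)) \<le> (1 - a) * (a / (1 - a))" using assms by (intro mult_left_mono) auto
  moreover have "(1 - a) * (a / (1 - a)) = a" using assms by simp
  ultimately show ?thesis unfolding bin_entropy_def by (simp add: algebra_simps)
qed

lemma bin_entropy_small:
  assumes "0 < a" "a \<le> 1 / 100"
  shows "bin_entropy a \<le> 0.21"
proof -
  have "ln (1 / sqrt a) \<le> 1 / sqrt a - 1" using assms by (intro ln_le_minus_one) auto
  then have "- ln a \<le> 2 / sqrt a" using assms by (simp add: ln_div ln_sqrt)
  then have "a * (- ln a) \<le> a * (2 / sqrt a)" using assms by (intro mult_left_mono) auto
  also have "\<dots> = 2 * sqrt a" using assms real_div_sqrt[of a] by (simp add: field_simps)
  also have "\<dots> \<le> 2 * (1 / 10)"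
  proof -
    have "sqrt a \<le> 1 / 10" using assms by (intro real_le_lsqrt) (auto simp: power2_eq_square)
    then show ?thesis by simp
  qed
  finally show ?thesis using bin_entropy_le_log[of a] assms by (simp add: algebra_simps)
qed

text \<open>\<open>exp (- n * bin_entropy a)\<close> is \<open>a ^ s * (1 - a) ^ (n - s)\<close>, so
  a single binomial probability is bounded by 1.\<close>

lemma binomial_le_exp_entropy:
  assumes "0 < s" "s < n" "a = real s / real n"
  shows "real (n choose s) \<le> exp (real n * bin_entropy a)"
proof -
  have a: "0 < a" "a < 1" using assms by auto
  have e: "exp (- (real n * bin_entropy a)) = a ^ s * (1 - a) ^ (n - s)"
  proof -
    have "- (real n * bin_entropy a) = real s * ln a + real (n - s) * ln (1 - a)"
      using assms(1,2) unfolding bin_entropy_def assms(3) by (simp add: field_simps of_nat_diff)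
    then show ?thesis using a by (simp add: exp_add exp_of_nat_mult)
  qed
  have "real (n choose s) * exp (- (real n * bin_entropy a)) \<le> 1"
    unfolding e using binomial_prob_le_1[of s n a] assms a by (simp add: mult.assoc)
  then show ?thesis by (simp add: exp_minus field_simps)
qed

section \<open>Tail bounds for the crossing counts\<close>

text \<open>\<open>W\<close> is the price of fixing the size of the random vertex set:
  \<open>n + 1\<close> in general, \<open>exp (card S)\<close> for small sets.\<close>

lemma cross_prob_le_exp:
  assumes n: "even n" and S: "S \<subseteq> {1..n}" "0 < card S" "card S < n" and a: "a = real (card S) / real n"
    and W: "1 \<le> W * (real (n choose card S) * a ^ card S * (1 - a) ^ (n - card S))"
  shows "cross_prob n S k \<le> W * exp (real n * ((\<mu> * (a * (1 - a)))\<^sup>2 * exp \<bar>\<mu>\<bar> / 4 - \<mu> * (a * (1 - a) - real k / real n) / 2))"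
proof -
  have n0: "0 < n" using S by auto
  have a01: "0 \<le> a" "a \<le> 1" using S a by auto
  let ?B = "real (n choose card S) * a ^ card S * (1 - a) ^ (n - card S)"
  let ?E = "exp (\<mu> * (a * (1 - a) * real n - real k) / 2)"
  have B0: "0 \<le> ?B" using a01 by simp
  have W0: "0 \<le> W"
  proof (rule ccontr)
    assume "\<not> 0 \<le> W"
    then have "W * ?B \<le> 0" using B0 by (intro mult_nonpos_nonneg) auto
    with W show False by simp
  qed
  have p0: "0 \<le> cross_prob n S k" by (simp add: cross_prob_def)
  have "?B * cross_prob n S k * ?E \<le> pair_mgf a \<mu> ^ (n div 2)"
    using cross_prob_le_mgf[OF n S(1) n0 a, of k \<mu>] .
  also have "\<dots> \<le> exp ((\<mu> * (a * (1 - a)))\<^sup>2 / 2 * exp \<bar>\<mu>\<bar>) ^ (n div 2)"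
    using pair_mgf_le[OF a01] a01 by (intro power_mono) (auto simp: pair_mgf_def)
  also have "\<dots> = exp (real n * ((\<mu> * (a * (1 - a)))\<^sup>2 * exp \<bar>\<mu>\<bar> / 4))"
    using n by (auto elim!: evenE simp flip: exp_of_nat_mult)
  finally have 1: "?B * cross_prob n S k * ?E \<le> exp (real n * ((\<mu> * (a * (1 - a)))\<^sup>2 * exp \<bar>\<mu>\<bar> / 4))" .
  have "cross_prob n S k * ?E \<le> (W * ?B) * (cross_prob n S k * ?E)"
    using W p0 mult_right_mono[of 1 "W * ?B" "cross_prob n S k * ?E"] by simp
  also have "\<dots> = W * (?B * cross_prob n S k * ?E)" by (simp add: mult_ac)
  also have "\<dots> \<le> W * exp (real n * ((\<mu> * (a * (1 - a)))\<^sup>2 * exp \<bar>\<mu>\<bar> / 4))" by (rule mult_left_mono[OF 1 W0])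
  finally have 2: "cross_prob n S k \<le> W * exp (real n * ((\<mu> * (a * (1 - a)))\<^sup>2 * exp \<bar>\<mu>\<bar> / 4)) / ?E"
    by (simp add: le_divide_eq)
  also have "\<dots> = W * exp (real n * ((\<mu> * (a * (1 - a)))\<^sup>2 * exp \<bar>\<mu>\<bar> / 4) - \<mu> * (a * (1 - a) * real n - real k) / 2)"
    by (simp add: exp_diff)
  also have "real n * ((\<mu> * (a * (1 - a)))\<^sup>2 * exp \<bar>\<mu>\<bar> / 4) - \<mu> * (a * (1 - a) * real n - real k) / 2
    = real n * ((\<mu> * (a * (1 - a)))\<^sup>2 * exp \<bar>\<mu>\<bar> / 4 - \<mu> * (a * (1 - a) - real k / real n) / 2)"
    using n0 by (simp add: field_simps)
  finally show ?thesis .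
qed

text \<open>The Chernoff parameter \<open>- \<tau> * \<mu>\<close> treats both signs at once. The
  term \<open>1 / (n - 1)\<close> absorbs the ratio \<open>n / (n - 1)\<close> between the mean
  number of crossing edges of a matching and \<open>a * (1 - a) * n\<close>.\<close>

lemma prod_cross_prob_le:
  assumes n: "even n" and S: "S \<subseteq> {1..n}" "0 < card S" "card S < n" and a: "a = real (card S) / real n"
    and W: "1 \<le> W * (real (n choose card S) * a ^ card S * (1 - a) ^ (n - card S))"
    and \<tau>: "\<tau> = 1 \<or> \<tau> = -1" and \<rho>: "\<rho> = cut_deviation n d \<tau> (card S) k" "0 \<le> \<rho>" and d: "0 < d" and \<mu>: "0 \<le> \<mu>"
  shows "(\<Prod>l<d. cross_prob n S (k l)) \<le> W ^ d * exp (real n * (real d * (\<mu> * (a * (1 - a)))\<^sup>2 * exp \<mu> / 4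
       - \<mu> * real d * (a * (1 - a)) * (\<rho> - 1 / (real n - 1)) / 2))"
proof -
  define v where "v = a * (1 - a)"
  have n1: "0 < real n - 1" using S by auto
  have a01: "0 < a" "a < 1" using S a by auto
  have v0: "0 < v" using a01 by (simp add: v_def)
  have vn: "real (card S) * (real n - real (card S)) = v * (real n)\<^sup>2"
    using n1 unfolding v_def a by (simp add: field_simps power2_eq_square)
  let ?K = "\<Sum>l<d. real (k l)"
  have K: "?K / real n = (1 + \<tau> * \<rho>) * (real d * v) * (real n / (real n - 1))"
  proof -
    have "\<tau> * \<rho> = \<tau> * \<tau> * (?K * (real n - 1) / (real d * (v * (real n)\<^sup>2)) - 1)"
      unfolding \<rho>(1) cut_deviation_def vn by simp
    then have "1 + \<tau> * \<rho> = ?K * (real n - 1) / (real d * (v * (real n)\<^sup>2))" using \<tau> by auto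
    then show ?thesis using n1 v0 d by (simp add: field_simps power2_eq_square)
  qed
  have "(\<Prod>l<d. cross_prob n S (k l)) \<le> (\<Prod>l<d. W * exp (real n * ((- \<tau> * \<mu> * (a * (1 - a)))\<^sup>2 * exp \<bar>- \<tau> * \<mu>\<bar> / 4 - (- \<tau> * \<mu>) * (a * (1 - a) - real (k l) / real n) / 2)))"
    by (intro prod_mono conjI cross_prob_le_exp[OF n S a W]) (auto simp: cross_prob_def)
  also have "\<dots> = W ^ d * exp (\<Sum>l<d. real n * ((- \<tau> * \<mu> * v)\<^sup>2 * exp \<bar>- \<tau> * \<mu>\<bar> / 4 - (- \<tau> * \<mu>) * (v - real (k l) / real n) / 2))"
    by (simp add: prod.distrib exp_sum v_def)
  also have "(\<Sum>l<d. real n * ((- \<tau> * \<mu> * v)\<^sup>2 * exp \<bar>- \<tau> * \<mu>\<bar> / 4 - (- \<tau> * \<mu>) * (v - real (k l) / real n) / 2))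
     = real n * (real d * ((\<mu> * v)\<^sup>2 * exp \<mu> / 4) + \<tau> * \<mu> * (real d * v - ?K / real n) / 2)"
  proof -
    have "(- \<tau> * \<mu> * v)\<^sup>2 * exp \<bar>- \<tau> * \<mu>\<bar> = (\<mu> * v)\<^sup>2 * exp \<mu>" using \<tau> \<mu> by auto
    then show ?thesis
      by (simp add: sum_distrib_left[symmetric] sum.distrib sum_subtractf sum_divide_distrib[symmetric])
  qed
  also have "W ^ d * exp \<dots> \<le> W ^ d * exp (real n * (real d * (\<mu> * v)\<^sup>2 * exp \<mu> / 4 - \<mu> * real d * v * (\<rho> - 1 / (real n - 1)) / 2))"
  proof (rule mult_left_mono)
    have W0: "0 \<le> W"
    proof (rule ccontr)
      assume "\<not> 0 \<le> W"
      then have "W * (real (n choose card S) * a ^ card S * (1 - a) ^ (n - card S)) \<le> 0"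
        using a01 by (intro mult_nonpos_nonneg) auto
      with W show False by simp
    qed
    then show "0 \<le> W ^ d" by simp
    have r: "real n / (real n - 1) = 1 + 1 / (real n - 1)" using n1 by (simp add: field_simps)
    define i where "i = 1 / (real n - 1)"
    have i0: "0 \<le> i" using n1 by (simp add: i_def)
    have "\<tau> * (real d * v - ?K / real n) = real d * v * (\<tau> * (1 - (1 + \<tau> * \<rho>) * (1 + i)))"
      unfolding K r i_def[symmetric] by (simp add: algebra_simps)
    also have "\<tau> * (1 - (1 + \<tau> * \<rho>) * (1 + i)) = - \<tau> * i - \<rho> * (1 + i)" using \<tau> by (auto simp: algebra_simps)
    also have "real d * v * (- \<tau> * i - \<rho> * (1 + i)) \<le> real d * v * (- (\<rho> - i))"
    proof (rule mult_left_mono)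
      have "0 \<le> \<rho> * i" using i0 \<rho>(2) by simp
      moreover have "- \<tau> * i \<le> i" using \<tau> i0 by auto
      ultimately show "- \<tau> * i - \<rho> * (1 + i) \<le> - (\<rho> - i)" by (simp add: algebra_simps)
    qed (use v0 in auto)
    finally have *: "\<mu> * (\<tau> * (real d * v - ?K / real n)) \<le> \<mu> * (real d * v * (- (\<rho> - i)))" using \<mu> by (rule mult_left_mono)
    then have "real d * ((\<mu> * v)\<^sup>2 * exp \<mu> / 4) + \<tau> * \<mu> * (real d * v - ?K / real n) / 2
      \<le> real d * (\<mu> * v)\<^sup>2 * exp \<mu> / 4 - \<mu> * real d * v * (\<rho> - i) / 2"
    proof -
      have eqs: "\<tau> * \<mu> * (real d * v - ?K / real n) = \<mu> * (\<tau> * (real d * v - ?K / real n))"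
        "real d * ((\<mu> * v)\<^sup>2 * exp \<mu> / 4) = real d * (\<mu> * v)\<^sup>2 * exp \<mu> / 4" by (simp_all add: algebra_simps)
      have eq: "\<mu> * (real d * v * (- (\<rho> - i))) = - (\<mu> * real d * v * (\<rho> - i))" by (simp add: algebra_simps)
      have gen: "q + x / 2 \<le> q - z / 2" if "x \<le> - z" for x z q :: real using that by simp
      show ?thesis unfolding eqs by (rule gen) (use * in \<open>simp only: eq\<close>)
    qed
    then show "exp (real n * (real d * ((\<mu> * v)\<^sup>2 * exp \<mu> / 4) + \<tau> * \<mu> * (real d * v - ?K / real n) / 2))
      \<le> exp (real n * (real d * (\<mu> * v)\<^sup>2 * exp \<mu> / 4 - \<mu> * real d * v * (\<rho> - 1 / (real n - 1)) / 2))"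
      unfolding i_def[symmetric] by (simp add: mult_left_mono)
  qed
  finally show ?thesis unfolding v_def .
qed

section \<open>Negativity of the exponent\<close>

text \<open>For \<open>a * sqrt d < 2\<close> a parameter of order \<open>1 / (a * sqrt d)\<close>,
  as used for larger \<open>a\<close>, would make \<open>exp \<mu>\<close> too large; a logarithmic
  one replaces it. All terms are compared with \<open>a * sqrt d * u\<close>: the entropy has
  coefficient at most 0.04, since \<open>1 - ln a = u + ln (sqrt d / 2)\<close>, the quadratic term
  at most \<open>1 / 24\<close>, and the gain at least 0.18.\<close>

lemma exponent_small:
  fixes d a \<rho> i :: real
  assumes d: "100 \<le> sqrt d" "1 + ln (sqrt d) \<le> 0.04 * sqrt d" and a: "0 < a" "a * sqrt d < 2"
    and \<rho>: "1.5957 \<le> \<rho> * sqrt d" and i: "0 \<le> i" "i * sqrt d \<le> 0.00001"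
    and u: "u = 1 + ln (2 / (a * sqrt d))" and \<mu>: "\<mu> = u / 4"
  shows "1 \<le> u" "bin_entropy a + (d * (\<mu> * (a * (1 - a)))\<^sup>2 * exp \<mu> / 4 - \<mu> * d * (a * (1 - a)) * (\<rho> - i) / 2) \<le> - (a * sqrt d * u / 20)"
proof -
  define R where "R = sqrt d"
  have "0 < sqrt d" using d(1) by linarith
  then have d0: "0 \<le> d" by simp
  then have R: "100 \<le> R" "1 + ln R \<le> 0.04 * R" "R\<^sup>2 = d" using d by (auto simp: R_def)
  have R0: "0 < R" using R(1) by linarith
 then have aR: "0 < a * R" "a * R < 2" using a by (auto simp: R_def)
  define w where "w = 2 / (a * R)"
  have w: "1 < w" using aR by (simp add: w_def)
  have u': "u = 1 + ln w" by (simp add: u w_def R_def)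
  then show u1: "1 \<le> u" using w by simp
  have a02: "a \<le> 0.02"
  proof -
    have "a * 100 \<le> a * R" using a R by (intro mult_left_mono) auto
    then show ?thesis using aR by simp
  qed
  have aw: "a * R = 2 / w" using aR by (simp add: w_def)
  \<comment> \<open>\<open>exp \<mu>\<close> is compensated by one factor
    \<open>a * R = 2 / w\<close>, because \<open>w = exp (u - 1)\<close> while
    \<open>\<mu> = u / 4\<close>.\<close>
  have T2: "d * (\<mu> * (a * (1 - a)))\<^sup>2 * exp \<mu> / 4 \<le> a * R * u * (1 / 24)"
  proof -
    have "exp \<mu> / w = exp (1 - 3 * u / 4)"
    proof -
      have "w = exp (u - 1)" using u' w by simp
      then have "exp \<mu> / w = exp (u / 4 - (u - 1))" by (simp only: \<mu> exp_diff[symmetric])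
      also have "u / 4 - (u - 1) = 1 - 3 * u / 4" by simp
      finally show ?thesis .
    qed
    moreover have "u * exp (1 - 3 * u / 4) \<le> 4 / 3"
    proof -
      have "3 * u / 4 \<le> exp (3 * u / 4 - 1)" using exp_ge_add_one_self[of "3 * u / 4 - 1"] by simp
      then have "3 * u / 4 * exp (1 - 3 * u / 4) \<le> exp (3 * u / 4 - 1) * exp (1 - 3 * u / 4)"
        by (intro mult_right_mono) auto
      also have "\<dots> = 1" by (simp flip: exp_add)
      finally show ?thesis by simp
    qed
    ultimately have k: "u * (exp \<mu> / w) \<le> 4 / 3" by simp
    have "d * (\<mu> * (a * (1 - a)))\<^sup>2 * exp \<mu> / 4 = (a * R) * (1 - a)\<^sup>2 * (u * (u * (exp \<mu> * (a * R)))) / 64"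
      unfolding \<mu> R(3)[symmetric] by (simp add: power2_eq_square)
    also have "\<dots> \<le> (a * R) * 1 * (u * (u * (exp \<mu> * (a * R)))) / 64"
      using a a02 aR u1 R0 by (intro divide_right_mono mult_right_mono mult_left_mono mult_nonneg_nonneg power_le_one) auto
    also have "\<dots> = (a * R) * u * (u * (exp \<mu> / w)) / 32" unfolding aw by simp
    also have "\<dots> \<le> (a * R) * u * (4 / 3) / 32"
      using k aR u1 by (intro divide_right_mono mult_left_mono) auto
    finally show ?thesis by (simp add: mult_ac)
  qed
  have T3: "0.18 * (a * R * u) \<le> \<mu> * d * (a * (1 - a)) * (\<rho> - i) / 2"
  proof -
    have "\<mu> * d * (a * (1 - a)) * (\<rho> - i) / 2 = (a * R * u) * ((1 - a) * (\<rho> * R - i * R)) / 8"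
      unfolding \<mu> R(3)[symmetric] by (simp add: power2_eq_square algebra_simps)
    also have "\<dots> \<ge> (a * R * u) * (0.98 * 1.5) / 8"
    proof (intro divide_right_mono mult_left_mono mult_mono)
      show "1.5 \<le> \<rho> * R - i * R" using \<rho> i by (simp add: R_def)
    qed (use a02 aR u1 a in auto)
    finally have "(a * R * u) * (0.98 * 1.5) / 8 \<le> \<mu> * d * (a * (1 - a)) * (\<rho> - i) / 2" .
    moreover have "0.18 * z \<le> z * (0.98 * 1.5) / 8" if "0 \<le> z" for z :: real using that by simp
    moreover have "0 \<le> a * R * u" using aR u1 by simp
    ultimately show ?thesis using order.trans by blast
  qed
  have T1: "bin_entropy a \<le> 0.04 * (a * R * u)"
  proof -
    have "bin_entropy a \<le> a * (1 - ln a)" using a a02 by (intro bin_entropy_le_log) auto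
    also have "1 - ln a = u + ln (R / 2)"
    proof -
      have "a = 2 / (w * R)" using aR R by (simp add: w_def)
      then have "ln a = ln 2 - ln w - ln R" using w R by (simp add: ln_div ln_mult)
      then show ?thesis using R by (simp add: u' ln_div)
    qed
    also have "a * (u + ln (R / 2)) \<le> a * (u * (0.04 * R))"
    proof (rule mult_left_mono)
      have "ln (R / 2) \<le> ln R" using R by simp
      moreover have "1 * ln R \<le> u * ln R" using u1 R by (intro mult_right_mono) auto
      ultimately have "u + ln (R / 2) \<le> u * (1 + ln R)" by (simp add: algebra_simps)
      also have "\<dots> \<le> u * (0.04 * R)" using R u1 by (intro mult_left_mono) auto
      finally show "u + ln (R / 2) \<le> u * (0.04 * R)" .
    qed (use a in auto)
    finally show ?thesis by (simp add: mult_ac)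
  qed
  have gen: "h + (p - q) \<le> - (z / 20)" if "0 \<le> z" "h \<le> 0.04 * z" "p \<le> z * (1 / 24)" "0.18 * z \<le> q" for h p q z :: real
    using that by simp
  have "0 \<le> a * R * u" using aR u1 by simp
  then show "bin_entropy a + (d * (\<mu> * (a * (1 - a)))\<^sup>2 * exp \<mu> / 4 - \<mu> * d * (a * (1 - a)) * (\<rho> - i) / 2) \<le> - (a * sqrt d * u / 20)"
    using T1 T2 T3 unfolding R_def[symmetric] by (rule gen)
qed

text \<open>The scaling leaves no dependence on \<open>a\<close> except through
  \<open>exp \<mu>\<close>. Ignoring that factor and \<open>i\<close>, the exponent is
  \<open>m ^ 2 / 4 - m * x / 2\<close> with \<open>x = \<rho> * sqrt d\<close>, smallest at
  \<open>m = x\<close> with value \<open>- x ^ 2 / 4\<close>.\<close>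

lemma exponent_scaled:
  fixes d v m \<rho> i :: real
  assumes "0 < d" "0 < v" "\<mu> = m / (v * sqrt d)"
  shows "d * (\<mu> * v)\<^sup>2 * exp \<mu> / 4 - \<mu> * d * v * (\<rho> - i) / 2 = m\<^sup>2 * exp \<mu> / 4 - m * (\<rho> * sqrt d - i * sqrt d) / 2"
proof -
  define R where "R = sqrt d"
  have R: "0 < R" "R\<^sup>2 = d" using assms by (auto simp: R_def)
  have mv: "\<mu> * v = m / R" using assms by (simp add: R_def)
  have "d * (\<mu> * v)\<^sup>2 = m\<^sup>2" unfolding mv power_divide R(2) using assms(1) by simp
  moreover have "\<mu> * d * v * (\<rho> - i) = m * (\<rho> * R - i * R)"
  proof -
    have "\<mu> * d * v * (\<rho> - i) = (\<mu> * v) * R\<^sup>2 * (\<rho> - i)" using R by simp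
    also have "\<dots> = (m / R * R\<^sup>2) * (\<rho> - i)" unfolding mv ..
    also have "m / R * R\<^sup>2 = m * R" using R(1) by (simp add: power2_eq_square)
    also have "m * R * (\<rho> - i) = m * (\<rho> * R - i * R)" by (simp add: algebra_simps)
    finally show ?thesis .
  qed
  ultimately show ?thesis by (simp add: R_def)
qed

text \<open>The scaled parameter is \<open>m = 1\<close>, and \<open>a * sqrt d \<ge> 2\<close>
  keeps \<open>\<mu>\<close> below 0.51. The quadratic term is then at most 0.5125 and the entropy
  at most 0.21, against a gain of almost 0.8.\<close>

lemma exponent_mid:
  fixes d a \<rho> i :: real
  assumes d: "0 < d" and a: "0 < a" "a \<le> 1 / 100" "2 \<le> a * sqrt d"
    and \<rho>: "1.5957 \<le> \<rho> * sqrt d" and i: "i * sqrt d \<le> 0.00001"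
    and \<mu>: "\<mu> = 1 / (a * (1 - a) * sqrt d)"
  shows "bin_entropy a + (d * (\<mu> * (a * (1 - a)))\<^sup>2 * exp \<mu> / 4 - \<mu> * d * (a * (1 - a)) * (\<rho> - i) / 2) \<le> - 0.0001"
proof -
  have v0: "0 < a * (1 - a)" using a by simp
  have mu: "\<mu> \<le> 0.51"
  proof -
    have "2 * 0.99 \<le> (a * sqrt d) * (1 - a)" using a by (intro mult_mono) auto
    moreover have "1 / X \<le> 1 / (2 * 0.99)" if "2 * 0.99 \<le> X" for X :: real
      using that by (intro divide_left_mono) auto
    ultimately have "\<mu> \<le> 1 / (2 * 0.99)" unfolding \<mu> by (metis mult.commute mult.left_commute)
    then show ?thesis by simp
  qed
  have "exp \<mu> \<le> 1 / (1 - \<mu>)"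
    using exp_ge_add_one_self[of "- \<mu>"] mu by (simp add: exp_minus field_simps)
  also have "\<dots> \<le> 1 / 0.49" using mu by (intro divide_left_mono) auto
  finally have "exp \<mu> / 4 \<le> 5125 / 10000" by simp
  moreover have "bin_entropy a \<le> 21 / 100" using bin_entropy_small[OF a(1,2)] by simp
  moreover have "15957 / 10000 \<le> \<rho> * sqrt d" "i * sqrt d \<le> 1 / 100000" using \<rho> i by simp_all
  ultimately have "bin_entropy a + (exp \<mu> / 4 - (\<rho> * sqrt d - i * sqrt d) / 2) \<le> - (1 / 10000)"
    by argo
  then show ?thesis using exponent_scaled[OF d v0 \<mu>, of \<rho> i] by simp
qed



lemma ln2_bound: "ln 2 \<le> (0.6932 :: real)"
proof -
  obtain t where "exp 0.6932 = (\<Sum>m<8. 0.6932 ^ m / fact m) + exp t / fact 8 * (0.6932::real) ^ 8"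
    using Maclaurin_exp_le[of "0.6932" 8] by blast
  moreover have "2 \<le> (\<Sum>m<8. (0.6932::real) ^ m / fact m)"
    by (simp add: eval_nat_numeral lessThan_Suc fact_numeral)
  moreover have "0 \<le> exp t / fact 8 * (0.6932::real) ^ 8" by simp
  ultimately have "2 \<le> exp (0.6932::real)" by linarith
  then show ?thesis by (metis ln_exp ln_mono zero_less_numeral)
qed

text \<open>The fixed choice \<open>m = 1.5957\<close> is optimal, up to the factor
  \<open>exp \<mu>\<close>, at the smallest admissible \<open>x = \<rho> * sqrt d\<close> and keeps
  the exponent linear in \<open>x\<close>. The entropy deficit settles \<open>a \<le> 3 / 10\<close>
  and the Chernoff gain settles \<open>x \<ge> 2\<close>; only nearly balanced cuts with
  \<open>x\<close> close to the threshold need the factor \<open>Phi\<close>.\<close>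

lemma exponent_ranges:
  fixes d a \<rho> i :: real
  assumes d: "0 < d" and a: "1 / 100 \<le> a" "a \<le> 1 / 2" and y: "1.5957 \<le> \<rho> * sqrt d"
    and i: "i * sqrt d \<le> 0.00001" and \<mu>: "\<mu> = 1.5957 / (a * (1 - a) * sqrt d)" "exp \<mu> \<le> 1.00005"
    and E: "E = bin_entropy a + (d * (\<mu> * (a * (1 - a)))\<^sup>2 * exp \<mu> / 4 - \<mu> * d * (a * (1 - a)) * (\<rho> - i) / 2)"
  shows "a \<le> 3 / 10 \<Longrightarrow> E \<le> - 0.0001" and "2 \<le> \<rho> * sqrt d \<Longrightarrow> E \<le> - 0.0001"
    and "3 / 10 \<le> a \<Longrightarrow> \<rho> * sqrt d \<le> 2 \<Longrightarrow> g = \<rho> * sqrt d / (2 * sqrt (a * (1 - a))) \<Longrightarrow>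
      0 \<le> g \<and> g \<le> 3 \<and> E + ln (Phi g + 0.00002) \<le> - 0.0001"
proof -
  define m where "m = (1.5957 :: real)"
  define Y where "Y = \<rho> * sqrt d"
  define \<delta> where "\<delta> = 1 / 2 - a"
  have v0: "0 < a * (1 - a)" using a by simp
  have E': "E = bin_entropy a + (m\<^sup>2 * exp \<mu> / 4 - m * (Y - i * sqrt d) / 2)"
    unfolding E m_def Y_def using exponent_scaled[OF d v0 \<mu>(1), of \<rho> i] by simp
  have h: "bin_entropy a \<le> ln 2 - 2 * \<delta>\<^sup>2" unfolding \<delta>_def using a by (intro bin_entropy_le_quadratic) auto
  have m2: "m\<^sup>2 * exp \<mu> / 4 \<le> m\<^sup>2 / 4 + 0.000033"
    using \<mu>(2) by (simp add: m_def power2_eq_square)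
  \<comment> \<open>0.000042 collects the losses through \<open>exp \<mu>\<close> and through
    \<open>i\<close>.\<close>
  have E1: "E \<le> ln 2 - 2 * \<delta>\<^sup>2 + m\<^sup>2 / 4 - m * Y / 2 + 0.000042"
    using h m2 i unfolding E' m_def by (simp add: field_simps)
  have Ym: "m \<le> Y" using y by (simp add: Y_def m_def)
  {
    assume "a \<le> 3 / 10"
    then have "(2 / 10)\<^sup>2 \<le> \<delta>\<^sup>2" unfolding \<delta>_def by (intro power_mono) auto
    moreover have "m * m \<le> m * Y" using Ym by (simp add: m_def)
    ultimately show "E \<le> - 0.0001" using E1 ln2_bound by (simp add: m_def power2_eq_square)
  }
  {
    assume "2 \<le> \<rho> * sqrt d"
    then have "m * 2 \<le> m * Y" by (simp add: m_def Y_def)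
    moreover have "E \<le> ln 2 + m\<^sup>2 / 4 - m * Y / 2 + 0.000042" using E1 zero_le_power2[of \<delta>] by linarith
    ultimately show "E \<le> - 0.0001" using ln2_bound by (simp add: m_def power2_eq_square)
  }
  {
    assume a3: "3 / 10 \<le> a" and Y2: "\<rho> * sqrt d \<le> 2" and g: "g = \<rho> * sqrt d / (2 * sqrt (a * (1 - a)))"
    define \<kappa> where "\<kappa> = 2 * sqrt (a * (1 - a))"
    define e where "e = \<delta>\<^sup>2"
    have e: "0 \<le> e" "e \<le> 0.04"
    proof -
      show "0 \<le> e" by (simp add: e_def)
      have "e \<le> (2 / 10)\<^sup>2" unfolding e_def using a3 a by (intro power_mono) (auto simp: \<delta>_def)
      then show "e \<le> 0.04" by (simp add: power2_eq_square)
    qed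
    have \<kappa>2: "\<kappa>\<^sup>2 = 1 - 4 * e" using v0 by (simp add: \<kappa>_def power_mult_distrib e_def \<delta>_def power2_eq_square algebra_simps)
    have \<kappa>0: "0 < \<kappa>" using v0 by (simp add: \<kappa>_def)
    have \<kappa>1: "\<kappa> \<le> 1" by (rule power2_le_imp_le) (use \<kappa>2 e in auto)
    \<comment> \<open>The expansion of \<open>(1 - 4 * e) powr (- 1 / 2)\<close> starts with
      \<open>1 + 2 * e\<close>; the coefficient 2.3 covers the rest for
      \<open>e \<le> 0.04\<close>.\<close>
    have inv: "1 / \<kappa> \<le> 1 + 2.3 * e"
    proof -
      have "1 \<le> (1 + 2.3 * e)\<^sup>2 * (1 - 4 * e)"
      proof -
        have "(1 + 2.3 * e)\<^sup>2 * (1 - 4 * e) = 1 + e * (0.6 - 13.11 * e - 21.16 * e * e)"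
          by (simp add: power2_eq_square field_simps)
        moreover have "e * e \<le> 4 / 100 * e" "e \<le> 4 / 100" using e mult_right_mono[of e "4 / 100" e] by auto
        then have "0 \<le> 6 / 10 - 1311 / 100 * e - 2116 / 100 * (e * e)" by linarith
        then have "0 \<le> 0.6 - 13.11 * e - 21.16 * e * e" by (simp add: mult.assoc)
        then have "0 \<le> e * (0.6 - 13.11 * e - 21.16 * e * e)" using e by (intro mult_nonneg_nonneg) auto
        ultimately show ?thesis by linarith
      qed
      also have "\<dots> = ((1 + 2.3 * e) * \<kappa>)\<^sup>2" by (simp add: power_mult_distrib \<kappa>2)
      finally have "1 \<le> (1 + 2.3 * e) * \<kappa>" using e \<kappa>0 by (intro power2_le_imp_le[of 1]) auto
      then show ?thesis using \<kappa>0 by (simp add: divide_le_eq)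
    qed
    have gY: "g = Y * (1 / \<kappa>)" by (simp add: g Y_def \<kappa>_def)
    have Y0: "0 < Y" "Y \<le> 2" using Ym Y2 by (auto simp: m_def Y_def)
    have gle: "g \<le> Y + 4.6 * e"
    proof -
      have "g \<le> Y * (1 + 2.3 * e)" unfolding gY using inv Y0 by (intro mult_left_mono) auto
      also have "\<dots> = Y + Y * (2.3 * e)" by (simp add: algebra_simps)
      also have "Y * (2.3 * e) \<le> 2 * (2.3 * e)" using Y0 e by (intro mult_right_mono) auto
      finally show ?thesis by simp
    qed
    have mg: "m \<le> g"
    proof -
      have "Y * 1 \<le> g" unfolding gY using \<kappa>0 \<kappa>1 Y0 by (intro mult_left_mono) auto
      then show ?thesis using Ym by simp
    qed
    have Pm: "1 / 2 \<le> Phi m" using Phi_mono[of 0 m] Phi_0 by (simp add: m_def)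
    \<comment> \<open>0.12 bounds the normal density beyond \<open>m\<close>, hence the growth rate
      of \<open>Phi\<close> there.\<close>
    have Pg: "Phi g \<le> Phi m + 0.12 * (g - m)"
    proof (rule Phi_le_add[OF mg])
      fix x assume "- g \<le> x" "x \<le> - m"
      then have "m\<^sup>2 \<le> (- x)\<^sup>2" by (intro power_mono) (auto simp: m_def)
      then have "m\<^sup>2 \<le> x\<^sup>2" by simp
      have "std_normal_density x = 1 / sqrt (2 * pi) * exp (- (x\<^sup>2 / 2))" by (simp add: std_normal_density_def)
      also have "\<dots> \<le> 0.39895 * exp (- (1.27))"
        using inverse_sqrt_2pi_bounds \<open>m\<^sup>2 \<le> x\<^sup>2\<close> by (intro mult_mono) (auto simp: m_def power2_eq_square)
      also have "exp (- (1.27)) \<le> (0.3::real)"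
      proof -
        obtain t where "exp 1.27 = (\<Sum>m<4. 1.27 ^ m / fact m) + exp t / fact 4 * (1.27::real) ^ 4"
          using Maclaurin_exp_le[of "1.27" 4] by blast
        moreover have "1 / 0.3 \<le> (\<Sum>m<4. (1.27::real) ^ m / fact m)"
          by (simp add: eval_nat_numeral lessThan_Suc fact_numeral)
        moreover have "0 \<le> exp t / fact 4 * (1.27::real) ^ 4" by simp
        ultimately have "1 / 0.3 \<le> exp (1.27::real)" by linarith
        then show ?thesis by (simp add: exp_minus field_simps)
      qed
      finally show "std_normal_density x \<le> 0.12" by simp
    qed
    \<comment> \<open>\<open>1 \<le> 2 * Phi m\<close> turns the additive increase into a relative
      one and doubles 0.12 and 0.00002.\<close>
    have lnP: "ln (Phi g + 0.00002) \<le> ln (Phi m) + (0.24 * (g - m) + 0.00004)"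
    proof -
      have P0: "0 < Phi m" "0 \<le> Phi g" using Pm Phi_nonneg by auto
      have "Phi g + 0.00002 \<le> Phi m + (0.12 * (g - m) + 0.00002)" using Pg by simp
      also have "0.12 * (g - m) + 0.00002 \<le> (2 * Phi m) * (0.12 * (g - m) + 0.00002)"
        using Pm mg mult_right_mono[of 1 "2 * Phi m" "0.12 * (g - m) + 0.00002"] by simp
      also have "Phi m + (2 * Phi m) * (0.12 * (g - m) + 0.00002) = Phi m * (1 + (0.24 * (g - m) + 0.00004))"
        by (simp add: algebra_simps)
      also have "\<dots> \<le> Phi m * exp (0.24 * (g - m) + 0.00004)"
        using P0 by (intro mult_left_mono exp_ge_add_one_self) auto
      finally have "ln (Phi g + 0.00002) \<le> ln (Phi m * exp (0.24 * (g - m) + 0.00004))"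
        using P0 by (intro ln_mono) auto
      then show ?thesis using P0 by (simp add: ln_mult)
    qed
    \<comment> \<open>The increase \<open>0.24 * (g - m)\<close> is split along
      \<open>g \<le> Y + 4.6 * e\<close>: the part in \<open>Y - m\<close> is covered by the
      Chernoff slope \<open>m / 2\<close>, the part \<open>1.104 * e\<close> by the entropy deficit
      \<open>2 * e\<close>. The slack 0.0002 pays the remaining 0.00004 and 0.000042.\<close>
    have gen: "E + L \<le> - 0.0001" if "L \<le> P + (0.24 * (g - m) + 0.00004)" "c - M + P \<le> - 0.0002" "q = 2 * M + r"
        "0.24 * (Y - m) \<le> r" "E \<le> c - 2 * e + M - q + 0.000042" "g \<le> Y + 4.6 * e" "0 \<le> e" for L P c M q r :: real
      using that by (simp add: field_simps)
    have "E + ln (Phi g + 0.00002) \<le> - 0.0001"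
    proof (rule gen[OF lnP])
      show "ln 2 - m\<^sup>2 / 4 + ln (Phi m) \<le> - 0.0002" unfolding m_def by (rule ln_Phi_numeric)
      show "m * Y / 2 = 2 * (m\<^sup>2 / 4) + m * (Y - m) / 2" by (simp add: power2_eq_square field_simps)
      show "0.24 * (Y - m) \<le> m * (Y - m) / 2"
        using mult_right_mono[of "0.48" m "Y - m"] Ym by (simp add: m_def)
    qed (use E1 gle e in \<open>auto simp: e_def\<close>)
    moreover have "0 \<le> g" using mg by (simp add: m_def)
    moreover have "g \<le> 3" using gle Y0 e by simp
    ultimately show "0 \<le> g \<and> g \<le> 3 \<and> E + ln (Phi g + 0.00002) \<le> - 0.0001" by simp
  }
qed

section \<open>Expected number of extremal cuts\<close>

text \<open>
  The necessary condition that \<open>extremal_cut\<close> imposes on a cut of maximal relative deviation with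
  \<open>k l\<close> crossing edges in the \<open>l\<close>-th matching.
\<close>

definition local_event :: "nat \<Rightarrow> nat \<Rightarrow> real \<Rightarrow> nat set \<Rightarrow> (nat \<Rightarrow> nat) \<Rightarrow> (nat \<Rightarrow> nat set set) set" where
  "local_event n d \<tau> S k = {M. (\<forall>l<d. card (cross_edges (M l) S) = k l) \<and>
     (\<forall>v\<in>{1..n}. - (cut_deviation n d \<tau> (card S) k * real d / 2) \<le>
        \<tau> * (real (card {l \<in> {..<d}. v \<in> cross_verts (M l) S}) - (\<Sum>l<d. vertex_rate n S (k l) v)))}"

lemma prob_local_event_le:
  assumes "even n"
  shows "measure_pmf.prob (matchings_pmf n d) (local_event n d \<tau> S k) \<le> (\<Prod>l<d. cross_prob n S (k l))"
proof -
  have "measure_pmf.prob (matchings_pmf n d) (local_event n d \<tau> S k) \<le>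
     measure_pmf.prob (matchings_pmf n d) {M. \<forall>l<d. card (cross_edges (M l) S) = k l}"
    by (rule measure_pmf.finite_measure_mono) (auto simp: local_event_def)
  then show ?thesis using prob_cross_vector[OF assms, of d S k] by simp
qed

text \<open>
  Very uneven vectors \<open>k\<close> are excluded separately because for them the vertex rates, and with them
  the variance in the central limit theorem, could be far from their typical value.
\<close>

lemma prod_cross_prob_spread:
  assumes n: "even n" and S: "S \<subseteq> {1..n}" "0 < card S" "2 * card S \<le> n" and a: "a = real (card S) / real n"
    and W: "1 \<le> W * (real (n choose card S) * a ^ card S * (1 - a) ^ (n - card S))" "0 \<le> W"
    and k: "\<And>l. l < d \<Longrightarrow> k l \<le> card S" and V: "1 \<le> (\<Sum>l<d. (real (k l) / real n - a * (1 - a))\<^sup>2)"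
  shows "(\<Prod>l<d. cross_prob n S (k l)) \<le> W ^ d * exp (real n * (- 0.8))"
proof -
  have Sn: "card S < n" using S by linarith
  have a01: "0 < a" "a \<le> 1 / 2" using S a by (auto simp: divide_le_eq)
  define v where "v = a * (1 - a)"
  have v: "0 \<le> v" "v \<le> 1 / 4"
    using a01 zero_le_power2[of "a - 1/2"] by (auto simp: v_def power2_eq_square algebra_simps)
  define \<delta> where "\<delta> l = v - real (k l) / real n" for l
  \<comment> \<open>The Chernoff parameter is chosen for each matching separately, as
    \<open>2 * \<delta> l\<close>. Since \<open>3 * v ^ 2 \<le> 3 / 16\<close>, this leaves the rate
    0.8, which exceeds \<open>ln 2\<close>; so a total spread of 1 already beats the
    entropy.\<close>
  have step: "cross_prob n S (k l) \<le> W * exp (real n * (- 0.8 * (\<delta> l)\<^sup>2))" if "l < d" for l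
  proof -
    have \<kappa>: "0 \<le> real (k l) / real n" "real (k l) / real n \<le> 1 / 2"
    proof -
      have "real (k l) / real n \<le> a" unfolding a using k[OF that] by (intro divide_right_mono) auto
      then show "real (k l) / real n \<le> 1 / 2" using a01(2) by linarith
    qed simp
    have \<delta>: "\<bar>\<delta> l\<bar> \<le> 1 / 2" unfolding \<delta>_def using \<kappa> v by linarith
    have e3: "exp \<bar>2 * \<delta> l\<bar> \<le> 3"
    proof -
      have "exp \<bar>2 * \<delta> l\<bar> \<le> exp 1" using \<delta> by (simp add: abs_mult)
      then show ?thesis using exp_le by linarith
    qed
    have "(2 * \<delta> l * v)\<^sup>2 * exp \<bar>2 * \<delta> l\<bar> / 4 - 2 * \<delta> l * (v - real (k l) / real n) / 2 \<le> - 0.8 * (\<delta> l)\<^sup>2"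
    proof -
      have "v\<^sup>2 * exp \<bar>2 * \<delta> l\<bar> \<le> (1 / 4)\<^sup>2 * 3" using v e3 by (intro mult_mono power_mono) auto
      then have "v\<^sup>2 * exp \<bar>2 * \<delta> l\<bar> - 1 \<le> - 0.8" by (simp add: power2_eq_square)
      then have "(\<delta> l)\<^sup>2 * (v\<^sup>2 * exp \<bar>2 * \<delta> l\<bar> - 1) \<le> (\<delta> l)\<^sup>2 * (- 0.8)" by (intro mult_left_mono) auto
      moreover have "(2 * \<delta> l * v)\<^sup>2 * exp \<bar>2 * \<delta> l\<bar> / 4 - 2 * \<delta> l * (v - real (k l) / real n) / 2 = (\<delta> l)\<^sup>2 * (v\<^sup>2 * exp \<bar>2 * \<delta> l\<bar> - 1)"
        unfolding \<delta>_def[symmetric] by (simp add: power2_eq_square algebra_simps)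
      ultimately show ?thesis by (simp add: mult.commute)
    qed
    then have "exp (real n * ((2 * \<delta> l * v)\<^sup>2 * exp \<bar>2 * \<delta> l\<bar> / 4 - 2 * \<delta> l * (v - real (k l) / real n) / 2)) \<le> exp (real n * (- 0.8 * (\<delta> l)\<^sup>2))"
      by (subst exp_le_cancel_iff) (rule mult_left_mono, auto)
    then have "W * exp (real n * ((2 * \<delta> l * v)\<^sup>2 * exp \<bar>2 * \<delta> l\<bar> / 4 - 2 * \<delta> l * (v - real (k l) / real n) / 2)) \<le> W * exp (real n * (- 0.8 * (\<delta> l)\<^sup>2))"
      using W(2) by (rule mult_left_mono)
    moreover have "cross_prob n S (k l) \<le> W * exp (real n * ((2 * \<delta> l * v)\<^sup>2 * exp \<bar>2 * \<delta> l\<bar> / 4 - 2 * \<delta> l * (v - real (k l) / real n) / 2))"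
      unfolding v_def by (rule cross_prob_le_exp[OF n S(1,2) Sn a W(1)])
    ultimately show ?thesis by linarith
  qed
  have "(\<Prod>l<d. cross_prob n S (k l)) \<le> (\<Prod>l<d. W * exp (real n * (- 0.8 * (\<delta> l)\<^sup>2)))"
    using step by (intro prod_mono) (auto simp: cross_prob_def)
  also have "\<dots> = W ^ d * exp (real n * (- 0.8 * (\<Sum>l<d. (\<delta> l)\<^sup>2)))"
    by (simp add: prod.distrib exp_sum[symmetric] sum_distrib_left)
  also have "\<dots> \<le> W ^ d * exp (real n * (- 0.8))"
  proof (rule mult_left_mono)
    have "(\<Sum>l<d. (\<delta> l)\<^sup>2) = (\<Sum>l<d. (real (k l) / real n - a * (1 - a))\<^sup>2)"
      by (simp add: \<delta>_def v_def power2_commute)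
    then have "- 0.8 * (\<Sum>l<d. (\<delta> l)\<^sup>2) \<le> - 0.8" using V by simp
    then show "exp (real n * (- 0.8 * (\<Sum>l<d. (\<delta> l)\<^sup>2))) \<le> exp (real n * (- 0.8))"
      by (subst exp_le_cancel_iff) (rule mult_left_mono, auto)
  qed (use W in auto)
  finally show ?thesis .
qed

text \<open>With \<open>q = \<kappa> l / p\<close>,
  \<open>q * (1 - q) - v = (q - (1 - p)) * (p - q)\<close> and
  \<open>q - (1 - p) = (\<kappa> l - v) / p\<close>, so each trial loses at most
  \<open>4 * \<bar>\<kappa> l - v\<bar>\<close>. Cauchy-Schwarz turns the squared spread into the
  total loss \<open>4 * sqrt d\<close>.\<close>

lemma sum_rate_variance_ge:
  fixes \<kappa> :: "nat \<Rightarrow> real"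
  assumes p: "3 / 10 \<le> p" "p \<le> 1" and v: "v = p * (1 - p)" and q: "\<And>l. l < d \<Longrightarrow> 0 \<le> \<kappa> l / p \<and> \<kappa> l / p \<le> 1"
    and V: "(\<Sum>l<d. (\<kappa> l - v)\<^sup>2) \<le> 1"
  shows "real d * v - 4 * sqrt (real d) \<le> (\<Sum>l<d. \<kappa> l / p * (1 - \<kappa> l / p))"
proof -
  have le: "v - 4 * \<bar>\<kappa> l - v\<bar> \<le> \<kappa> l / p * (1 - \<kappa> l / p)" if "l < d" for l
  proof -
    let ?q = "\<kappa> l / p"
    have e: "?q * (1 - ?q) - v = (?q - (1 - p)) * (p - ?q)" by (simp add: v algebra_simps)
    have "\<bar>p - ?q\<bar> \<le> 1" using q[OF that] p by linarith
    then have "\<bar>(?q - (1 - p)) * (p - ?q)\<bar> \<le> \<bar>?q - (1 - p)\<bar> * 1"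
      unfolding abs_mult by (intro mult_left_mono) auto
    also have "\<dots> \<le> 4 * \<bar>\<kappa> l - v\<bar>"
    proof -
      have q': "?q - (1 - p) = (\<kappa> l - v) / p" using p by (simp add: v field_simps)
      have "\<bar>\<kappa> l - v\<bar> * 1 \<le> \<bar>\<kappa> l - v\<bar> * (4 * p)" using p by (intro mult_left_mono) auto
      then show ?thesis unfolding q' using p by (simp add: abs_divide divide_le_eq mult_ac)
    qed
    finally show ?thesis using e by linarith
  qed
  have "(\<Sum>l<d. \<bar>\<kappa> l - v\<bar>) \<le> sqrt (real d)"
  proof (rule real_le_rsqrt)
    have "(\<Sum>l<d. \<bar>\<kappa> l - v\<bar>)\<^sup>2 \<le> (\<Sum>l<d. \<bar>\<kappa> l - v\<bar>\<^sup>2) * real (card {..<d})"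
      by (rule sum_squared_le_sum_of_squares)
    also have "\<dots> \<le> 1 * real d" using V by (intro mult_mono) (auto intro: sum_nonneg)
    finally show "(\<Sum>l<d. \<bar>\<kappa> l - v\<bar>)\<^sup>2 \<le> real d" by simp
  qed
  moreover have "(\<Sum>l<d. v - 4 * \<bar>\<kappa> l - v\<bar>) \<le> (\<Sum>l<d. \<kappa> l / p * (1 - \<kappa> l / p))"
    using le by (intro sum_mono) auto
  ultimately show ?thesis by (simp add: sum_subtractf sum_distrib_left[symmetric])
qed

text \<open>The typical rate is \<open>1 - a\<close> inside \<open>S\<close> and \<open>a\<close>
  outside, so both sides have nominal variance \<open>v = a * (1 - a)\<close> and one value
  \<open>Phi g\<close> serves all vertices; \<open>g\<close> is the threshold
  \<open>\<rho> * d / 2\<close> in units of \<open>sqrt (d * v)\<close>.\<close>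

lemma prob_local_event_le_Phi:
  assumes n: "even n" and S: "S \<subseteq> {1..n}" "0 < card S" "2 * card S \<le> n" and a: "a = real (card S) / real n" "3 / 10 \<le> a"
    and k: "\<And>l. l < d \<Longrightarrow> k l \<le> card S" and V: "(\<Sum>l<d. (real (k l) / real n - a * (1 - a))\<^sup>2) \<le> 1"
    and \<tau>: "\<tau> = 1 \<or> \<tau> = -1" and d: "0 < d"
    and \<rho>: "\<rho> = cut_deviation n d \<tau> (card S) k" and g: "g = \<rho> * sqrt (real d) / (2 * sqrt (a * (1 - a)))" "0 \<le> g" "g \<le> 3"
    and clt: "\<And>q v g \<tau>. (\<forall>l<d. 0 \<le> q l \<and> q l \<le> 1) \<and> 1 / 5 \<le> v \<and> 0 \<le> g \<and> g \<le> 3 \<and> \<bar>\<tau>\<bar> = 1 \<and>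
      real d * v - 4 * sqrt (real d) \<le> (\<Sum>l<d. q l * (1 - q l)) \<Longrightarrow>
     bernoulli_sum_avg d q (\<lambda>m. if - g * sqrt (real d * v) \<le> \<tau> * (real m - (\<Sum>l<d. q l)) then 1 else 0) \<le> Phi g + \<omega>"
  shows "measure_pmf.prob (matchings_pmf n d) (local_event n d \<tau> S k)
     \<le> (\<Prod>l<d. cross_prob n S (k l)) * (real (n + 1)) ^ (2 * d) * (Phi g + \<omega>) ^ n"
proof -
  have Sn: "card S < n" "0 < n" using S by linarith+
  have a01: "0 < a" "a \<le> 1 / 2" using S a by (auto simp: divide_le_eq)
  define v where "v = a * (1 - a)"
  have v5: "1 / 5 \<le> v"
  proof -
    have "0 \<le> (a - 3 / 10) * (7 / 10 - a)" using a(2) a01 by (intro mult_nonneg_nonneg) auto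
    then show ?thesis unfolding v_def by (simp add: algebra_simps)
  qed
  define ok where "ok x (m::nat) \<longleftrightarrow> - (\<rho> * real d / 2) \<le> \<tau> * (real m - (\<Sum>l<d. vertex_rate n S (k l) x))" for x m
  have gd: "g * sqrt (real d * v) = \<rho> * real d / 2"
  proof -
    have "sqrt (real d) * sqrt (real d) = real d" by simp
    moreover have "0 < sqrt v" using v5 by simp
    ultimately show ?thesis unfolding g(1) v_def[symmetric] real_sqrt_mult by (simp add: field_simps)
  qed
  have rate: "0 \<le> vertex_rate n S (k l) x" "vertex_rate n S (k l) x \<le> 1" if "l < d" for l x
    using k[OF that] S Sn by (auto simp: vertex_rate_def divide_le_eq of_nat_diff)
  have each: "bernoulli_sum_avg d (\<lambda>l. vertex_rate n S (k l) x) (\<lambda>m. if ok x m then 1 else 0) \<le> Phi g + \<omega>" for x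
  proof -
    define p where "p = (if x \<in> S then a else 1 - a)"
    have p: "3 / 10 \<le> p" "p \<le> 1" "v = p * (1 - p)" using a(2) a01 by (auto simp: p_def v_def)
    have r: "vertex_rate n S (k l) x = (real (k l) / real n) / p" for l
    proof -
      have "real (n - card S) = real n * (1 - a)" using Sn a by (simp add: of_nat_diff field_simps)
      then show ?thesis using Sn a(1) by (auto simp: vertex_rate_def p_def)
    qed
    have var: "real d * v - 4 * sqrt (real d) \<le> (\<Sum>l<d. vertex_rate n S (k l) x * (1 - vertex_rate n S (k l) x))"
      unfolding r by (rule sum_rate_variance_ge[OF p]) (use rate[of _ x, unfolded r] V in \<open>auto simp: v_def\<close>)
    have "(\<lambda>m. if ok x m then 1 else 0 :: real) = (\<lambda>m. if - g * sqrt (real d * v) \<le> \<tau> * (real m - (\<Sum>l<d. vertex_rate n S (k l) x)) then 1 else 0)"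
      unfolding ok_def gd[symmetric] by simp
    then show ?thesis using clt[of "\<lambda>l. vertex_rate n S (k l) x" v g \<tau>] rate v5 g \<tau> var by auto
  qed
  have "measure_pmf.prob (matchings_pmf n d) (local_event n d \<tau> S k)
    \<le> (\<Prod>l<d. cross_prob n S (k l)) * (real (n + 1)) ^ (2 * d) *
       (\<Prod>x\<in>{1..n}. bernoulli_sum_avg d (\<lambda>l. vertex_rate n S (k l) x) (\<lambda>m. if ok x m then 1 else 0))"
  proof -
    have "local_event n d \<tau> S k = {M. (\<forall>l<d. card (cross_edges (M l) S) = k l) \<and>
       (\<forall>v\<in>{1..n}. ok v (card {l \<in> {..<d}. v \<in> cross_verts (M l) S}))}"
      by (simp add: local_event_def ok_def \<rho>)
    moreover have "k l \<le> card S \<and> k l \<le> n - card S" if "l < d" for l using k[OF that] S by auto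
    ultimately show ?thesis using prob_cross_vector_local[OF n S(1,2) Sn(1), of d k ok] by simp
  qed
  also have "\<dots> \<le> (\<Prod>l<d. cross_prob n S (k l)) * (real (n + 1)) ^ (2 * d) * (\<Prod>x\<in>{1..n}. Phi g + \<omega>)"
  proof (intro mult_left_mono prod_mono conjI each mult_nonneg_nonneg prod_nonneg)
    fix x
    show "0 \<le> bernoulli_sum_avg d (\<lambda>l. vertex_rate n S (k l) x) (\<lambda>m. if ok x m then 1 else 0)"
      unfolding bernoulli_sum_avg_def using rate by (intro sum_nonneg mult_nonneg_nonneg prod_nonneg) auto
  qed (auto simp: cross_prob_def)
  finally show ?thesis by simp
qed


lemma eventually_poly_exp:
  assumes "0 < c"
  shows "eventually (\<lambda>n::nat. K * ln (real n + 1) + 2 * ln (real n) \<le> c * real n) sequentially"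
    "eventually (\<lambda>n::nat. K * ln (real n + 1) + 2 * ln (real n) \<le> c * sqrt (real n)) sequentially"
  using assms by real_asymp+

text \<open>The factor \<open>(card S + 1) ^ d\<close> counts the possible vectors \<open>k\<close>.\<close>

definition negligible_local_events :: "nat \<Rightarrow> nat \<Rightarrow> bool" where
  "negligible_local_events n d \<longleftrightarrow> (\<forall>S \<tau> k. S \<subseteq> {1..n} \<and> 0 < card S \<and> 2 * card S \<le> n \<and>
     (\<tau> = 1 \<or> \<tau> = -1) \<and> (\<forall>l<d. k l \<le> card S) \<and> 1.5957 \<le> cut_deviation n d \<tau> (card S) k * sqrt (real d) \<longrightarrow>
     real (n choose card S) * real (card S + 1) ^ d * measure_pmf.prob (matchings_pmf n d) (local_event n d \<tau> S k) \<le> 1 / (real n)\<^sup>2)"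

text \<open>\<open>D\<close> makes the exponent negative uniformly in \<open>a\<close> and
  \<open>\<rho>\<close>; only then does \<open>N\<close>, which depends on \<open>d\<close>, make it
  beat powers of \<open>n\<close> of degree up to \<open>4 * d\<close>.\<close>

lemma eventually_negligible_local_events:
  "\<exists>D>0. \<forall>d\<ge>D. \<exists>N>0. \<forall>n\<ge>N. even n \<longrightarrow> negligible_local_events n d"
proof -
  obtain D1 where D1: "D1 > 0" "\<And>d q v g \<tau>. d \<ge> D1 \<Longrightarrow> (\<forall>l<d. 0 \<le> q l \<and> q l \<le> 1) \<and> 1 / 5 \<le> v \<and> 0 \<le> g \<and> g \<le> 3 \<and> \<bar>\<tau>\<bar> = 1 \<and>
      real d * v - 4 * sqrt (real d) \<le> (\<Sum>l<d. q l * (1 - q l)) \<Longrightarrow>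
     bernoulli_sum_avg d q (\<lambda>m. if - g * sqrt (real d * v) \<le> \<tau> * (real m - (\<Sum>l<d. q l)) then 1 else 0) \<le> Phi g + 0.00002"
    using bernoulli_sum_tail_uniform[of "0.00002"] by auto
  have "eventually (\<lambda>d::nat. 100 \<le> sqrt (real d)) sequentially"
    "eventually (\<lambda>d::nat. 1 + ln (sqrt (real d)) \<le> 0.04 * sqrt (real d)) sequentially"
    \<comment> \<open>0.0099 is the minimum of \<open>a * (1 - a)\<close> for
      \<open>1 / 100 \<le> a \<le> 1 / 2\<close>.\<close>
    "eventually (\<lambda>d::nat. exp (1.5957 / (0.0099 * sqrt (real d))) \<le> 1.00005) sequentially"
    by real_asymp+
  then have "eventually (\<lambda>d::nat. 100 \<le> sqrt (real d) \<and> 1 + ln (sqrt (real d)) \<le> 0.04 * sqrt (real d) \<and>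
      exp (1.5957 / (0.0099 * sqrt (real d))) \<le> 1.00005) sequentially"
    by (intro eventually_conj)
  then obtain D2 where D2: "\<And>d. d \<ge> D2 \<Longrightarrow> 100 \<le> sqrt (real d)" "\<And>d. d \<ge> D2 \<Longrightarrow> 1 + ln (sqrt (real d)) \<le> 0.04 * sqrt (real d)"
    "\<And>d. d \<ge> D2 \<Longrightarrow> exp (1.5957 / (0.0099 * sqrt (real d))) \<le> 1.00005"
    by (auto simp: eventually_sequentially)
  show ?thesis
  proof (rule exI[of _ "max D1 D2"], intro conjI allI impI)
    show "0 < max D1 D2" using D1 by simp
    fix d assume "max D1 D2 \<le> d"
    then have dD: "D1 \<le> d" "D2 \<le> d" "0 < d" using D1(1) by auto
    define R where "R = sqrt (real d)"
    have R: "100 \<le> R" "1 + ln R \<le> 0.04 * R" "exp (1.5957 / (0.0099 * R)) \<le> 1.00005"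
      using D2[OF dD(2)] by (auto simp: R_def)
    have R0: "0 < R" using R by linarith
    \<comment> \<open>The first condition makes \<open>i\<close> negligible. The next three beat the
      polynomial factors for sets of linear size, for smaller sets of more than
      \<open>sqrt n\<close> vertices, and for sets of at most \<open>sqrt n\<close>
      vertices.\<close>
    have "eventually (\<lambda>n::nat. 1 / (real n - 1) * R \<le> 0.00001) sequentially" using R0 by real_asymp
    moreover have "eventually (\<lambda>n::nat. (4 * real d) * ln (real n + 1) + 2 * ln (real n) \<le> 0.0001 * real n) sequentially"
      by (rule eventually_poly_exp) simp
    moreover have "eventually (\<lambda>n::nat. (2 * real d) * ln (real n + 1) + 2 * ln (real n) \<le> (R / 20) * sqrt (real n)) sequentially"
      by (rule eventually_poly_exp) (use R0 in simp)
    moreover have "eventually (\<lambda>n::nat. (2 * real d + R / 20 * ln R) / (R / 40 - 2) \<le> ln (real n)) sequentially"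
      by real_asymp
    moreover have "eventually (\<lambda>n::nat. 2 \<le> n) sequentially" by (rule eventually_ge_at_top)
    ultimately have "eventually (\<lambda>n::nat. 1 / (real n - 1) * R \<le> 0.00001 \<and>
        (4 * real d) * ln (real n + 1) + 2 * ln (real n) \<le> 0.0001 * real n \<and>
        (2 * real d) * ln (real n + 1) + 2 * ln (real n) \<le> (R / 20) * sqrt (real n) \<and>
        (2 * real d + R / 20 * ln R) / (R / 40 - 2) \<le> ln (real n) \<and> 2 \<le> n) sequentially"
      by (intro eventually_conj)
    then obtain N where N: "\<And>n. n \<ge> N \<Longrightarrow> 1 / (real n - 1) * R \<le> 0.00001"
        "\<And>n. n \<ge> N \<Longrightarrow> (4 * real d) * ln (real n + 1) + 2 * ln (real n) \<le> 0.0001 * real n"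
        "\<And>n. n \<ge> N \<Longrightarrow> (2 * real d) * ln (real n + 1) + 2 * ln (real n) \<le> (R / 20) * sqrt (real n)"
        "\<And>n. n \<ge> N \<Longrightarrow> (2 * real d + R / 20 * ln R) / (R / 40 - 2) \<le> ln (real n)"
        "\<And>n. n \<ge> N \<Longrightarrow> 2 \<le> n"
      unfolding eventually_sequentially by blast
    show "\<exists>N>0. \<forall>n\<ge>N. even n \<longrightarrow> negligible_local_events n d"
      unfolding negligible_local_events_def
    proof (intro exI[of _ "Suc N"] conjI allI impI)
      fix n S k and \<tau> :: real
      assume nN: "Suc N \<le> n" and n: "even n"
      assume H: "S \<subseteq> {1..n} \<and> 0 < card S \<and> 2 * card S \<le> n \<and> (\<tau> = 1 \<or> \<tau> = -1) \<and> (\<forall>l<d. k l \<le> card S) \<and>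
        1.5957 \<le> cut_deviation n d \<tau> (card S) k * sqrt (real d)"
      define s where "s = card S"
      define a where "a = real (card S) / real n"
      define \<rho> where "\<rho> = cut_deviation n d \<tau> (card S) k"
      define i where "i = 1 / (real n - 1)"
      define P where "P = measure_pmf.prob (matchings_pmf n d) (local_event n d \<tau> S k)"
      define Q where "Q = (\<Prod>l<d. cross_prob n S (k l))"
      define B where "B = real (n choose card S) * a ^ card S * (1 - a) ^ (n - card S)"
      have S: "S \<subseteq> {1..n}" "0 < card S" "2 * card S \<le> n" "card S < n" using H by auto
      have \<tau>: "\<tau> = 1 \<or> \<tau> = -1" using H by auto
      have k: "k l \<le> card S" if "l < d" for l using H that by auto
      have y: "1.5957 \<le> \<rho> * R" using H by (simp add: \<rho>_def R_def)
      have n2: "2 \<le> n" "0 < real n" using N(5)[of n] nN by auto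
      have s1: "1 \<le> real s" "0 < s" "s < n" "real s \<le> real n" using S by (auto simp: s_def)
      have a01: "0 < a" "a \<le> 1 / 2" using S n2 by (auto simp: a_def divide_le_eq)
      have na: "real n * a = real s" using n2 by (simp add: a_def s_def)
      have i: "0 \<le> i" "i * R \<le> 0.00001" using N(1)[of n] nN n2 by (auto simp: i_def)
      have \<rho>0: "0 \<le> \<rho>"
      proof (rule ccontr)
        assume "\<not> 0 \<le> \<rho>"
        then have "\<rho> * R \<le> 0" using R0 by (intro mult_nonpos_nonneg) auto
        with y show False by simp
      qed
      have d0: "0 < real d" using dD by simp
      have PQ: "P \<le> Q" unfolding P_def Q_def by (rule prob_local_event_le[OF n])
      have P0: "0 \<le> P" by (simp add: P_def)
      have W1: "1 \<le> real (n + 1) * B" unfolding B_def a_def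
        by (rule binomial_prob_mode_ge) (use S in auto)
      have W2: "1 \<le> exp (real s) * B" unfolding B_def a_def s_def
        by (rule binomial_prob_mode_ge_exp) (use S in auto)
      have C: "real (n choose card S) \<le> exp (real n * bin_entropy a)"
        by (rule binomial_le_exp_entropy) (use S in \<open>auto simp: a_def\<close>)
      have Qle: "Q \<le> W ^ d * exp (real n * (real d * (\<mu> * (a * (1 - a)))\<^sup>2 * exp \<mu> / 4 - \<mu> * real d * (a * (1 - a)) * (\<rho> - i) / 2))"
        if "1 \<le> W * B" "0 \<le> \<mu>" for W \<mu>
        unfolding Q_def i_def
        by (rule prod_cross_prob_le[OF n S(1,2,4) a_def _ \<tau> \<rho>_def \<rho>0 dD(3) that(2)]) (use that(1) in \<open>simp add: B_def\<close>)
      have goal_eq: "1 / (real n)\<^sup>2 = exp (- (2 * ln (real n)))"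
        using n2 by (simp add: exp_minus exp_of_nat_mult[of 2, simplified] inverse_eq_divide)
      have comb: "real (n choose card S) * real (card S + 1) ^ d * P \<le> real (s + 1) ^ d * F * exp (real n * (bin_entropy a + E))"
        if "P \<le> F * exp (real n * E)" "0 \<le> F" for F E
      proof -
        have "real (n choose card S) * real (card S + 1) ^ d * P \<le> exp (real n * bin_entropy a) * real (s + 1) ^ d * (F * exp (real n * E))"
          using C P0 that unfolding s_def by (intro mult_mono) auto
        then show ?thesis by (simp add: distrib_left exp_add mult_ac)
      qed
      have pow: "real (n + 1) ^ j = exp (real j * ln (real n + 1))" for j
        by (simp add: exp_of_nat_mult add_pos_pos add.commute)
      \<comment> \<open>\<open>F\<close> may contain \<open>(n + 1) ^ d\<close> from fixing the set
        size and \<open>(n + 1) ^ (2 * d)\<close> from the comparison with independent vertices; the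
        number of vectors \<open>k\<close> adds another \<open>(n + 1) ^ d\<close>.\<close>
      have big: "real (n choose card S) * real (card S + 1) ^ d * P \<le> 1 / (real n)\<^sup>2"
        if "P \<le> F * exp (real n * E)" "0 \<le> F" "F \<le> real (n + 1) ^ (3 * d)" "bin_entropy a + E \<le> - 0.0001" for F E
      proof -
        have "real (n choose card S) * real (card S + 1) ^ d * P \<le> real (s + 1) ^ d * F * exp (real n * (bin_entropy a + E))"
          by (rule comb[OF that(1,2)])
        also have "\<dots> \<le> real (n + 1) ^ d * real (n + 1) ^ (3 * d) * exp (real n * (- 0.0001))"
        proof (intro mult_mono power_mono that(2,3))
          have "real n * (bin_entropy a + E) \<le> real n * (- 0.0001)" by (rule mult_left_mono[OF that(4)]) simp
          then show "exp (real n * (bin_entropy a + E)) \<le> exp (real n * (- 0.0001))" by simp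
        qed (use s1 that(2) in auto)
        also have "\<dots> = exp ((4 * real d) * ln (real n + 1) + real n * (- 0.0001))"
          unfolding power_add[symmetric] pow exp_add[symmetric] by simp
        also have "\<dots> \<le> exp (- (2 * ln (real n)))" using N(2)[of n] nN by simp
        finally show ?thesis unfolding goal_eq .
      qed
      have fin: "real (n choose card S) * real (card S + 1) ^ d * P \<le> 1 / (real n)\<^sup>2"
      proof (cases "a * R < 2")
        case True
        define u where "u = 1 + ln (2 / (a * R))"
        define \<mu> where "\<mu> = u / 4"
        note es = exponent_small[of "real d" a \<rho> i u \<mu>, folded R_def, OF R(1,2) a01(1) True y i u_def \<mu>_def]
        let ?E = "real d * (\<mu> * (a * (1 - a)))\<^sup>2 * exp \<mu> / 4 - \<mu> * real d * (a * (1 - a)) * (\<rho> - i) / 2"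
        have mu0: "0 \<le> \<mu>" using es(1) by (simp add: \<mu>_def)
        have nE: "real n * (bin_entropy a + ?E) \<le> - (real s * (R * u / 20))"
        proof -
          have "real n * (bin_entropy a + ?E) \<le> real n * (- (a * R * u / 20))" by (rule mult_left_mono[OF es(2)]) simp
          also have "\<dots> = - (real n * a * (R * u / 20))" by simp
          finally show ?thesis unfolding na .
        qed
        show ?thesis
        proof (cases "real s \<le> sqrt (real n)")
          \<comment> \<open>Both the weight and the number of vectors are bounded by
            \<open>exp s ^ d\<close>, so the loss is \<open>2 * d\<close> per vertex of
            \<open>S\<close>. The gain per vertex is \<open>R * u / 20\<close>, and \<open>u\<close>
            contains \<open>ln n / 2\<close> because \<open>a \<le> 1 / sqrt n\<close>.\<close>
          case True
          have "P \<le> exp (real s) ^ d * exp (real n * ?E)" using PQ Qle[OF W2 mu0] by linarith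
          then have "real (n choose card S) * real (card S + 1) ^ d * P \<le> real (s + 1) ^ d * exp (real s) ^ d * exp (real n * (bin_entropy a + ?E))"
            by (rule comb) simp
          also have "\<dots> \<le> exp (real s) ^ d * exp (real s) ^ d * exp (- (real s * (R * u / 20)))"
            using nE exp_ge_add_one_self[of "real s"] by (intro mult_mono power_mono) auto
          also have "\<dots> = exp (- (real s * (R * u / 20 - 2 * real d)))"
            by (simp flip: exp_of_nat_mult exp_add add: algebra_simps)
          also have "\<dots> \<le> exp (- (1 * (2 * ln (real n))))"
          proof -
            have "- ln a \<ge> 1 / 2 * ln (real n)"
            proof -
              have "a = real s / (sqrt (real n) * sqrt (real n))" by (simp add: a_def s_def)
              also have "\<dots> \<le> sqrt (real n) / (sqrt (real n) * sqrt (real n))" using True by (intro divide_right_mono) auto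
              also have "\<dots> = 1 / sqrt (real n)" by (simp add: divide_divide_eq_left[symmetric] del: real_sqrt_mult_self)
              finally have "ln a \<le> ln (1 / sqrt (real n))" using a01 by (intro ln_mono) auto
              then show ?thesis using n2 by (simp add: ln_div ln_sqrt)
            qed
            moreover have "u = 1 + ln 2 - ln a - ln R" unfolding u_def using a01 R0 by (simp add: ln_div ln_mult)
            ultimately have "1 / 2 * ln (real n) - ln R \<le> u" using ln_ge_zero[of 2] by linarith
            then have "R / 20 * (1 / 2 * ln (real n) - ln R) \<le> R / 20 * u" using R0 by (intro mult_left_mono) auto
            moreover have "2 * real d + R / 20 * ln R \<le> ln (real n) * (R / 40 - 2)"
            proof -
              have "0 < R / 40 - 2" using R(1) by simp
              moreover have "(2 * real d + R / 20 * ln R) / (R / 40 - 2) \<le> ln (real n)" using N(4)[of n] nN by simp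
              ultimately show ?thesis by (simp only: pos_divide_le_eq)
            qed
            ultimately have "2 * ln (real n) \<le> R * u / 20 - 2 * real d" by (simp add: algebra_simps)
            moreover have "0 \<le> 2 * ln (real n)" using n2 by simp
            ultimately have "1 * (2 * ln (real n)) \<le> real s * (R * u / 20 - 2 * real d)" using s1 by (intro mult_mono) auto
            then show ?thesis by simp
          qed
          finally show ?thesis unfolding goal_eq by simp
        next
          case False
          \<comment> \<open>With more than \<open>sqrt n\<close> vertices, \<open>u \<ge> 1\<close>
            suffices: the gain \<open>exp (- R * sqrt n / 20)\<close> outweighs every power of
            \<open>n\<close>.\<close>
          have "P \<le> real (n + 1) ^ d * exp (real n * ?E)" using PQ Qle[OF W1 mu0] by linarith
          then have "real (n choose card S) * real (card S + 1) ^ d * P \<le> real (s + 1) ^ d * real (n + 1) ^ d * exp (real n * (bin_entropy a + ?E))"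
            by (rule comb) simp
          also have "\<dots> \<le> real (n + 1) ^ d * real (n + 1) ^ d * exp (- ((R / 20) * sqrt (real n)))"
          proof (intro mult_mono power_mono)
            have "sqrt (real n) * (R * 1 / 20) \<le> real s * (R * u / 20)"
              using False es(1) R0 by (intro mult_mono divide_right_mono mult_left_mono) auto
            then show "exp (real n * (bin_entropy a + ?E)) \<le> exp (- ((R / 20) * sqrt (real n)))"
              using nE by (simp add: mult_ac)
          qed (use s1 in auto)
          also have "\<dots> = exp ((2 * real d) * ln (real n + 1) - (R / 20) * sqrt (real n))"
            unfolding power_add[symmetric] pow exp_add[symmetric] by simp
          also have "\<dots> \<le> exp (- (2 * ln (real n)))" using N(3)[of n] nN by simp
          finally show ?thesis unfolding goal_eq .
        qed
      next
        case False
        have nd: "real (n + 1) ^ d \<le> real (n + 1) ^ (3 * d)" by (intro power_increasing) auto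
        show ?thesis
        proof (cases "a \<le> 1 / 100")
          case True
          define \<mu> where "\<mu> = 1 / (a * (1 - a) * R)"
          have mu0: "0 \<le> \<mu>" using a01 R0 by (simp add: \<mu>_def)
          have "P \<le> real (n + 1) ^ d * exp (real n * (real d * (\<mu> * (a * (1 - a)))\<^sup>2 * exp \<mu> / 4 - \<mu> * real d * (a * (1 - a)) * (\<rho> - i) / 2))"
            using PQ Qle[OF W1 mu0] by linarith
          then show ?thesis
          proof (rule big)
            show "bin_entropy a + (real d * (\<mu> * (a * (1 - a)))\<^sup>2 * exp \<mu> / 4 - \<mu> * real d * (a * (1 - a)) * (\<rho> - i) / 2) \<le> - 0.0001"
              by (rule exponent_mid[OF d0 a01(1) True]) (use False y i in \<open>auto simp: R_def \<mu>_def\<close>)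
          qed (use nd in auto)
        next
          case a100: False
          define \<mu> where "\<mu> = 1.5957 / (a * (1 - a) * R)"
          have mu0: "0 \<le> \<mu>" using a01 R0 by (simp add: \<mu>_def)
          have emu: "exp \<mu> \<le> 1.00005"
          proof -
            have "0.01 * 0.99 \<le> a * (1 - a)"
            proof -
              have "0 \<le> (a - 1 / 100) * (99 / 100 - a)" using a100 a01 by (intro mult_nonneg_nonneg) auto
              then show ?thesis by (simp add: field_simps)
            qed
            then have "0.0099 * R \<le> a * (1 - a) * R" using R0 by (intro mult_right_mono) auto
            then have "\<mu> \<le> 1.5957 / (0.0099 * R)" unfolding \<mu>_def using R0 a01 by (intro divide_left_mono) auto
            then have "exp \<mu> \<le> exp (1.5957 / (0.0099 * R))" by simp
            then show ?thesis using R(3) by linarith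
          qed
          define E where "E = bin_entropy a + (real d * (\<mu> * (a * (1 - a)))\<^sup>2 * exp \<mu> / 4 - \<mu> * real d * (a * (1 - a)) * (\<rho> - i) / 2)"
          let ?E = "real d * (\<mu> * (a * (1 - a)))\<^sup>2 * exp \<mu> / 4 - \<mu> * real d * (a * (1 - a)) * (\<rho> - i) / 2"
          have a1: "1 / 100 \<le> a" using a100 by simp
          note er = exponent_ranges[of "real d" a \<rho> i \<mu> E, folded R_def, OF d0 a1 a01(2) y i(2) \<mu>_def emu E_def]
          have Qm: "Q \<le> real (n + 1) ^ d * exp (real n * ?E)" by (rule Qle[OF W1 mu0])
          show ?thesis
          proof (cases "a \<le> 3 / 10 \<or> 2 \<le> \<rho> * R")
            case True
            then have "E \<le> - 0.0001" using er(1,2) by blast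
            moreover have "P \<le> real (n + 1) ^ d * exp (real n * ?E)" using PQ Qm by linarith
            ultimately show ?thesis using big[of "real (n + 1) ^ d" ?E] nd unfolding E_def by simp
          next
            case nT: False
            show ?thesis
            proof (cases "1 \<le> (\<Sum>l<d. (real (k l) / real n - a * (1 - a))\<^sup>2)")
              case True
              have "Q \<le> real (n + 1) ^ d * exp (real n * (- 0.8))"
                unfolding Q_def by (rule prod_cross_prob_spread[OF n S(1-3) a_def _ _ k True]) (use W1 in \<open>auto simp: B_def\<close>)
              then have "P \<le> real (n + 1) ^ d * exp (real n * (- 0.8))" using PQ by linarith
              then show ?thesis
              proof (rule big)
                have "bin_entropy a \<le> ln 2 - 2 * (1 / 2 - a)\<^sup>2" using a01 by (rule bin_entropy_le_quadratic)
                then have "bin_entropy a \<le> ln 2" using zero_le_power2[of "1 / 2 - a"] by linarith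
                then show "bin_entropy a + - 0.8 \<le> - 0.0001" using ln2_bound by simp
              qed (use nd in auto)
            next
              case V: False
              define g where "g = \<rho> * R / (2 * sqrt (a * (1 - a)))"
              have g: "0 \<le> g" "g \<le> 3" "E + ln (Phi g + 0.00002) \<le> - 0.0001"
                using er(3)[OF _ _ g_def] nT by auto
              have Pg: "0 < Phi g + 0.00002" using Phi_nonneg[of g] by (simp add: add_nonneg_pos)
              have "P \<le> Q * (real (n + 1)) ^ (2 * d) * (Phi g + 0.00002) ^ n"
                unfolding P_def Q_def
                by (rule prob_local_event_le_Phi[OF n S(1-3) a_def _ k _ \<tau> dD(3) \<rho>_def g_def[unfolded R_def] g(1,2) D1(2)[OF dD(1)]])
                  (use nT V in auto)
              also have "\<dots> \<le> (real (n + 1) ^ d * exp (real n * ?E)) * (real (n + 1)) ^ (2 * d) * (Phi g + 0.00002) ^ n"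
                using Qm Pg by (intro mult_right_mono) auto
              also have "(Phi g + 0.00002) ^ n = exp (real n * ln (Phi g + 0.00002))"
                using Pg by (simp add: exp_of_nat_mult)
              also have "(real (n + 1) ^ d * exp (real n * ?E)) * (real (n + 1)) ^ (2 * d) * exp (real n * ln (Phi g + 0.00002))
                = real (n + 1) ^ (3 * d) * exp (real n * (?E + ln (Phi g + 0.00002)))"
              proof -
                have "real (n + 1) ^ (3 * d) = real (n + 1) ^ d * real (n + 1) ^ (2 * d)" by (simp flip: power_add)
                then show ?thesis by (simp add: distrib_left exp_add mult_ac)
              qed
              finally show ?thesis
              proof (rule big)
                show "bin_entropy a + (?E + ln (Phi g + 0.00002)) \<le> - 0.0001" using g(3) unfolding E_def by (simp add: add.assoc)
              qed auto
            qed
          qed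
        qed
      qed
      then show "real (n choose card S) * real (card S + 1) ^ d * measure_pmf.prob (matchings_pmf n d) (local_event n d \<tau> S k) \<le> 1 / (real n)\<^sup>2"
        unfolding P_def .
    qed simp
  qed
qed

section \<open>The sparsifier theorem\<close>

text \<open>A union bound over sign, size, set and vector of crossing counts; the weights in
  \<open>negligible_local_events\<close> cancel the last two, so each sign and size costs
  \<open>1 / n ^ 2\<close>.\<close>

lemma prob_not_sparsifier_le:
  assumes "even n" "2 \<le> n" "0 < d" and \<epsilon>: "1.5957 \<le> \<epsilon> * sqrt (real d)"
    and w: "negligible_local_events n d"
  shows "measure_pmf.prob (matchings_pmf n d) {M. \<not> cut_sparsifier \<epsilon>
     (weighted_multigraph n ((real n - 1) / real d) (\<Sum>i<d. mset_set (M i))) (complete_wgraph n)} \<le> 2 / real n"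
proof -
  let ?P = "matchings_pmf n d"
  let ?bad = "{M. \<not> cut_sparsifier \<epsilon> (weighted_multigraph n ((real n - 1) / real d) (\<Sum>i<d. mset_set (M i))) (complete_wgraph n)}"
  define T where "T = {1, -1 :: real}"
  define F where "F s = {S. S \<subseteq> {1..n} \<and> card S = s}" for s
  define Z where "Z = {1..n div 2}"
  define G where "G s = {..<d} \<rightarrow>\<^sub>E {0..s}" for s :: nat
  \<comment> \<open>Emptying the event below the threshold lets the union run over finite index sets
    that do not depend on the matchings.\<close>
  define A where "A \<tau> S k = (if 1.5957 \<le> cut_deviation n d \<tau> (card S) k * sqrt (real d) then local_event n d \<tau> S k else {})" for \<tau> S k
  have finF: "finite (F s)" for s unfolding F_def by (rule finite_subset[of _ "Pow {1..n}"]) auto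
  have finG: "finite (G s)" for s unfolding G_def by (intro finite_PiE) auto
  have cF: "card (F s) = n choose s" for s unfolding F_def using n_subsets[of "{1..n}" s] by simp
  have cG: "card (G s) = (s + 1) ^ d" for s unfolding G_def by (simp add: card_PiE)
  have A_le: "measure_pmf.prob ?P (A \<tau> S k) \<le> 1 / (real n)\<^sup>2 / (real (n choose s) * real (s + 1) ^ d)"
    if "\<tau> \<in> T" "s \<in> Z" "S \<in> F s" "k \<in> G s" for \<tau> s S k
  proof (cases "1.5957 \<le> cut_deviation n d \<tau> (card S) k * sqrt (real d)")
    case True
    have s: "card S = s" "S \<subseteq> {1..n}" "0 < s" "2 * s \<le> n" using that by (auto simp: F_def Z_def)
    have k: "\<forall>l<d. k l \<le> card S" using that(4) s by (auto simp: G_def PiE_def Pi_def)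
    have "real (n choose s) * real (s + 1) ^ d * measure_pmf.prob ?P (A \<tau> S k) \<le> 1 / (real n)\<^sup>2"
      using w[unfolded negligible_local_events_def, rule_format, of S \<tau> k] s k True that(1) by (auto simp: A_def T_def)
    moreover have "0 < real (n choose s) * real (s + 1) ^ d" using s(4) by (intro mult_pos_pos) auto
    ultimately show ?thesis by (subst pos_le_divide_eq) (simp_all only: mult.commute)
  next
    case False
    then show ?thesis by (simp add: A_def)
  qed
  have "measure_pmf.prob ?P ?bad = measure_pmf.prob ?P (?bad \<inter> set_pmf ?P)" by (simp add: measure_Int_set_pmf)
  also have "\<dots> \<le> measure_pmf.prob ?P (\<Union>\<tau>\<in>T. \<Union>s\<in>Z. \<Union>S\<in>F s. \<Union>k\<in>G s. A \<tau> S k)"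
  proof (rule measure_pmf.finite_measure_mono)
    show "?bad \<inter> set_pmf ?P \<subseteq> (\<Union>\<tau>\<in>T. \<Union>s\<in>Z. \<Union>S\<in>F s. \<Union>k\<in>G s. A \<tau> S k)"
    proof
      fix M assume M: "M \<in> ?bad \<inter> set_pmf ?P"
      have pm: "M l \<in> perfect_matchings n" if "l < d" for l using M that set_matchings_pmf[OF assms(1)] by auto
      have n0: "0 < n" using assms(2) by simp
      have neg: "\<not> cut_sparsifier \<epsilon> (weighted_multigraph n ((real n - 1) / real d) (\<Sum>i<d. mset_set (M i))) (complete_wgraph n)"
        using M by simp
      obtain \<tau> :: real and S \<rho> where *: "\<tau> = 1 \<or> \<tau> = -1" "S \<subseteq> {1..n}" "0 < card S" "2 * card S \<le> n"
        "\<rho> = cut_deviation n d \<tau> (card S) (\<lambda>l. card (cross_edges (M l) S))" "\<epsilon> < \<rho>"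
        "\<And>v. v \<in> {1..n} \<Longrightarrow> - (\<rho> * real d / 2) \<le> \<tau> * (real (card {l \<in> {..<d}. v \<in> cross_verts (M l) S})
           - (\<Sum>l<d. vertex_rate n S (card (cross_edges (M l) S)) v))"
        using extremal_cut[OF n0 assms(3) pm neg] by blast
      \<comment> \<open>The restriction to \<open>{..<d}\<close> places the vector in the finite set
        \<open>G (card S)\<close> of extensional functions.\<close>
      define k where "k = (\<lambda>l\<in>{..<d}. card (cross_edges (M l) S))"
      have fS: "finite S" using *(2) finite_subset by auto
      have kl: "k l = card (cross_edges (M l) S)" if "l < d" for l using that by (simp add: k_def)
      have dev: "cut_deviation n d \<tau> (card S) k = \<rho>" unfolding *(5) cut_deviation_def using kl by simp
      have "card (cross_edges (M l) S) \<le> card S" if "l < d" for l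
        using card_cross_verts(1)[OF pm[OF that], of S] card_mono[of S "cross_verts (M l) S \<inter> S"] fS by auto
      then have kG: "k \<in> G (card S)" by (auto simp: G_def k_def)
      have "1.5957 \<le> \<rho> * sqrt (real d)"
        by (rule order.trans[OF \<epsilon>]) (use *(6) in \<open>intro mult_right_mono, auto\<close>)
      moreover have "M \<in> local_event n d \<tau> S k"
        unfolding local_event_def dev using *(7) kl by auto
      ultimately have "M \<in> A \<tau> S k" by (simp add: A_def dev)
      moreover have "\<tau> \<in> T" "card S \<in> Z" "S \<in> F (card S)" using * by (auto simp: T_def Z_def F_def)
      ultimately show "M \<in> (\<Union>\<tau>\<in>T. \<Union>s\<in>Z. \<Union>S\<in>F s. \<Union>k\<in>G s. A \<tau> S k)" using kG by blast
    qed
  qed auto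
  also have "\<dots> \<le> (\<Sum>\<tau>\<in>T. measure_pmf.prob ?P (\<Union>s\<in>Z. \<Union>S\<in>F s. \<Union>k\<in>G s. A \<tau> S k))"
    by (rule measure_pmf.finite_measure_subadditive_finite) (auto simp: T_def)
  also have "\<dots> \<le> (\<Sum>\<tau>\<in>T. \<Sum>s\<in>Z. measure_pmf.prob ?P (\<Union>S\<in>F s. \<Union>k\<in>G s. A \<tau> S k))"
    by (intro sum_mono measure_pmf.finite_measure_subadditive_finite) (auto simp: Z_def)
  also have "\<dots> \<le> (\<Sum>\<tau>\<in>T. \<Sum>s\<in>Z. \<Sum>S\<in>F s. measure_pmf.prob ?P (\<Union>k\<in>G s. A \<tau> S k))"
    by (intro sum_mono measure_pmf.finite_measure_subadditive_finite) (auto simp: finF)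
  also have "\<dots> \<le> (\<Sum>\<tau>\<in>T. \<Sum>s\<in>Z. \<Sum>S\<in>F s. \<Sum>k\<in>G s. measure_pmf.prob ?P (A \<tau> S k))"
    by (intro sum_mono measure_pmf.finite_measure_subadditive_finite) (auto simp: finG)
  also have "\<dots> \<le> (\<Sum>\<tau>\<in>T. \<Sum>s\<in>Z. \<Sum>S\<in>F s. \<Sum>k\<in>G s. 1 / (real n)\<^sup>2 / (real (n choose s) * real (s + 1) ^ d))"
    by (intro sum_mono A_le)
  also have "\<dots> = (\<Sum>\<tau>\<in>T. \<Sum>s\<in>Z. 1 / (real n)\<^sup>2)"
  proof (intro sum.cong refl)
    fix s assume "s \<in> Z"
    then have "0 < real (n choose s)" "0 < real (s + 1) ^ d" by (auto simp: Z_def)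
    then show "(\<Sum>S\<in>F s. \<Sum>k\<in>G s. 1 / (real n)\<^sup>2 / (real (n choose s) * real (s + 1) ^ d)) = 1 / (real n)\<^sup>2"
      by (simp add: cF cG del: of_nat_Suc of_nat_add)
  qed
  also have "\<dots> \<le> 2 * (real n / (real n)\<^sup>2)"
  proof -
    have "real (n div 2) / (real n)\<^sup>2 \<le> real n / (real n)\<^sup>2" by (intro divide_right_mono) auto
    then show ?thesis by (simp add: T_def Z_def)
  qed
  also have "\<dots> = 2 / real n" using assms(2) by (simp add: power2_eq_square)
  finally show ?thesis .
qed

lemma sqrt_two_over_pi_bounds: "1.5957 \<le> 2 * sqrt (2 / pi)" "2 * sqrt (2 / pi) < 1.596"
proof -
  have "pi \<le> 3.1415926535899" "3.141592653588 \<le> pi" by (rule pi_approx)+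
  then have "(1.5957 / 2)\<^sup>2 \<le> 2 / pi" "2 / pi < (1.596 / 2)\<^sup>2"
    using pi_gt_zero by (simp_all add: power2_eq_square le_divide_eq divide_less_eq)
  then have 1: "(1.5957 / 2)\<^sup>2 \<le> 2 / pi" and 2: "2 / pi < (1.596 / 2)\<^sup>2" by auto
  have "1.5957 / 2 \<le> sqrt (2 / pi)" by (rule real_le_rsqrt[OF 1])
  moreover have "sqrt (2 / pi) < 1.596 / 2"
    using real_sqrt_less_mono[OF 2] by simp
  ultimately show "1.5957 \<le> 2 * sqrt (2 / pi)" "2 * sqrt (2 / pi) < 1.596" by simp_all
qed

theorem mainTheorem1:
  shows "(\<exists>r :: nat \<Rightarrow> nat \<Rightarrow> real. small_o_nd r \<and>
      (\<forall>d>0. ((\<lambda>n. measure_pmf.prob (G_reg n d)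
          {H. \<exists>\<epsilon>. \<epsilon> \<le> (2 * sqrt (2 / pi) + r n d) / sqrt (real d) \<and>
             cut_sparsifier \<epsilon> (weighted_multigraph n ((real n - 1) / real d) H)
               (complete_wgraph n)})
        \<longlongrightarrow> 1) even_at_top)) \<and>
    1.595 \<le> 2 * sqrt (2 / pi) \<and> 2 * sqrt (2 / pi) < 1.596"
proof (intro conjI)
  show "1.595 \<le> 2 * sqrt (2 / pi)" using sqrt_two_over_pi_bounds(1) by simp
  show "2 * sqrt (2 / pi) < 1.596" by (rule sqrt_two_over_pi_bounds(2))
  obtain D where D: "\<And>d. d \<ge> D \<Longrightarrow> \<exists>N>0. \<forall>n\<ge>N. even n \<longrightarrow> negligible_local_events n d"
    using eventually_negligible_local_events by blast
  define r where "r = (\<lambda>(n::nat) d. if d < D then sqrt (real d) else 0)"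
  have o: "small_o_nd r"
    unfolding small_o_nd_def
  proof (intro exI[of _ "\<lambda>d. if d < D then sqrt (real d) else 0"] conjI allI impI)
    show "(\<lambda>d. if d < D then sqrt (real d) else 0) \<longlonglongrightarrow> 0"
    proof (rule tendsto_eventually)
      show "\<forall>\<^sub>F d in sequentially. (if d < D then sqrt (real d) else 0) = 0"
        using eventually_ge_at_top[of D] by eventually_elim auto
    qed
  qed (simp add: r_def)
  show "\<exists>r. small_o_nd r \<and> (\<forall>d>0. ((\<lambda>n. measure_pmf.prob (G_reg n d)
          {H. \<exists>\<epsilon>. \<epsilon> \<le> (2 * sqrt (2 / pi) + r n d) / sqrt (real d) \<and>
             cut_sparsifier \<epsilon> (weighted_multigraph n ((real n - 1) / real d) H)
               (complete_wgraph n)}) \<longlongrightarrow> 1) even_at_top)"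
  proof (intro exI[of _ r] conjI o allI impI)
    fix d :: nat assume d: "0 < d"
    let ?ok = "\<lambda>n. {H. \<exists>\<epsilon>. \<epsilon> \<le> (2 * sqrt (2 / pi) + r n d) / sqrt (real d) \<and>
             cut_sparsifier \<epsilon> (weighted_multigraph n ((real n - 1) / real d) H) (complete_wgraph n)}"
    let ?G = "\<lambda>M. \<Sum>i<d. mset_set (M i)"
    have prob: "measure_pmf.prob (G_reg n d) X = measure_pmf.prob (matchings_pmf n d) {M. ?G M \<in> X}" for n X
      unfolding G_reg_def matchings_pmf_def by (simp add: measure_map_pmf vimage_def)
    have bound: "1 - 2 / real n \<le> measure_pmf.prob (G_reg n d) (?ok n)" if n: "even n" "2 \<le> n"
      and ev: "d \<ge> D \<longrightarrow> negligible_local_events n d" for n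
    proof (cases "d < D")
      case True
      have "measure_pmf.prob (matchings_pmf n d) {M. ?G M \<in> ?ok n} = 1"
      proof (rule measure_pmf.prob_eq_1[THEN iffD2, OF _ AE_pmfI])
        fix M assume M: "M \<in> set_pmf (matchings_pmf n d)"
        have "cut_sparsifier 1 (weighted_multigraph n ((real n - 1) / real d) (?G M)) (complete_wgraph n)"
          by (rule cut_sparsifier_trivial) (use n d M set_matchings_pmf[OF n(1)] in auto)
        moreover have "1 \<le> (2 * sqrt (2 / pi) + r n d) / sqrt (real d)"
          using True d sqrt_two_over_pi_bounds(1) by (simp add: r_def le_divide_eq)
        ultimately show "M \<in> {M. ?G M \<in> ?ok n}" by blast
      qed simp
      then show ?thesis unfolding prob by simp
    next
      case False
      define \<epsilon> where "\<epsilon> = 2 * sqrt (2 / pi) / sqrt (real d)"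
      let ?bad = "{M. \<not> cut_sparsifier \<epsilon> (weighted_multigraph n ((real n - 1) / real d) (?G M)) (complete_wgraph n)}"
      have "measure_pmf.prob (matchings_pmf n d) ?bad \<le> 2 / real n"
        by (rule prob_not_sparsifier_le) (use n d ev False sqrt_two_over_pi_bounds in \<open>auto simp: \<epsilon>_def\<close>)
      then have "1 - 2 / real n \<le> measure_pmf.prob (matchings_pmf n d) (- ?bad)"
        using measure_pmf.prob_compl[of ?bad "matchings_pmf n d"] by (simp add: Compl_eq_Diff_UNIV)
      also have "\<dots> \<le> measure_pmf.prob (matchings_pmf n d) {M. ?G M \<in> ?ok n}"
      proof (rule measure_pmf.finite_measure_mono)
        have "\<epsilon> \<le> (2 * sqrt (2 / pi) + r n d) / sqrt (real d)" using False by (simp add: \<epsilon>_def r_def)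
        then show "- ?bad \<subseteq> {M. ?G M \<in> ?ok n}" by blast
      qed simp
      finally show ?thesis unfolding prob .
    qed
    obtain N where N: "d \<ge> D \<longrightarrow> (\<forall>n\<ge>N. even n \<longrightarrow> negligible_local_events n d)"
      using D[of d] by blast
    have lower: "eventually (\<lambda>n. 1 - 2 / real n \<le> measure_pmf.prob (G_reg n d) (?ok n)) even_at_top"
      unfolding eventually_inf_principal
      using eventually_ge_at_top[of "max 2 N"]
    proof eventually_elim
      case (elim n)
      show ?case
      proof
        assume "n \<in> {n. even n}"
        then show "1 - 2 / real n \<le> measure_pmf.prob (G_reg n d) (?ok n)"
          using elim N by (intro bound) auto
      qed
    qed
    have lim: "((\<lambda>n. 1 - 2 / real n) \<longlongrightarrow> 1) even_at_top"
    proof (rule tendsto_mono)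
      show "even_at_top \<le> sequentially" by simp
      show "(\<lambda>n. 1 - 2 / real n) \<longlonglongrightarrow> 1" by real_asymp
    qed
    show "((\<lambda>n. measure_pmf.prob (G_reg n d) (?ok n)) \<longlongrightarrow> 1) even_at_top"
      by (rule tendsto_sandwich[OF lower _ lim tendsto_const]) (simp add: always_eventually)
  qed
qed

end
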